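(* Let $d\ge 3$ and let $v:\mathbb{R}^d\to\mathbb{R}$ be a bounded Borel measurable function with bounded support. Let $x(t)\in\mathbb{R}^d$ and $y(t)\in\mathbb{R}^d$ be defined for $t>0$, and suppose that, as $t\to\infty$, $x(t)\to x\in\mathbb{R}^d$, while $|y(t)|\to\infty$ and $|y(t)|^2/t$ remains bounded. For each $t>0$ let $Z(t)=\int_0^t v(X_s)\,ds$, where $(X_s,0\le s\le t)$ is a $d$-dimensional Brownian bridge running for time $t$ with $X_0=x(t)$ and $X_t=y(t)$. Let $Y_x$ be the Brownian motion path integral defined in the context. Let $\alpha_0>0$ be such that $$E\exp\Big\{\alpha\int_0^\infty |v(W_z(s))|\,ds\Big\}<\infty\quad\text{for all } z\in\mathbb{R}^d \text{ and all } |\alpha|<\alpha_0 .$$ Then: (i) for every positive integer $k$, $E[Z(t)^k]\to E[(Y_x)^k]$ as $t\to\infty$; (ii) for every $\alpha\in(-\alpha_0,\alpha_0)$, $E e^{\alpha Z(t)}\to E e^{\alpha Y_x}$ as $t\to\infty$; (iii) if moreover $v$ is nonnegative and not almost everywhere zero, the convergence in (ii) holds for every $\alpha\in(-\infty,\alpha_1)$, where $\alpha_1\in(0,\infty)$ is the number such that $E e^{\alpha Y_z}<\infty$ for all $\alpha<\alpha_1$ and $z\in\mathbb{R}^d$, and $E e^{\alpha Y_z}=\infty$ for all $\alpha>\alpha_1$ and $z\in\mathbb{R}^d$.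
   Context: For $z\in\mathbb{R}^d$, $(W_z(s),s\ge0)$ denotes a standard $d$-dimensional Brownian motion (Wiener process) with $W_z(0)=z$, and $Y_z=\int_0^\infty v(W_z(s))\,ds$. A Brownian bridge of duration $t$ from $a$ to $b$ is standard Brownian motion started at $a$ and conditioned to be at $b$ at time $t$: with $q(t;x)=(2\pi t)^{-d/2}\exp(-|x|^2/(2t))$, its joint density at times $0<s_1<\dots<s_k<t$ and positions $z_1,\dots,z_k$ is $\big[\prod_{j=0}^{k}q(s_{j+1}-s_j;z_{j+1}-z_j)\big]/q(t;b-a)$, where $s_0=0$, $z_0=a$, $s_{k+1}=t$, $z_{k+1}=b$. The family $\{Z(t)\}$ is regarded only as a family of distributions indexed by $t$. A number $\alpha_0>0$ with the stated property exists, and when $v$ is nonnegative and not almost everywhere zero a number $\alpha_1\in(0,\infty)$ with the stated property exists. *)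

theory Defs
  imports "HOL-Probability.Probability"
begin

definition heat_kernel :: "real \<Rightarrow> 'a::euclidean_space \<Rightarrow> real" where
  "heat_kernel t x = (2 * pi * t) powr (- (real DIM('a) / 2)) * exp (- (norm x)\<^sup>2 / (2 * t))"

text \<open>All paths, not merely almost all, are continuous. Hence the process is jointly measurable
  and path integrals of bounded Borel functions are random variables on \<^term>\<open>M\<close> itself,
  which is not assumed to be complete.\<close>

definition brownian_motion ::
    "'w measure \<Rightarrow> 'a::euclidean_space \<Rightarrow> (real \<Rightarrow> 'w \<Rightarrow> 'a) \<Rightarrow> bool" where
  "brownian_motion M z W \<longleftrightarrow>
     prob_space M \<and>
     (\<forall>s\<ge>0. W s \<in> borel_measurable M) \<and>
     (\<forall>\<omega>\<in>space M. W 0 \<omega> = z) \<and>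
     (\<forall>\<omega>\<in>space M. continuous_on {0..} (\<lambda>s. W s \<omega>)) \<and>
     (\<forall>r s. 0 \<le> r \<and> r < s \<longrightarrow>
        distributed M lborel (\<lambda>\<omega>. W s \<omega> - W r \<omega>) (\<lambda>u. ennreal (heat_kernel (s - r) u))) \<and>
     (\<forall>k (s :: nat \<Rightarrow> real). 0 \<le> s 0 \<and> (\<forall>j<k. s j < s (Suc j)) \<longrightarrow>
        prob_space.indep_vars M (\<lambda>_. borel) (\<lambda>j \<omega>. W (s (Suc j)) \<omega> - W (s j) \<omega>) {..<k})"

text \<open>The conditioning of Brownian motion on its value at time \<^term>\<open>t\<close> is expressed through the
  joint densities at times \<open>0 = s 0 < s 1 < \<dots> < s k < s (k + 1) = t\<close>, with the positions
  \<open>z 0 = a\<close> and \<open>z (k + 1) = b\<close> pinned by the function updates.\<close>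

definition bridge_density ::
    "real \<Rightarrow> 'a::euclidean_space \<Rightarrow> 'a \<Rightarrow> nat \<Rightarrow> (nat \<Rightarrow> real) \<Rightarrow> (nat \<Rightarrow> 'a) \<Rightarrow> real" where
  "bridge_density t a b k s z =
     (let z' = z(0 := a, Suc k := b) in
      (\<Prod>j=0..k. heat_kernel (s (Suc j) - s j) (z' (Suc j) - z' j)) / heat_kernel t (b - a))"

definition brownian_bridge ::
    "'w measure \<Rightarrow> real \<Rightarrow> 'a::euclidean_space \<Rightarrow> 'a \<Rightarrow> (real \<Rightarrow> 'w \<Rightarrow> 'a) \<Rightarrow> bool" where
  "brownian_bridge M t a b X \<longleftrightarrow>
     prob_space M \<and>
     (\<forall>s\<in>{0..t}. X s \<in> borel_measurable M) \<and>
     (\<forall>\<omega>\<in>space M. X 0 \<omega> = a \<and> X t \<omega> = b) \<and>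
     (\<forall>\<omega>\<in>space M. continuous_on {0..t} (\<lambda>s. X s \<omega>)) \<and>
     (\<forall>k\<ge>1. \<forall>s :: nat \<Rightarrow> real.
        s 0 = 0 \<and> s (Suc k) = t \<and> (\<forall>j\<le>k. s j < s (Suc j)) \<longrightarrow>
        distributed M (\<Pi>\<^sub>M i\<in>{1..k}. lborel) (\<lambda>\<omega>. \<lambda>i\<in>{1..k}. X (s i) \<omega>)
          (\<lambda>z. ennreal (bridge_density t a b k s z)))"

definition path_integral :: "('a \<Rightarrow> real) \<Rightarrow> real set \<Rightarrow> (real \<Rightarrow> 'w \<Rightarrow> 'a) \<Rightarrow> 'w \<Rightarrow> real" where
  "path_integral v T X \<omega> = (LINT s:T|lborel. v (X s \<omega>))"

text \<open>For a nonnegative integrand the path integral over the half-line is taken in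
  \<open>[0, \<infinity>]\<close>, and its exponential moment accordingly uses \<open>exp \<infinity> = \<infinity>\<close>,
  \<open>exp (-\<infinity>) = 0\<close> and \<open>0 * \<infinity> = 0\<close>; a path with a divergent integral thus contributes
  \<open>\<infinity>\<close> when \<open>c > 0\<close>, rather than the default value of the Bochner integral.\<close>

definition exp_ereal :: "ereal \<Rightarrow> ennreal" where
  "exp_ereal u = (case u of ereal r \<Rightarrow> ennreal (exp r) | PInfty \<Rightarrow> \<infinity> | MInfty \<Rightarrow> 0)"

definition nn_exp_moment ::
    "'w measure \<Rightarrow> real \<Rightarrow> ('a \<Rightarrow> real) \<Rightarrow> (real \<Rightarrow> 'w \<Rightarrow> 'a) \<Rightarrow> ennreal" where
  "nn_exp_moment M c f W =
     (\<integral>\<^sup>+\<omega>. exp_ereal (ereal c * enn2ereal (\<integral>\<^sup>+s\<in>{0..}. ennreal (f (W s \<omega>)) \<partial>lborel)) \<partial>M)"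

end

theory Submission
  imports Defs
begin

text \<open>Expanding a power of the path integral of \<open>f = \<bar>v\<bar>\<close> over ordered times turns the \<open>k\<close>-th moment under
  the bridge from \<open>a\<close> to \<open>b\<close> into \<open>k! A\<^sub>k(t, a, b) / q(t; b - a)\<close>, and that of the Brownian motion over
  the half-line into \<open>k! B\<^sub>k(a)\<close>, where \<open>B\<^sub>k\<close> is the \<open>k\<close>-fold potential of \<open>f\<close>. Among the \<open>k + 1\<close> time gaps in
  \<open>A\<^sub>k\<close> one is at least \<open>t / (k + 1)\<close>; bounding its heat kernel by the maximum decouples the rest, so
  \<open>A\<^sub>k(t, a, b) \<le> (2 \<pi> t / (k + 1))\<^bsup>-d/2\<^esup> (\<Sum>i\<le>k. B\<^sub>i(a) B\<^bsub>k-i\<^esub>(b))\<close>. The polynomial factor does not change the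
  radius of convergence, so the bridge has bounded exponential moments at every rate below \<open>\<alpha>\<^sub>0\<close>,
  once finiteness of \<open>\<Sum>k. \<alpha>\<^sup>k B\<^sub>k(z)\<close> for every \<open>z\<close> is improved to boundedness in \<open>z\<close>.

  On a fixed time interval \<open>[0, T]\<close> the moments under the bridge converge to those of the Brownian motion,
  hence so do expectations of continuous functions. The time spent in the support of \<open>v\<close> after \<open>T\<close> is
  small: before \<open>t / 2\<close> by transience, after \<open>t / 2\<close> because the reversed bridge starts at the
  distant point \<open>y(t)\<close>.\<close>

section \<open>The heat kernel\<close>

text \<open>The bound on the bridge is uniform in t because two powers cancel: the gap estimate
  carries t^(-d/2), while 1 / q(t; b - a) equals (2 \<pi> t)^(d/2) exp(|b - a|^2 / (2t)), and this
  exponential stays bounded when |y(t)|^2 / t does. The same hypothesis makes q(t - \<tau>; y - z) /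
  q(t; y - x) tend to 1, which is why the bridge looks like free Brownian motion on a fixed
  interval. The condition d \<ge> 3 enters as integrability of s^(-d/2) at infinity.

  The function v may change sign, whereas Tonelli computes moments only for nonnegative integrands.
  Absolute bounds therefore use |v|, and the limit on a bounded horizon uses v + K with |v| \<le> K,
  which shifts the path integral by a constant.

  All three claims are instances of one limit theorem for continuous test functions \<phi> with
  |\<phi>(z)| \<le> C exp(b |z|), where b lies below a rate at which the path integral of |v| has
  finite exponential moments.\<close>

definition heat :: "real \<Rightarrow> 'a::euclidean_space \<Rightarrow> 'a \<Rightarrow> ennreal" where
  "heat t x y = ennreal (heat_kernel t (y - x))"

lemma heat_kernel_nonneg [simp]: "0 \<le> heat_kernel t x"
  by (simp add: heat_kernel_def)

lemma heat_kernel_pos: "0 < t \<Longrightarrow> 0 < heat_kernel t x"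
  by (simp add: heat_kernel_def)

lemma borel_measurable_heat_kernel [measurable (raw)]:
  fixes g :: "'b \<Rightarrow> 'a::euclidean_space"
  assumes [measurable]: "f \<in> borel_measurable M" "g \<in> borel_measurable M"
  shows "(\<lambda>w. heat_kernel (f w) (g w)) \<in> borel_measurable M"
  unfolding heat_kernel_def by measurable

lemma borel_measurable_heat [measurable (raw)]:
  fixes g h :: "'b \<Rightarrow> 'a::euclidean_space"
  assumes [measurable]: "f \<in> borel_measurable M" "g \<in> borel_measurable M" "h \<in> borel_measurable M"
  shows "(\<lambda>w. heat (f w) (g w) (h w)) \<in> borel_measurable M"
  unfolding heat_def by measurable

lemma heat_commute: "heat t x y = heat t y x"
  by (simp add: heat_def heat_kernel_def norm_minus_commute)

text \<open>Factorisation into one-dimensional normal densities; the total mass in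
  \<open>nn_integral_heat\<close> is thereby reduced to dimension one.\<close>

lemma heat_kernel_eq_prod:
  assumes "0 < t"
  shows "heat_kernel t (x::'a::euclidean_space) = (\<Prod>b\<in>Basis. normal_density 0 (sqrt t) (x \<bullet> b))"
proof -
  have "(\<Prod>b\<in>(Basis::'a set). normal_density 0 (sqrt t) (x \<bullet> b))
      = (\<Prod>b\<in>(Basis::'a set). 1 / sqrt (2 * pi * t)) * exp (\<Sum>b\<in>Basis. - (x \<bullet> b)\<^sup>2 / (2 * t))"
    using assms by (simp add: normal_density_def exp_sum prod_dividef power_divide)
  also have "(\<Sum>b\<in>Basis. - (x \<bullet> b)\<^sup>2 / (2 * t)) = - (norm x)\<^sup>2 / (2 * t)"
    by (subst power2_norm_eq_inner, subst euclidean_inner)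
       (simp add: power2_eq_square sum_divide_distrib[symmetric] sum_negf)
  also have "(\<Prod>b\<in>(Basis::'a set). 1 / sqrt (2 * pi * t)) = (2 * pi * t) powr (- (real DIM('a) / 2))"
    using assms by (simp add: powr_minus powr_half_sqrt[symmetric] powr_powr power_divide
        powr_realpow[symmetric] field_simps)
  finally show ?thesis by (simp add: heat_kernel_def)
qed

lemma nn_integral_heat:
  assumes "0 < t"
  shows "(\<integral>\<^sup>+y. heat t (x::'a::euclidean_space) y \<partial>lborel) = 1"
proof -
  have N: "(\<integral>\<^sup>+y. ennreal (normal_density 0 (sqrt t) y) \<partial>lborel) = 1"
    using assms by (subst nn_integral_eq_integral) auto
  have "(\<integral>\<^sup>+y. heat t x y \<partial>lborel) = (\<integral>\<^sup>+y. heat t x y \<partial>distr lborel borel ((+) x))"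
    by (simp add: lborel_distr_plus)
  also have "\<dots> = (\<integral>\<^sup>+(y::'a). (\<Prod>b\<in>Basis. ennreal (normal_density 0 (sqrt t) (y \<bullet> b))) \<partial>lborel)"
    using assms by (subst nn_integral_distr) (auto simp: heat_def heat_kernel_eq_prod prod_ennreal)
  also have "\<dots> = 1"
    by (subst nn_integral_lborel_prod) (auto simp: N)
  finally show ?thesis .
qed

text \<open>The value of the kernel at the origin, hence its maximum over space. The type argument
  only supplies the dimension.\<close>

definition heat_max :: "'a::euclidean_space itself \<Rightarrow> real \<Rightarrow> ennreal" where
  "heat_max _ t = ennreal ((2 * pi * t) powr (- (real DIM('a) / 2)))"

lemma borel_measurable_heat_max [measurable (raw)]:
  "f \<in> borel_measurable M \<Longrightarrow> (\<lambda>w. heat_max TYPE('a::euclidean_space) (f w)) \<in> borel_measurable M"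
  unfolding heat_max_def by measurable

lemma heat_le_heat_max:
  assumes "0 < t"
  shows "heat t (x::'a::euclidean_space) y \<le> heat_max TYPE('a) t"
  using assms unfolding heat_def heat_max_def heat_kernel_def
  by (intro ennreal_leI mult_left_le) auto

lemma heat_max_antimono: "0 < s \<Longrightarrow> s \<le> t \<Longrightarrow> heat_max TYPE('a::euclidean_space) t \<le> heat_max TYPE('a) s"
  unfolding heat_max_def by (intro ennreal_leI powr_mono2') auto

text \<open>The integral of \<open>heat_max\<close> over \<open>{T..}\<close> in closed form. With p
  = d/2 the antiderivative is a multiple of s^(1 - p) / (1 - p), which vanishes at infinity because
  d \<ge> 3 gives p > 1.\<close>

definition heat_tail :: "'a::euclidean_space itself \<Rightarrow> real \<Rightarrow> real" where
  "heat_tail _ T = (2 * pi) powr (- (real DIM('a) / 2)) * (T powr (1 - real DIM('a) / 2) / (real DIM('a) / 2 - 1))"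

lemma nn_integral_heat_max_tail:
  assumes T: "0 < T" and d: "3 \<le> DIM('a::euclidean_space)"
  shows "(\<integral>\<^sup>+s\<in>{T..}. heat_max TYPE('a) s \<partial>lborel) = ennreal (heat_tail TYPE('a) T)"
proof -
  define p where "p = real DIM('a) / 2"
  have p: "1 < p" using d by (simp add: p_def)
  have "(\<integral>\<^sup>+s\<in>{T..}. heat_max TYPE('a) s \<partial>lborel)
      = (\<integral>\<^sup>+s. ennreal ((2 * pi * s) powr - p) * indicator {T..} s \<partial>lborel)"
    by (simp add: heat_max_def p_def)
  also have "\<dots> = ennreal (0 - (2*pi) powr (- p) * (T powr (1 - p) / (1 - p)))"
  proof (rule nn_integral_FTC_atLeast)
    fix s assume "T \<le> s"
    then have s: "0 < s" using T by simp
    show "((\<lambda>s. (2*pi) powr (- p) * (s powr (1 - p) / (1 - p))) has_real_derivative (2 * pi * s) powr - p) (at s)"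
      using s p by (auto intro!: derivative_eq_intros simp: powr_mult)
  next
    have "((\<lambda>s. s powr (1 - p)) \<longlongrightarrow> 0) at_top"
      using p tendsto_neg_powr[of "1 - p" "\<lambda>s. s" at_top] filterlim_ident by auto
    from tendsto_mult[OF tendsto_const tendsto_divide[OF this tendsto_const], of "(1 - p)" "(2*pi) powr (- p)"] p
    show "((\<lambda>s. (2*pi) powr (- p) * (s powr (1 - p) / (1 - p))) \<longlongrightarrow> 0) at_top" by simp
  qed auto
  also have "\<dots> = ennreal (heat_tail TYPE('a) T)"
    unfolding heat_tail_def p_def[symmetric]
    using p by (intro arg_cong[where f=ennreal]) (simp add: field_simps)
  finally show ?thesis .
qed

lemma heat_tail_nonneg: "3 \<le> DIM('a::euclidean_space) \<Longrightarrow> 0 \<le> heat_tail TYPE('a) T"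
  unfolding heat_tail_def by simp

lemma heat_tail_tendsto_0:
  assumes d: "3 \<le> DIM('a::euclidean_space)"
  shows "(heat_tail TYPE('a) \<longlongrightarrow> 0) at_top"
proof -
  define p where "p = real DIM('a) / 2"
  have p: "1 < p" using d by (simp add: p_def)
  have "((\<lambda>s. s powr (1 - p)) \<longlongrightarrow> 0) at_top"
    using p tendsto_neg_powr[of "1 - p" "\<lambda>s. s" at_top] filterlim_ident by auto
  from tendsto_mult[OF tendsto_const tendsto_divide[OF this tendsto_const], of "(p-1)" "(2*pi) powr (- p)"] p
  show ?thesis unfolding heat_tail_def[abs_def] p_def[symmetric] by simp
qed

section \<open>Potentials\<close>

text \<open>The Green operator of Brownian motion, kept as a time integral of the heat semigroup
  rather than as a Newtonian kernel because the estimates below split the time axis.\<close>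

definition pot :: "('a::euclidean_space \<Rightarrow> ennreal) \<Rightarrow> 'a \<Rightarrow> ennreal" where
  "pot g x = (\<integral>\<^sup>+s\<in>{0<..}. (\<integral>\<^sup>+z. heat s x z * g z \<partial>lborel) \<partial>lborel)"

fun pot_iter :: "('a::euclidean_space \<Rightarrow> ennreal) \<Rightarrow> nat \<Rightarrow> 'a \<Rightarrow> ennreal" where
  "pot_iter f 0 x = 1"
| "pot_iter f (Suc k) x = pot (\<lambda>z. f z * pot_iter f k z) x"

text \<open>\<open>pot_iter\<close> and \<open>kern\<close> are the B_k and A_k of the overview. The
  recursion of \<open>pot_iter\<close> splits off the first of the k times, that of
  \<open>kern\<close> the last; \<open>nn_integral_kern_pot_iter\<close> reconciles the two.\<close>

fun kern :: "('a::euclidean_space \<Rightarrow> ennreal) \<Rightarrow> nat \<Rightarrow> 'a \<Rightarrow> real \<Rightarrow> 'a \<Rightarrow> ennreal" where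
  "kern f 0 x t y = heat t x y"
| "kern f (Suc k) x t y =
     (\<integral>\<^sup>+s\<in>{0<..<t}. (\<integral>\<^sup>+z. kern f k x s z * f z * heat (t - s) z y \<partial>lborel) \<partial>lborel)"

lemma borel_measurable_pot [measurable]:
  fixes g :: "'a::euclidean_space \<Rightarrow> ennreal"
  assumes [measurable]: "g \<in> borel_measurable borel"
  shows "pot g \<in> borel_measurable borel"
  unfolding pot_def[abs_def] by measurable

lemma borel_measurable_pot_iter [measurable]:
  fixes f :: "'a::euclidean_space \<Rightarrow> ennreal"
  assumes [measurable]: "f \<in> borel_measurable borel"
  shows "pot_iter f k \<in> borel_measurable borel"
proof (induction k)
  case (Suc k)
  note Suc[measurable]
  show ?case by (simp add: borel_measurable_pot[unfolded pot_def] pot_def[abs_def])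
qed simp

lemma pot_mono: "(\<And>z. g z \<le> h z) \<Longrightarrow> pot g x \<le> pot h x"
  unfolding pot_def by (intro nn_integral_mono mult_right_mono mult_left_mono) auto

lemma pot_add:
  fixes g h :: "'a::euclidean_space \<Rightarrow> ennreal"
  assumes [measurable]: "g \<in> borel_measurable borel" "h \<in> borel_measurable borel"
  shows "pot (\<lambda>z. g z + h z) x = pot g x + pot h x"
proof -
  have "pot (\<lambda>z. g z + h z) x = (\<integral>\<^sup>+s. ((\<integral>\<^sup>+z. heat s x z * g z \<partial>lborel) * indicator {0<..} s +
      (\<integral>\<^sup>+z. heat s x z * h z \<partial>lborel) * indicator {0<..} s) \<partial>lborel)"
    unfolding pot_def by (simp add: distrib_left distrib_right nn_integral_add)
  then show ?thesis unfolding pot_def by (subst (asm) nn_integral_add) auto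
qed

lemma pot_cmult:
  fixes g :: "'a::euclidean_space \<Rightarrow> ennreal"
  assumes [measurable]: "g \<in> borel_measurable borel"
  shows "pot (\<lambda>z. c * g z) x = c * pot g x"
  unfolding pot_def
  by (subst nn_integral_cmult[symmetric]; simp add: nn_integral_cmult[symmetric] ac_simps)

lemma borel_measurable_kern [measurable]:
  fixes f :: "'a::euclidean_space \<Rightarrow> ennreal"
  assumes [measurable]: "f \<in> borel_measurable borel"
  shows "(\<lambda>p. kern f k x (fst p) (snd p)) \<in> borel_measurable (borel \<Otimes>\<^sub>M borel)"
proof (induction k)
  case 0 show ?case by simp
next
  case (Suc k)
  have [measurable]: "(\<lambda>w. kern f k x (g w) (h w)) \<in> borel_measurable M"
    if "g \<in> borel_measurable M" "h \<in> borel_measurable M" for g h and M :: "'c measure"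
    using measurable_compose[OF measurable_Pair[OF that] Suc] by simp
  show ?case
    \<comment> \<open>The interval \<open>{0<..<t}\<close> moves with the argument; written as a
      predicate in s and t, its indicator is jointly measurable.\<close>
    by (simp add: greaterThanLessThan_def lessThan_def greaterThan_def indicator_def[abs_def] if_distrib)
qed

lemma borel_measurable_kern_compose [measurable (raw)]:
  fixes f :: "'a::euclidean_space \<Rightarrow> ennreal"
  assumes "f \<in> borel_measurable borel" "g \<in> borel_measurable M" "h \<in> borel_measurable M"
  shows "(\<lambda>w. kern f k x (g w) (h w)) \<in> borel_measurable M"
  using measurable_compose[OF measurable_Pair[OF assms(2,3)] borel_measurable_kern[OF assms(1)]] by simp

lemma nn_integral_swap:
  fixes f :: "'a::euclidean_space \<Rightarrow> 'b::euclidean_space \<Rightarrow> ennreal"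
  assumes "case_prod f \<in> borel_measurable (lborel \<Otimes>\<^sub>M lborel)"
  shows "(\<integral>\<^sup>+x. \<integral>\<^sup>+y. f x y \<partial>lborel \<partial>lborel) = (\<integral>\<^sup>+y. \<integral>\<^sup>+x. f x y \<partial>lborel \<partial>lborel)"
  using lborel_pair.Fubini'[OF assms] by simp

lemma nn_integral_shift_pot:
  fixes \<phi> :: "'a::euclidean_space \<Rightarrow> ennreal"
  assumes [measurable]: "\<phi> \<in> borel_measurable borel"
  shows "(\<integral>\<^sup>+t. indicator {s<..} t * (\<integral>\<^sup>+y. heat (t - s) z y * \<phi> y \<partial>lborel) \<partial>lborel) = pot \<phi> z"
  unfolding pot_def
  by (subst nn_integral_real_affine[where c=1 and t=s])
     (auto intro!: nn_integral_cong split: split_indicator)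

text \<open>Once the end time t runs over everything beyond the last intermediate time s, the last
  heat kernel integrates to a potential at z. The rest is Tonelli and holds without any
  finiteness.\<close>

lemma nn_integral_kern_Suc:
  fixes f \<phi> :: "'a::euclidean_space \<Rightarrow> ennreal"
  assumes [measurable]: "f \<in> borel_measurable borel" "\<phi> \<in> borel_measurable borel"
  shows "(\<integral>\<^sup>+t\<in>{0<..}. (\<integral>\<^sup>+y. kern f (Suc k) x t y * \<phi> y \<partial>lborel) \<partial>lborel)
    = (\<integral>\<^sup>+s\<in>{0<..}. (\<integral>\<^sup>+z. kern f k x s z * f z * pot \<phi> z \<partial>lborel) \<partial>lborel)"
proof -
  \<comment> \<open>\<open>H\<close> carries the constraint 0 < s < t as indicators, so that the
    four integrals can be permuted freely.\<close>
  define H where "H t y s z = indicator {0<..} s * indicator {s<..} t * (kern f k x s z * f z * (heat (t - s) z y * \<phi> y))"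
    for t s :: real and y z :: 'a
  have [measurable]: "(\<lambda>w. H (a w) (b w) (c w) (e w)) \<in> borel_measurable M"
    if [measurable]: "a \<in> borel_measurable M" "b \<in> borel_measurable M" "c \<in> borel_measurable M" "e \<in> borel_measurable M"
    for a b c e and M :: "'m measure"
  proof -
    have "Measurable.pred M (\<lambda>w. c w < a w)" by measurable
    then show ?thesis
      unfolding H_def indicator_def greaterThan_def mem_Collect_eq by measurable
  qed
  have "(\<integral>\<^sup>+t\<in>{0<..}. (\<integral>\<^sup>+y. kern f (Suc k) x t y * \<phi> y \<partial>lborel) \<partial>lborel)
      = (\<integral>\<^sup>+t. \<integral>\<^sup>+y. \<integral>\<^sup>+s. \<integral>\<^sup>+z. H t y s z \<partial>lborel \<partial>lborel \<partial>lborel \<partial>lborel)"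
  proof (intro nn_integral_cong)
    fix t :: real
    have "(\<integral>\<^sup>+y. kern f (Suc k) x t y * \<phi> y \<partial>lborel) * indicator {0<..} t
        = (\<integral>\<^sup>+y. kern f (Suc k) x t y * \<phi> y * indicator {0<..} t \<partial>lborel)"
      by (subst nn_integral_multc) (auto simp del: kern.simps)
    also have "\<dots> = (\<integral>\<^sup>+y. \<integral>\<^sup>+s. \<integral>\<^sup>+z. H t y s z \<partial>lborel \<partial>lborel \<partial>lborel)"
    proof (intro nn_integral_cong)
      fix y :: 'a
      have "kern f (Suc k) x t y * \<phi> y * indicator {0<..} t =
        (\<integral>\<^sup>+s. (\<integral>\<^sup>+z. kern f k x s z * f z * heat (t - s) z y \<partial>lborel) * indicator {0<..<t} s * (\<phi> y * indicator {0<..} t) \<partial>lborel)"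
        unfolding kern.simps mult.assoc[of _ "\<phi> y"]
        by (rule nn_integral_multc[symmetric]) measurable
      also have "\<dots> = (\<integral>\<^sup>+s. \<integral>\<^sup>+z. H t y s z \<partial>lborel \<partial>lborel)"
      proof (intro nn_integral_cong)
        fix s :: real
        have "(\<integral>\<^sup>+z. kern f k x s z * f z * heat (t - s) z y \<partial>lborel) * indicator {0<..<t} s * (\<phi> y * indicator {0<..} t)
          = (\<integral>\<^sup>+z. kern f k x s z * f z * heat (t - s) z y * (indicator {0<..<t} s * (\<phi> y * indicator {0<..} t)) \<partial>lborel)"
          by (subst nn_integral_multc) (auto simp: mult.assoc)
        also have "\<dots> = (\<integral>\<^sup>+z. H t y s z \<partial>lborel)"
          by (intro nn_integral_cong) (auto simp: H_def ac_simps split: split_indicator)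
        finally show "(\<integral>\<^sup>+z. kern f k x s z * f z * heat (t - s) z y \<partial>lborel) * indicator {0<..<t} s * (\<phi> y * indicator {0<..} t)
          = (\<integral>\<^sup>+z. H t y s z \<partial>lborel)" .
      qed
      finally show "kern f (Suc k) x t y * \<phi> y * indicator {0<..} t = (\<integral>\<^sup>+s. \<integral>\<^sup>+z. H t y s z \<partial>lborel \<partial>lborel)" .
    qed
    finally show "(\<integral>\<^sup>+y. kern f (Suc k) x t y * \<phi> y \<partial>lborel) * indicator {0<..} t
        = (\<integral>\<^sup>+y. \<integral>\<^sup>+s. \<integral>\<^sup>+z. H t y s z \<partial>lborel \<partial>lborel \<partial>lborel)" .
  qed
  \<comment> \<open>Four swaps bring the order t, y, s, z into s, z, t, y, with the potential
    innermost.\<close>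
  also have "\<dots> = (\<integral>\<^sup>+t. \<integral>\<^sup>+s. \<integral>\<^sup>+y. \<integral>\<^sup>+z. H t y s z \<partial>lborel \<partial>lborel \<partial>lborel \<partial>lborel)"
    by (intro nn_integral_cong nn_integral_swap) measurable
  also have "\<dots> = (\<integral>\<^sup>+t. \<integral>\<^sup>+s. \<integral>\<^sup>+z. \<integral>\<^sup>+y. H t y s z \<partial>lborel \<partial>lborel \<partial>lborel \<partial>lborel)"
    by (intro nn_integral_cong nn_integral_swap) measurable
  also have "\<dots> = (\<integral>\<^sup>+s. \<integral>\<^sup>+t. \<integral>\<^sup>+z. \<integral>\<^sup>+y. H t y s z \<partial>lborel \<partial>lborel \<partial>lborel \<partial>lborel)"
    by (intro nn_integral_swap) measurable
  also have "\<dots> = (\<integral>\<^sup>+s. \<integral>\<^sup>+z. \<integral>\<^sup>+t. \<integral>\<^sup>+y. H t y s z \<partial>lborel \<partial>lborel \<partial>lborel \<partial>lborel)"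
    by (intro nn_integral_cong nn_integral_swap) measurable
  also have "\<dots> = (\<integral>\<^sup>+s. \<integral>\<^sup>+z. kern f k x s z * f z * pot \<phi> z * indicator {0<..} s \<partial>lborel \<partial>lborel)"
  proof (intro nn_integral_cong)
    fix s :: real and z :: 'a
    have "(\<integral>\<^sup>+t. \<integral>\<^sup>+y. H t y s z \<partial>lborel \<partial>lborel) =
      (\<integral>\<^sup>+t. (indicator {0<..} s * (kern f k x s z * f z)) * (indicator {s<..} t * (\<integral>\<^sup>+y. heat (t - s) z y * \<phi> y \<partial>lborel)) \<partial>lborel)"
      unfolding H_def by (subst nn_integral_cmult[symmetric]; simp add: nn_integral_cmult[symmetric] ac_simps)
    also have "\<dots> = (indicator {0<..} s * (kern f k x s z * f z)) * pot \<phi> z"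
      by (subst nn_integral_cmult) (simp_all add: nn_integral_shift_pot)
    finally show "(\<integral>\<^sup>+t. \<integral>\<^sup>+y. H t y s z \<partial>lborel \<partial>lborel) = kern f k x s z * f z * pot \<phi> z * indicator {0<..} s"
      by (simp add: ac_simps)
  qed
  also have "\<dots> = (\<integral>\<^sup>+s\<in>{0<..}. (\<integral>\<^sup>+z. kern f k x s z * f z * pot \<phi> z \<partial>lborel) \<partial>lborel)"
    by (simp add: nn_integral_multc)
  finally show ?thesis .
qed

text \<open>Each use of \<open>nn_integral_kern_Suc\<close> converts the last link of
  \<open>kern\<close> into one more potential, so k falls while j grows. For j = 0 this gives the
  moments over the half-line.\<close>

lemma nn_integral_kern_pot_iter:
  fixes f :: "'a::euclidean_space \<Rightarrow> ennreal"
  assumes [measurable]: "f \<in> borel_measurable borel"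
  shows "(\<integral>\<^sup>+t\<in>{0<..}. (\<integral>\<^sup>+y. kern f k x t y * (f y * pot_iter f j y) \<partial>lborel) \<partial>lborel) = pot_iter f (Suc (k + j)) x"
proof (induction k arbitrary: j)
  case 0
  then show ?case by (simp add: pot_def)
next
  case (Suc k)
  show ?case
    using Suc[of "Suc j"] by (subst nn_integral_kern_Suc) (simp_all add: mult.assoc)
qed

text \<open>Among the \<open>k + 1\<close> consecutive time gaps one is at least \<open>\<delta>\<close>. Bounding the kernel of
  that gap by its maximum decouples the part of the path before it from the part after it.\<close>

lemma kern_le:
  fixes f :: "'a::euclidean_space \<Rightarrow> ennreal"
  assumes [measurable]: "f \<in> borel_measurable borel" and \<delta>: "0 < \<delta>" and t: "real (Suc k) * \<delta> \<le> t"
  shows "kern f k x t y \<le> heat_max TYPE('a) \<delta> * (\<Sum>i\<le>k. pot_iter f i x * pot_iter f (k - i) y)"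
  using t
proof (induction k arbitrary: t y)
  case 0
  then have "0 < t" using \<delta> by simp
  with heat_le_heat_max[of t x y] heat_max_antimono[of \<delta> t] 0 \<delta> show ?case
    by (auto intro: order.trans)
next
  case (Suc k)
  let ?q = "heat_max TYPE('a) \<delta>"
  \<comment> \<open>The two summands belong to a long gap among the first k + 1 and to a long last
    gap. Each keeps only one of the bounds on s in 0 < s < t, so that its time integral becomes a
    full potential.\<close>
  have "kern f (Suc k) x t y \<le> (\<integral>\<^sup>+s. ((\<integral>\<^sup>+z. ?q * (\<Sum>i\<le>k. pot_iter f i x * pot_iter f (k - i) z) * (f z * heat (t - s) z y) \<partial>lborel) * indicator {..<t} s
    + ?q * (\<integral>\<^sup>+z. kern f k x s z * (f z * pot_iter f 0 z) \<partial>lborel) * indicator {0<..} s) \<partial>lborel)"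
    unfolding kern.simps
  proof (intro nn_integral_mono)
    fix s :: real
    let ?L = "(\<integral>\<^sup>+z. kern f k x s z * f z * heat (t - s) z y \<partial>lborel)"
    \<comment> \<open>If s < (k + 1) \<delta> and t - s < \<delta>, then t < (k + 2) \<delta>,
      contrary to the hypothesis.\<close>
    consider "s \<le> 0 \<or> t \<le> s" | "0 < s" "s < t" "real (Suc k) * \<delta> \<le> s" | "0 < s" "s < t" "\<delta> \<le> t - s"
      using Suc.prems by (fastforce simp: algebra_simps)
    then show "?L * indicator {0<..<t} s \<le> (\<integral>\<^sup>+z. ?q * (\<Sum>i\<le>k. pot_iter f i x * pot_iter f (k - i) z) * (f z * heat (t - s) z y) \<partial>lborel) * indicator {..<t} s
      + ?q * (\<integral>\<^sup>+z. kern f k x s z * (f z * pot_iter f 0 z) \<partial>lborel) * indicator {0<..} s"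
    proof cases
      case 2
      have "?L \<le> (\<integral>\<^sup>+z. ?q * (\<Sum>i\<le>k. pot_iter f i x * pot_iter f (k - i) z) * (f z * heat (t - s) z y) \<partial>lborel)"
        unfolding mult.assoc[of "kern _ _ _ _ _"] by (intro nn_integral_mono mult_right_mono Suc.IH 2) simp
      then show ?thesis using 2 by (auto intro: order.trans add_increasing2)
    next
      case 3
      have "?L \<le> (\<integral>\<^sup>+z. kern f k x s z * f z * ?q \<partial>lborel)"
        using 3 \<delta> heat_le_heat_max[of "t - s" _ y] heat_max_antimono[of \<delta> "t - s"]
        by (intro nn_integral_mono mult_left_mono) (auto intro: order.trans)
      also have "\<dots> = ?q * (\<integral>\<^sup>+z. kern f k x s z * (f z * pot_iter f 0 z) \<partial>lborel)"
        by (subst nn_integral_cmult[symmetric]) (simp_all add: ac_simps)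
      finally show ?thesis using 3 by (auto intro: order.trans add_increasing)
    qed auto
  qed
  also have "\<dots> = (\<integral>\<^sup>+s. (\<integral>\<^sup>+z. ?q * (\<Sum>i\<le>k. pot_iter f i x * pot_iter f (k - i) z) * (f z * heat (t - s) z y) \<partial>lborel) * indicator {..<t} s \<partial>lborel)
    + ?q * (\<integral>\<^sup>+s\<in>{0<..}. (\<integral>\<^sup>+z. kern f k x s z * (f z * pot_iter f 0 z) \<partial>lborel) \<partial>lborel)"
    by (subst nn_integral_add) (simp_all add: nn_integral_cmult mult.assoc)
  \<comment> \<open>Reversing time, s to t - s, together with the symmetry of the heat kernel, gives
    a potential at the endpoint y.\<close>
  also have "(\<integral>\<^sup>+s. (\<integral>\<^sup>+z. ?q * (\<Sum>i\<le>k. pot_iter f i x * pot_iter f (k - i) z) * (f z * heat (t - s) z y) \<partial>lborel) * indicator {..<t} s \<partial>lborel)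
    = pot (\<lambda>z. ?q * (\<Sum>i\<le>k. pot_iter f i x * pot_iter f (k - i) z) * f z) y"
    unfolding pot_def
    by (subst nn_integral_real_affine[where c="-1" and t=t])
       (auto intro!: nn_integral_cong simp: heat_commute[of _ y] ac_simps split: split_indicator)
  also have "\<dots> = pot (\<lambda>z. ?q * (\<Sum>i\<le>k. pot_iter f i x * (f z * pot_iter f (k - i) z))) y"
    by (simp add: sum_distrib_left sum_distrib_right ac_simps)
  also have "\<dots> = ?q * (\<Sum>i\<le>k. pot_iter f i x * pot_iter f (Suc (k - i)) y)"
  proof -
    have "pot (\<lambda>z. (\<Sum>i\<in>I. pot_iter f i x * (f z * pot_iter f (k - i) z))) y = (\<Sum>i\<in>I. pot_iter f i x * pot_iter f (Suc (k - i)) y)"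
      if "finite I" for I
      using that
    proof (induction I)
      case empty show ?case by (simp add: pot_def)
    qed (simp add: pot_add pot_cmult)
    then show ?thesis by (subst pot_cmult) auto
  qed
  \<comment> \<open>This is the missing summand i = k + 1, where \<open>pot_iter f 0 y\<close> is
    1.\<close>
  also have "(\<integral>\<^sup>+s\<in>{0<..}. (\<integral>\<^sup>+z. kern f k x s z * (f z * pot_iter f 0 z) \<partial>lborel) \<partial>lborel) = pot_iter f (Suc k) x * pot_iter f 0 y"
    using nn_integral_kern_pot_iter[of f k x 0] by simp
  also have "?q * (\<Sum>i\<le>k. pot_iter f i x * pot_iter f (Suc (k - i)) y) + ?q * (pot_iter f (Suc k) x * pot_iter f 0 y)
    = ?q * (\<Sum>i\<le>Suc k. pot_iter f i x * pot_iter f (Suc k - i) y)"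
    by (simp add: distrib_left[symmetric] Suc_diff_le del: pot_iter.simps)
  finally show ?case .
qed

section \<open>Powers of an integral as integrals over ordered variables\<close>

lemma borel_measurable_indicator_lessThan [measurable (raw)]:
  fixes a b :: "'b \<Rightarrow> real"
  assumes [measurable]: "a \<in> borel_measurable M" "b \<in> borel_measurable M"
  shows "(\<lambda>w. indicator {..<a w} (b w) :: ennreal) \<in> borel_measurable M"
  unfolding indicator_def lessThan_def mem_Collect_eq by measurable

text \<open>By symmetry each of the k + 1 variables is the largest on an equal share; r is the
  largest one. Induction replaces the appeal to permutations, and only sums and products occur, so
  that the identity holds also when the integral is infinite.\<close>

lemma nn_integral_power_Suc:
  fixes h :: "real \<Rightarrow> ennreal"
  assumes "h \<in> borel_measurable borel"
  shows "(\<integral>\<^sup>+r. h r \<partial>lborel) ^ Suc k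
    = of_nat (Suc k) * (\<integral>\<^sup>+r. h r * (\<integral>\<^sup>+s\<in>{..<r}. h s \<partial>lborel) ^ k \<partial>lborel)"
  using assms
proof (induction k arbitrary: h)
  case 0
  then show ?case by simp
next
  case (Suc k)
  note [measurable] = Suc.prems
  define P where "P r = (\<integral>\<^sup>+s\<in>{..<r}. h s \<partial>lborel)" for r
  have P_m [measurable]: "P \<in> borel_measurable borel"
    unfolding P_def[abs_def] indicator_def lessThan_def mem_Collect_eq by measurable
  \<comment> \<open>The induction hypothesis is used for h cut off at r; in the inner integral, over
    u < s < r, the cut-off is invisible.\<close>
  have P_power: "P r ^ Suc k = of_nat (Suc k) * (\<integral>\<^sup>+s\<in>{..<r}. h s * P s ^ k \<partial>lborel)" for r
  proof -
    have "P r ^ Suc k = of_nat (Suc k) * (\<integral>\<^sup>+s. h s * indicator {..<r} s * (\<integral>\<^sup>+u\<in>{..<s}. h u * indicator {..<r} u \<partial>lborel) ^ k \<partial>lborel)"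
      unfolding P_def by (rule Suc.IH) measurable
    also have "(\<integral>\<^sup>+s. h s * indicator {..<r} s * (\<integral>\<^sup>+u\<in>{..<s}. h u * indicator {..<r} u \<partial>lborel) ^ k \<partial>lborel)
      = (\<integral>\<^sup>+s\<in>{..<r}. h s * P s ^ k \<partial>lborel)"
    proof (intro nn_integral_cong)
      fix s
      have "(\<integral>\<^sup>+u\<in>{..<s}. h u * indicator {..<r} u \<partial>lborel) = P s" if "s < r"
        unfolding P_def using that by (intro nn_integral_cong) (auto split: split_indicator)
      then show "h s * indicator {..<r} s * (\<integral>\<^sup>+u\<in>{..<s}. h u * indicator {..<r} u \<partial>lborel) ^ k = h s * P s ^ k * indicator {..<r} s"
        by (auto split: split_indicator)
    qed
    finally show ?thesis .
  qed
  let ?I = "\<integral>\<^sup>+r. h r * P r ^ Suc k \<partial>lborel"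
  have "(\<integral>\<^sup>+r. h r \<partial>lborel) ^ Suc (Suc k) = (\<integral>\<^sup>+r. h r \<partial>lborel) * (of_nat (Suc k) * (\<integral>\<^sup>+r. h r * P r ^ k \<partial>lborel))"
    unfolding P_def Suc.IH[OF Suc.prems, symmetric] by simp
  also have "\<dots> = of_nat (Suc k) * (\<integral>\<^sup>+r. \<integral>\<^sup>+s. h s * (h r * P r ^ k) \<partial>lborel \<partial>lborel)"
  proof -
    have "(\<integral>\<^sup>+r. \<integral>\<^sup>+s. h s * (h r * P r ^ k) \<partial>lborel \<partial>lborel)
        = (\<integral>\<^sup>+r. h r \<partial>lborel) * (\<integral>\<^sup>+r. h r * P r ^ k \<partial>lborel)"
      by (simp add: nn_integral_multc nn_integral_cmult)
    then show ?thesis by (simp add: ac_simps)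
  qed
  \<comment> \<open>The plane is split along its diagonal, a null set. The part s < r gives
    \<open>?I\<close>, and k + 1 times the part r < s gives \<open>?I\<close> once more by
    \<open>P_power\<close>; the total factor is (k + 1) + 1.\<close>
  also have "(\<integral>\<^sup>+r. \<integral>\<^sup>+s. h s * (h r * P r ^ k) \<partial>lborel \<partial>lborel)
    = (\<integral>\<^sup>+r. \<integral>\<^sup>+s. (h s * (h r * P r ^ k) * indicator {..<r} s + h s * (h r * P r ^ k) * indicator {..<s} r) \<partial>lborel \<partial>lborel)"
  proof (rule nn_integral_cong, rule nn_integral_cong_AE)
    fix r :: real
    have "AE s in lborel. s \<noteq> r" by (rule AE_lborel_singleton)
    then show "AE s in lborel. h s * (h r * P r ^ k) = h s * (h r * P r ^ k) * indicator {..<r} s + h s * (h r * P r ^ k) * indicator {..<s} r"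
      by eventually_elim (auto split: split_indicator)
  qed
  also have "\<dots> = (\<integral>\<^sup>+r. \<integral>\<^sup>+s. h s * (h r * P r ^ k) * indicator {..<r} s \<partial>lborel \<partial>lborel)
     + (\<integral>\<^sup>+r. \<integral>\<^sup>+s. h s * (h r * P r ^ k) * indicator {..<s} r \<partial>lborel \<partial>lborel)"
    unfolding lessThan_def indicator_def mem_Collect_eq
    by (simp add: nn_integral_add)
  also have "(\<integral>\<^sup>+r. \<integral>\<^sup>+s. h s * (h r * P r ^ k) * indicator {..<r} s \<partial>lborel \<partial>lborel) = ?I"
  proof (intro nn_integral_cong)
    fix r :: real
    have "(\<integral>\<^sup>+s. h s * (h r * P r ^ k) * indicator {..<r} s \<partial>lborel) = (\<integral>\<^sup>+s. h s * indicator {..<r} s * (h r * P r ^ k) \<partial>lborel)"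
      by (intro nn_integral_cong) (simp add: ac_simps)
    also have "\<dots> = P r * (h r * P r ^ k)"
      unfolding P_def by (subst nn_integral_multc) auto
    finally show "(\<integral>\<^sup>+s. h s * (h r * P r ^ k) * indicator {..<r} s \<partial>lborel) = h r * P r ^ Suc k"
      by (simp add: ac_simps)
  qed
  also have "(\<integral>\<^sup>+r. \<integral>\<^sup>+s. h s * (h r * P r ^ k) * indicator {..<s} r \<partial>lborel \<partial>lborel)
    = (\<integral>\<^sup>+s. \<integral>\<^sup>+r. h s * (h r * P r ^ k) * indicator {..<s} r \<partial>lborel \<partial>lborel)"
    unfolding lessThan_def indicator_def mem_Collect_eq
    by (rule nn_integral_swap) measurable
  also have "\<dots> = (\<integral>\<^sup>+s. h s * (\<integral>\<^sup>+r\<in>{..<s}. h r * P r ^ k \<partial>lborel) \<partial>lborel)"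
    by (simp add: nn_integral_cmult mult.assoc)
  also have "of_nat (Suc k) * (?I + \<dots>) = of_nat (Suc k) * ?I + (\<integral>\<^sup>+s. h s * (of_nat (Suc k) * (\<integral>\<^sup>+r\<in>{..<s}. h r * P r ^ k \<partial>lborel)) \<partial>lborel)"
  proof -
    have [measurable]: "(\<lambda>s. \<integral>\<^sup>+r\<in>{..<s}. h r * P r ^ k \<partial>lborel) \<in> borel_measurable borel"
      unfolding lessThan_def indicator_def mem_Collect_eq by measurable
    show ?thesis by (simp add: distrib_left nn_integral_cmult[symmetric] ac_simps del: of_nat_Suc)
  qed
  also have "\<dots> = of_nat (Suc k) * ?I + ?I"
    by (simp add: P_power[symmetric] del: of_nat_Suc)
  also have "\<dots> = of_nat (Suc (Suc k)) * ?I"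
    by (simp add: distrib_right ac_simps)
  finally show ?case unfolding P_def .
qed

section \<open>Uniform bounds and decay of potentials\<close>

lemma nn_integral_heat_indicator_le:
  fixes A :: "'a::euclidean_space set"
  assumes [measurable]: "A \<in> sets borel" and "0 < s"
  shows "(\<integral>\<^sup>+z. heat s x z * indicator A z \<partial>lborel) \<le> 1"
    and "(\<integral>\<^sup>+z. heat s x z * indicator A z \<partial>lborel) \<le> heat_max TYPE('a) s * emeasure lborel A"
proof -
  have "(\<integral>\<^sup>+z. heat s x z * indicator A z \<partial>lborel) \<le> (\<integral>\<^sup>+z. heat s x z \<partial>lborel)"
    by (intro nn_integral_mono) (auto split: split_indicator)
  then show "(\<integral>\<^sup>+z. heat s x z * indicator A z \<partial>lborel) \<le> 1"
    using nn_integral_heat[OF \<open>0 < s\<close>, of x] by simp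
  have "(\<integral>\<^sup>+z. heat s x z * indicator A z \<partial>lborel) \<le> (\<integral>\<^sup>+z. heat_max TYPE('a) s * indicator A z \<partial>lborel)"
    using \<open>0 < s\<close> by (intro nn_integral_mono mult_right_mono heat_le_heat_max) auto
  then show "(\<integral>\<^sup>+z. heat s x z * indicator A z \<partial>lborel) \<le> heat_max TYPE('a) s * emeasure lborel A"
    by (simp add: nn_integral_cmult)
qed

text \<open>Time is split at \<delta>: before \<delta> the heat mass in A is at most 1, after
  \<delta> at most the maximal kernel times the volume of A. The bound is uniform in x, and the free
  \<delta> allows both terms to be made small.\<close>

lemma pot_indicator_le:
  fixes A :: "'a::euclidean_space set"
  assumes d: "3 \<le> DIM('a)" and [measurable]: "A \<in> sets borel" and \<delta>: "0 < \<delta>"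
  shows "pot (indicator A) x \<le> ennreal \<delta> + heat_tail TYPE('a) \<delta> * emeasure lborel A"
proof -
  have "pot (indicator A) x \<le> (\<integral>\<^sup>+s. (indicator {0..\<delta>} s + emeasure lborel A * (heat_max TYPE('a) s * indicator {\<delta>..} s)) \<partial>lborel)"
    unfolding pot_def
  proof (intro nn_integral_mono)
    fix s :: real
    show "(\<integral>\<^sup>+z. heat s x z * indicator A z \<partial>lborel) * indicator {0<..} s
      \<le> indicator {0..\<delta>} s + emeasure lborel A * (heat_max TYPE('a) s * indicator {\<delta>..} s)"
      using nn_integral_heat_indicator_le[of A s x]
      by (auto split: split_indicator simp: ac_simps intro: add_increasing2)
  qed
  also have "\<dots> = ennreal \<delta> + emeasure lborel A * (\<integral>\<^sup>+s\<in>{\<delta>..}. heat_max TYPE('a) s \<partial>lborel)"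
    using \<delta> by (subst nn_integral_add) (auto simp: nn_integral_cmult)
  finally show ?thesis
    by (simp add: nn_integral_heat_max_tail[OF \<delta> d] ac_simps)
qed

lemma pot_indicator_small:
  assumes d: "3 \<le> DIM('a::euclidean_space)" and "0 < (\<epsilon>::real)"
  obtains \<eta> :: real where "0 < \<eta>"
    "\<And>A x. A \<in> sets borel \<Longrightarrow> emeasure lborel A \<le> ennreal \<eta> \<Longrightarrow> pot (indicator A) (x::'a) \<le> ennreal \<epsilon>"
proof
  define \<tau> where "\<tau> = heat_tail TYPE('a) (\<epsilon> / 2)"
  have \<tau>: "0 \<le> \<tau>" unfolding \<tau>_def by (rule heat_tail_nonneg[OF d])
  \<comment> \<open>Cutting time at \<epsilon> / 2 costs half of \<epsilon>, and the volume is
    chosen so that the tail costs at most the other half. The 1 in the denominator guards against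
    \<tau> = 0.\<close>
  show "0 < \<epsilon> / 2 / (\<tau> + 1)" using \<tau> \<open>0 < \<epsilon>\<close> by simp
  fix A :: "'a set" and x :: 'a assume A: "A \<in> sets borel" and le: "emeasure lborel A \<le> ennreal (\<epsilon> / 2 / (\<tau> + 1))"
  have "pot (indicator A) x \<le> ennreal (\<epsilon> / 2) + ennreal \<tau> * emeasure lborel A"
    unfolding \<tau>_def using \<open>0 < \<epsilon>\<close> by (intro pot_indicator_le d A) simp
  also have "\<dots> \<le> ennreal (\<epsilon> / 2) + ennreal \<tau> * ennreal (\<epsilon> / 2 / (\<tau> + 1))"
    by (intro add_left_mono mult_left_mono le) simp
  also have "\<dots> = ennreal (\<epsilon> / 2 + \<tau> * (\<epsilon> / 2 / (\<tau> + 1)))"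
    using \<tau> \<open>0 < \<epsilon>\<close> by (simp add: ennreal_mult[symmetric] ennreal_plus[symmetric] del: ennreal_plus)
  also have "\<dots> \<le> ennreal \<epsilon>"
    using \<tau> \<open>0 < \<epsilon>\<close> by (intro ennreal_leI) (simp add: field_simps)
  finally show "pot (indicator A) x \<le> ennreal \<epsilon>" .
qed

lemma pot_bounded:
  fixes f :: "'a::euclidean_space \<Rightarrow> ennreal"
  assumes d: "3 \<le> DIM('a)" and [measurable]: "f \<in> borel_measurable borel"
    and f: "\<And>z. f z \<le> ennreal K * indicator (cball 0 R) z"
  obtains G :: real where "0 \<le> G" "\<And>x. pot f x \<le> ennreal G"
proof -
  let ?b = "ennreal K * (ennreal 1 + heat_tail TYPE('a) 1 * emeasure lborel (cball 0 R :: 'a set))"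
  have "pot f x \<le> ?b" for x
  proof -
    have "pot f x \<le> pot (\<lambda>z. ennreal K * indicator (cball 0 R) z) x" by (intro pot_mono f)
    also have "\<dots> = ennreal K * pot (indicator (cball 0 R)) x" by (rule pot_cmult, rule borel_measurable_indicator) simp
    also have "\<dots> \<le> ?b" by (intro mult_left_mono pot_indicator_le d) auto
    finally show ?thesis .
  qed
  moreover have "?b < \<infinity>"
    using emeasure_lborel_cball_finite[of "0::'a" R]
    by (auto simp: ennreal_mult_less_top less_top[symmetric] ennreal_add_eq_top ennreal_mult_eq_top_iff)
  ultimately show thesis
    by (intro that[of "enn2real ?b"]) (auto simp: ennreal_enn2real_if)
qed

text \<open>Pointwise finiteness suffices for boundedness: the set where the sum exceeds a large \<open>M\<close> has
  small measure, hence small potential uniformly in the starting point, so that the suprema \<open>m\<^sub>n\<close> of the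
  partial sums satisfy \<open>m\<^bsub>n+1\<^esub> \<le> c + m\<^sub>n / 2\<close>.\<close>

lemma sum_pot_iter_bounded:
  fixes f :: "'a::euclidean_space \<Rightarrow> ennreal"
  assumes d: "3 \<le> DIM('a)" and [measurable]: "f \<in> borel_measurable borel"
    and f: "\<And>z. f z \<le> ennreal K * indicator (cball 0 R) z" and "0 \<le> a" "0 \<le> K"
    and fin: "\<And>x. (\<Sum>k. ennreal (a ^ k) * pot_iter f k x) < \<infinity>"
  obtains C :: real where "\<And>x. (\<Sum>k. ennreal (a ^ k) * pot_iter f k x) \<le> ennreal C"
proof -
  define U where "U x = (\<Sum>k. ennreal (a ^ k) * pot_iter f k x)" for x
  define V where "V n x = (\<Sum>k<n. ennreal (a ^ k) * pot_iter f k x)" for n x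
  have [measurable]: "U \<in> borel_measurable borel" "\<And>n. V n \<in> borel_measurable borel"
    unfolding U_def[abs_def] V_def[abs_def] by measurable
  have V_le_U: "V n x \<le> U x" for n x
    unfolding U_def V_def by (rule sum_le_suminf) auto
  obtain G where G: "0 \<le> G" "\<And>x. pot f x \<le> ennreal G"
    by (rule pot_bounded[OF d _ f]) auto
  \<comment> \<open>Chosen so that a K \<epsilon> \<le> 1 / 2, which is the contraction factor of
    the recursion.\<close>
  define \<epsilon> where "\<epsilon> = 1 / (2 * (a * K + 1))"
  have \<epsilon>: "0 < \<epsilon>" using \<open>0 \<le> a\<close> \<open>0 \<le> K\<close> by (simp add: \<epsilon>_def add_nonneg_pos)
  from pot_indicator_small[OF d this] obtain \<eta> where \<eta>: "0 < \<eta>"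
    "\<And>A x. A \<in> sets borel \<Longrightarrow> emeasure lborel A \<le> ennreal \<eta> \<Longrightarrow> pot (indicator A) (x::'a) \<le> ennreal \<epsilon>"
    by blast
  \<comment> \<open>Outside the ball f vanishes; inside it the sets have finite measure, so
    continuity from above applies.\<close>
  define A where "A n = {z \<in> cball 0 R. of_nat n < U z}" for n :: nat
  have [measurable]: "A n \<in> sets borel" for n unfolding A_def by measurable
  have "(\<lambda>n. emeasure lborel (A n)) \<longlonglongrightarrow> emeasure lborel (\<Inter>n. A n)"
  proof (rule Lim_emeasure_decseq)
    show "decseq A"
      unfolding A_def decseq_def by (auto intro: le_less_trans[OF of_nat_mono])
    show "emeasure lborel (A i) \<noteq> \<infinity>" for i
    proof -
      have "emeasure lborel (A i) \<le> emeasure lborel (cball 0 R :: 'a set)"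
        by (rule emeasure_mono) (auto simp: A_def)
      with emeasure_lborel_cball_finite[of "0::'a" R] show ?thesis by auto
    qed
  qed auto
  \<comment> \<open>Finiteness of the series at each single point enters here.\<close>
  moreover have "(\<Inter>n. A n) = {}"
  proof -
    have "\<exists>n. \<not> of_nat n < U z" for z
      using fin[of z] ennreal_Ex_less_of_nat[of "U z"] unfolding U_def by (auto dest: less_asym simp: less_top)
    then show ?thesis unfolding A_def by blast
  qed
  ultimately have "(\<lambda>n. emeasure lborel (A n)) \<longlonglongrightarrow> 0" by simp
  from order_tendstoD(2)[OF this, of "ennreal \<eta>"] \<eta>(1) obtain M where M: "emeasure lborel (A M) \<le> ennreal \<eta>"
    by (auto simp: eventually_sequentially intro: less_imp_le)
  define c where "c = 1 + a * (real M * G)"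
  have c: "0 \<le> c" using G(1) \<open>0 \<le> a\<close> by (simp add: c_def)
  \<comment> \<open>The value 2 c is the fixed point of m = c + m / 2. As an explicit invariant it
    spares any prior knowledge that the suprema are finite.\<close>
  have "V n x \<le> ennreal (2 * c)" for n x
  proof (induction n arbitrary: x)
    case 0 show ?case by (simp add: V_def)
  next
    case (Suc n)
    have "V (Suc n) x = 1 + ennreal a * pot (\<lambda>z. f z * V n z) x"
    proof -
      have *: "ennreal a * pot (\<lambda>z. f z * (\<Sum>k\<in>I. ennreal (a ^ k) * pot_iter f k z)) x
          = (\<Sum>k\<in>I. ennreal (a ^ Suc k) * pot_iter f (Suc k) x)" if "finite I" for I
        using that
      proof (induction I)
        case empty show ?case by (simp add: pot_def)
      next
        case (insert k I)
        have "pot (\<lambda>z. f z * (ennreal (a ^ k) * pot_iter f k z)) x = ennreal (a ^ k) * pot_iter f (Suc k) x"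
          by (subst mult.left_commute, subst pot_cmult) auto
        with insert show ?case
          using \<open>0 \<le> a\<close> by (simp add: distrib_left pot_add ennreal_mult mult.assoc del: pot_iter.simps)
      qed
      show ?thesis
        unfolding V_def sum.lessThan_Suc_shift by (subst *) simp_all
    qed
    also have "pot (\<lambda>z. f z * V n z) x \<le> pot (\<lambda>z. of_nat M * f z + ennreal (K * (2 * c)) * indicator (A M) z) x"
    proof (rule pot_mono)
      fix z
      \<comment> \<open>Off \<open>A M\<close> the partial sum is at most M; on \<open>A M\<close>,
        whose potential is small, the induction hypothesis is used.\<close>
      show "f z * V n z \<le> of_nat M * f z + ennreal (K * (2 * c)) * indicator (A M) z"
      proof (cases "z \<in> A M")
        case True
        have "f z * V n z \<le> ennreal K * ennreal (2 * c)"
          using f[of z] Suc[of z] True by (intro mult_mono) (auto simp: A_def)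
        then show ?thesis using True c \<open>0 \<le> K\<close> by (auto simp: ennreal_mult intro: order.trans add_increasing)
      next
        case False
        show ?thesis
        proof (cases "z \<in> cball 0 R")
          case True
          with False V_le_U[of n z] have "V n z \<le> of_nat M" by (auto simp: A_def)
          then have "f z * V n z \<le> f z * of_nat M" by (intro mult_left_mono) auto
          then show ?thesis by (simp add: ac_simps False)
        next
          case False
          then show ?thesis using f[of z] by simp
        qed
      qed
    qed
    also have "\<dots> = of_nat M * pot f x + ennreal (K * (2 * c)) * pot (indicator (A M)) x"
      by (simp add: pot_add pot_cmult)
    also have "\<dots> \<le> of_nat M * ennreal G + ennreal (K * (2 * c)) * ennreal \<epsilon>"
      by (intro add_mono mult_left_mono G \<eta> M) auto
    also have "1 + ennreal a * \<dots> = ennreal (1 + a * (real M * G + K * (2 * c) * \<epsilon>))"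
      using G c \<epsilon> \<open>0 \<le> a\<close> \<open>0 \<le> K\<close>
      by (simp add: ennreal_mult ennreal_plus ennreal_of_nat_eq_real_of_nat)
    also have "\<dots> \<le> ennreal (2 * c)"
    proof (rule ennreal_leI)
      have "a * K * \<epsilon> \<le> 1 / 2"
      proof -
        have "b * (1 / (2 * (b + 1))) \<le> 1 / 2" if "0 \<le> b" for b :: real
          using that by (simp add: divide_simps)
        from this[of "a * K"] show ?thesis using \<open>0 \<le> a\<close> \<open>0 \<le> K\<close> by (simp add: \<epsilon>_def)
      qed
      then have "a * K * \<epsilon> * (2 * c) \<le> 1 / 2 * (2 * c)"
        using c by (intro mult_right_mono) auto
      moreover have "1 + a * (real M * G + K * (2 * c) * \<epsilon>) = c + a * K * \<epsilon> * (2 * c)"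
        by (simp add: c_def algebra_simps)
      ultimately show "1 + a * (real M * G + K * (2 * c) * \<epsilon>) \<le> 2 * c" by simp
    qed
    finally show ?case by (simp add: add_left_mono mult_left_mono)
  qed
  then have "U x \<le> ennreal (2 * c)" for x
    unfolding U_def V_def by (intro suminf_le_const) auto
  then show thesis by (intro that) (simp add: U_def)
qed

lemma heat_tendsto_0:
  fixes y :: "nat \<Rightarrow> 'a::euclidean_space"
  assumes "filterlim (\<lambda>n. norm (y n)) at_top sequentially" and "0 < s"
  shows "(\<lambda>n. heat s (y n) z) \<longlonglongrightarrow> 0"
proof -
  have "filterlim (\<lambda>n. - norm z + norm (y n)) at_top sequentially"
    by (rule filterlim_tendsto_add_at_top[OF tendsto_const assms(1)])
  then have "filterlim (\<lambda>n. norm (z - y n)) at_top sequentially"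
  proof (rule filterlim_at_top_mono)
    have "- norm z + norm (y n) \<le> norm (z - y n)" for n
      using norm_triangle_ineq2[of "y n" z] by (simp add: norm_minus_commute)
    then show "\<forall>\<^sub>F n in sequentially. - norm z + norm (y n) \<le> norm (z - y n)" by simp
  qed
  then have "filterlim (\<lambda>n. 1 / (2 * s) * (norm (z - y n))\<^sup>2) at_top sequentially"
    using \<open>0 < s\<close> by (intro filterlim_tendsto_pos_mult_at_top[OF tendsto_const] filterlim_pow_at_top) auto
  then have "(\<lambda>n. exp (- (1 / (2 * s) * (norm (z - y n))\<^sup>2))) \<longlonglongrightarrow> 0"
    by (intro filterlim_compose[OF exp_at_bot]) (simp add: filterlim_uminus_at_bot)
  then have "(\<lambda>n. heat_kernel s (z - y n)) \<longlonglongrightarrow> 0"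
    unfolding heat_kernel_def by (intro tendsto_mult_right_zero) simp
  then show ?thesis
    unfolding heat_def by (metis ennreal_0 tendsto_ennrealI)
qed

text \<open>At each fixed time the kernel from y n to the ball tends to 0. Dominated convergence is
  applied first in space, then in time; up to constants the time majorant is 1 until time 1 and the
  maximal kernel afterwards, independently of y n.\<close>

lemma pot_tendsto_0:
  fixes f :: "'a::euclidean_space \<Rightarrow> ennreal" and y :: "nat \<Rightarrow> 'a"
  assumes d: "3 \<le> DIM('a)" and [measurable]: "f \<in> borel_measurable borel"
    and f: "\<And>z. f z \<le> ennreal K * indicator (cball 0 R) z"
    and y: "filterlim (\<lambda>n. norm (y n)) at_top sequentially"
  shows "(\<lambda>n. pot f (y n)) \<longlonglongrightarrow> 0"
proof -
  let ?B = "cball 0 R :: 'a set"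
  have [measurable]: "?B \<in> sets borel" by simp
  have B: "emeasure lborel ?B < \<infinity>" using emeasure_lborel_cball_finite[of "0::'a" R] by simp
  let ?w = "\<lambda>s. ennreal K * (indicator {0..1} s + emeasure lborel ?B * (heat_max TYPE('a) s * indicator {1..} s))"
  have "(\<lambda>n. pot f (y n)) \<longlonglongrightarrow> (\<integral>\<^sup>+(s::real). 0 \<partial>lborel)"
    unfolding pot_def
  proof (rule nn_integral_dominated_convergence[where w = ?w])
    fix n
    show "AE s in lborel. (\<integral>\<^sup>+z. heat s (y n) z * f z \<partial>lborel) * indicator {0<..} s \<le> ?w s"
    proof (rule AE_I2)
      fix s :: real
      have "(\<integral>\<^sup>+z. heat s (y n) z * f z \<partial>lborel) \<le> (\<integral>\<^sup>+z. ennreal K * (heat s (y n) z * indicator ?B z) \<partial>lborel)"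
        using mult_left_mono[OF f, of "heat s (y n) _"] by (intro nn_integral_mono) (simp add: ac_simps)
      also have "\<dots> = ennreal K * (\<integral>\<^sup>+z. heat s (y n) z * indicator ?B z \<partial>lborel)"
        by (rule nn_integral_cmult) measurable
      finally have "(\<integral>\<^sup>+z. heat s (y n) z * f z \<partial>lborel) * indicator {0<..} s
          \<le> ennreal K * ((\<integral>\<^sup>+z. heat s (y n) z * indicator ?B z \<partial>lborel) * indicator {0<..} s)"
        by (simp add: mult.assoc mult_right_mono split: split_indicator)
      also have "\<dots> \<le> ?w s"
        using nn_integral_heat_indicator_le[of ?B s "y n"]
        by (intro mult_left_mono) (auto split: split_indicator simp: ac_simps intro: add_increasing2)
      finally show "(\<integral>\<^sup>+z. heat s (y n) z * f z \<partial>lborel) * indicator {0<..} s \<le> ?w s" .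
    qed
  next
    have "(\<integral>\<^sup>+s. ?w s \<partial>lborel) = ennreal K * (1 + emeasure lborel ?B * ennreal (heat_tail TYPE('a) 1))"
      using nn_integral_heat_max_tail[OF _ d, of 1]
      by (simp add: nn_integral_cmult nn_integral_add)
    then show "(\<integral>\<^sup>+s. ?w s \<partial>lborel) < \<infinity>"
      using B by (auto simp: ennreal_mult_less_top less_top[symmetric] ennreal_add_eq_top ennreal_mult_eq_top_iff)
  next
    show "AE s in lborel. (\<lambda>n. (\<integral>\<^sup>+z. heat s (y n) z * f z \<partial>lborel) * indicator {0<..} s) \<longlonglongrightarrow> 0"
    proof (rule AE_I2)
      fix s :: real
      have "(\<lambda>n. (\<integral>\<^sup>+z. heat s (y n) z * f z \<partial>lborel)) \<longlonglongrightarrow> (\<integral>\<^sup>+(z::'a). 0 \<partial>lborel)" if s: "0 < s"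
      proof (rule nn_integral_dominated_convergence[where w = "\<lambda>z. heat_max TYPE('a) s * (ennreal K * indicator ?B z)"])
        show "AE z in lborel. heat s (y n) z * f z \<le> heat_max TYPE('a) s * (ennreal K * indicator ?B z)" for n
          by (intro AE_I2 mult_mono f heat_le_heat_max s) auto
        show "(\<integral>\<^sup>+z. heat_max TYPE('a) s * (ennreal K * indicator ?B z) \<partial>lborel) < \<infinity>"
          using B by (auto simp: nn_integral_cmult ennreal_mult_less_top heat_max_def)
        show "AE z in lborel. (\<lambda>n. heat s (y n) z * f z) \<longlonglongrightarrow> 0"
        proof (rule AE_I2)
          fix z
          \<comment> \<open>A product of limits in [0, \<infinity>] is safe once the form 0 times
            \<infinity> is excluded.\<close>
          have "f z \<noteq> \<top>" using f[of z] by (auto simp: top_unique split: split_indicator_asm)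
          then show "(\<lambda>n. heat s (y n) z * f z) \<longlonglongrightarrow> 0"
            using tendsto_mult_ennreal[OF heat_tendsto_0[OF y s] tendsto_const, of "f z" z] by simp
        qed
      qed auto
      then show "(\<lambda>n. (\<integral>\<^sup>+z. heat s (y n) z * f z \<partial>lborel) * indicator {0<..} s) \<longlonglongrightarrow> 0"
        by (cases "0 < s") auto
    qed
  qed auto
  then show ?thesis by simp
qed

text \<open>For a Brownian path at x at time \<tau>, this is the expectation of the product of f
  along \<open>rs\<close> and of \<open>h\<close> at the last time. The terminal weight
  \<open>h\<close> is 1 for Brownian motion and a density ratio for the bridge, so that one formula
  serves both.\<close>

fun chain :: "('a::euclidean_space \<Rightarrow> ennreal) \<Rightarrow> (real \<Rightarrow> 'a \<Rightarrow> ennreal) \<Rightarrow> real \<Rightarrow> 'a \<Rightarrow> real list \<Rightarrow> ennreal" where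
  "chain f h \<tau> x [] = h \<tau> x"
| "chain f h \<tau> x (r # rs) = (\<integral>\<^sup>+z. heat (r - \<tau>) x z * f z * chain f h r z rs \<partial>lborel)"

lemma borel_measurable_chain [measurable (raw)]:
  fixes f :: "'a::euclidean_space \<Rightarrow> ennreal"
  assumes [measurable]: "f \<in> borel_measurable borel" "\<And>\<tau>. h \<tau> \<in> borel_measurable borel" "e \<in> borel_measurable M"
  shows "(\<lambda>w. chain f h \<tau> (e w) rs) \<in> borel_measurable M"
proof -
  have "(\<lambda>x. chain f h \<tau> x rs) \<in> borel_measurable borel"
  proof (induction rs arbitrary: \<tau>)
    case (Cons r rs)
    note Cons[measurable]
    show ?case by simp
  qed simp
  from measurable_compose[OF assms(3) this] show ?thesis .
qed

text \<open>\<open>chain\<close> unfolds from the first time, whereas product measures peel off the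
  last coordinate. Absorbing the last step into the terminal weight mediates between the
  two.\<close>

lemma chain_snoc:
  "chain f h \<tau> x (rs @ [r]) = chain f (\<lambda>\<tau>' w. \<integral>\<^sup>+u. heat (r - \<tau>') w u * f u * h r u \<partial>lborel) \<tau> x rs"
  by (induction rs arbitrary: \<tau> x) simp_all

section \<open>Moments of path integrals\<close>

abbreviation occ_time :: "(real \<Rightarrow> 'w \<Rightarrow> ennreal) \<Rightarrow> real set \<Rightarrow> 'w \<Rightarrow> ennreal" where
  "occ_time g A \<omega> \<equiv> (\<integral>\<^sup>+s\<in>A. g s \<omega> \<partial>lborel)"

text \<open>The pathwise identity \<open>nn_integral_power_Suc\<close>, followed by Tonelli. The
  factor p carries the values at later times that are already fixed, so that the identity can be
  iterated; S is closed downwards so that all times before s count.\<close>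

lemma nn_integral_occupation_Suc:
  fixes g :: "real \<Rightarrow> 'w \<Rightarrow> ennreal"
  assumes "sigma_finite_measure M"
    and g [measurable]: "(\<lambda>(s, \<omega>). g s \<omega>) \<in> borel_measurable (borel \<Otimes>\<^sub>M M)"
    and [measurable]: "p \<in> borel_measurable M" "S \<in> sets borel"
    and S: "\<And>r s. r \<in> S \<Longrightarrow> s < r \<Longrightarrow> s \<in> S"
  shows "(\<integral>\<^sup>+\<omega>. (occ_time g S \<omega>) ^ Suc k * p \<omega> \<partial>M)
    = of_nat (Suc k) * (\<integral>\<^sup>+s\<in>S. (\<integral>\<^sup>+\<omega>. (occ_time g {..<s} \<omega>) ^ k * (g s \<omega> * p \<omega>) \<partial>M) \<partial>lborel)"
proof -
  interpret sigma_finite_measure M by fact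
  interpret pair_sigma_finite lborel M ..
  have gs [measurable]: "(\<lambda>s. g s \<omega>) \<in> borel_measurable borel" if "\<omega> \<in> space M" for \<omega>
    using measurable_compose[OF measurable_Pair2'[OF that] g] by simp
  have [measurable]: "(\<lambda>w. g (a w) (b w)) \<in> borel_measurable N"
    if "a \<in> borel_measurable N" "b \<in> N \<rightarrow>\<^sub>M M" for a b and N :: "'n measure"
    using measurable_compose[OF measurable_Pair[OF that] g] by simp
  have gs' [measurable]: "g s \<in> borel_measurable M" for s
    by measurable
  have P [measurable]: "(\<lambda>(s, \<omega>). \<integral>\<^sup>+u\<in>{..<s}. g u \<omega> \<partial>lborel) \<in> borel_measurable (borel \<Otimes>\<^sub>M M)"
    by measurable
  have "(\<integral>\<^sup>+\<omega>. (occ_time g S \<omega>) ^ Suc k * p \<omega> \<partial>M)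
    = (\<integral>\<^sup>+\<omega>. \<integral>\<^sup>+s. of_nat (Suc k) * (g s \<omega> * indicator S s * (occ_time g {..<s} \<omega>) ^ k * p \<omega>) \<partial>lborel \<partial>M)"
  proof (intro nn_integral_cong)
    fix \<omega> assume \<omega> [measurable]: "\<omega> \<in> space M"
    note [measurable] = gs[OF \<omega>]
    have "(occ_time g S \<omega>) ^ Suc k = of_nat (Suc k) * (\<integral>\<^sup>+s. g s \<omega> * indicator S s *
       (\<integral>\<^sup>+u\<in>{..<s}. g u \<omega> * indicator S u \<partial>lborel) ^ k \<partial>lborel)"
      by (rule nn_integral_power_Suc) measurable
    also have "(\<integral>\<^sup>+s. g s \<omega> * indicator S s * (\<integral>\<^sup>+u\<in>{..<s}. g u \<omega> * indicator S u \<partial>lborel) ^ k \<partial>lborel)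
      = (\<integral>\<^sup>+s. g s \<omega> * indicator S s * (occ_time g {..<s} \<omega>) ^ k \<partial>lborel)"
    proof (intro nn_integral_cong)
      fix s
      have "(\<integral>\<^sup>+u\<in>{..<s}. g u \<omega> * indicator S u \<partial>lborel) = (occ_time g {..<s} \<omega>)" if "s \<in> S"
        using S[OF that] by (intro nn_integral_cong) (auto split: split_indicator)
      then show "g s \<omega> * indicator S s * (\<integral>\<^sup>+u\<in>{..<s}. g u \<omega> * indicator S u \<partial>lborel) ^ k
         = g s \<omega> * indicator S s * (occ_time g {..<s} \<omega>) ^ k"
        by (auto split: split_indicator)
    qed
    finally have E: "(occ_time g S \<omega>) ^ Suc k = of_nat (Suc k) * (\<integral>\<^sup>+s. g s \<omega> * indicator S s * (occ_time g {..<s} \<omega>) ^ k \<partial>lborel)" .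
    show "(occ_time g S \<omega>) ^ Suc k * p \<omega> =
       (\<integral>\<^sup>+s. of_nat (Suc k) * (g s \<omega> * indicator S s * (occ_time g {..<s} \<omega>) ^ k * p \<omega>) \<partial>lborel)"
      unfolding E mult.assoc[of "of_nat _"]
      by (subst nn_integral_cmult, measurable, subst nn_integral_multc, measurable)
  qed
  also have "\<dots> = (\<integral>\<^sup>+s. \<integral>\<^sup>+\<omega>. of_nat (Suc k) * (g s \<omega> * indicator S s * (occ_time g {..<s} \<omega>) ^ k * p \<omega>) \<partial>M \<partial>lborel)"
    by (rule Fubini') measurable
  also have "\<dots> = (\<integral>\<^sup>+s. of_nat (Suc k) * ((\<integral>\<^sup>+\<omega>. (occ_time g {..<s} \<omega>) ^ k * (g s \<omega> * p \<omega>) \<partial>M) * indicator S s) \<partial>lborel)"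
    by (intro nn_integral_cong) (simp add: nn_integral_cmult[symmetric] nn_integral_multc[symmetric] ac_simps del: of_nat_Suc)
  also have "\<dots> = of_nat (Suc k) * (\<integral>\<^sup>+s\<in>S. (\<integral>\<^sup>+\<omega>. (occ_time g {..<s} \<omega>) ^ k * (g s \<omega> * p \<omega>) \<partial>M) \<partial>lborel)"
    by (intro nn_integral_cmult) measurable
  finally show ?thesis .
qed

text \<open>Common frame for Brownian motion with J = \<open>{0<..}\<close> and the bridge with J =
  \<open>{0<..<t}\<close>. Here g is f along the path, set to 0 off J; J omits the pinned endpoints
  because the joint densities are given at interior times.\<close>

locale occupation = sigma_finite_measure M for M :: "'w measure" +
  fixes g :: "real \<Rightarrow> 'w \<Rightarrow> ennreal" and J :: "real set" and f :: "'a::euclidean_space \<Rightarrow> ennreal"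
    and h :: "real \<Rightarrow> 'a \<Rightarrow> ennreal" and a :: 'a
  assumes g: "(\<lambda>(s, \<omega>). g s \<omega>) \<in> borel_measurable (borel \<Otimes>\<^sub>M M)"
    and f [measurable]: "f \<in> borel_measurable borel"
    and h: "(\<lambda>(\<tau>, z). h \<tau> z) \<in> borel_measurable (borel \<Otimes>\<^sub>M borel)"
    and J_pos: "J \<subseteq> {0<..}" and J_down: "\<And>r s. r \<in> J \<Longrightarrow> 0 < s \<Longrightarrow> s < r \<Longrightarrow> s \<in> J"
    and J_sets [measurable]: "J \<in> sets borel"
    and g_outside: "\<And>s \<omega>. s \<notin> J \<Longrightarrow> g s \<omega> = 0"
    and fdd: "\<And>rs. rs \<noteq> [] \<Longrightarrow> sorted_wrt (<) rs \<Longrightarrow> set rs \<subseteq> J \<Longrightarrow>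
      (\<integral>\<^sup>+\<omega>. (\<Prod>r\<leftarrow>rs. g r \<omega>) \<partial>M) = chain f h 0 a rs"
begin

lemma g_meas [measurable]: "g s \<in> borel_measurable M"
  using measurable_compose[OF measurable_Pair1' g, of s] by simp

lemma h_meas [measurable (raw)]:
  "e \<in> borel_measurable N \<Longrightarrow> u \<in> borel_measurable N \<Longrightarrow> (\<lambda>w. h (e w) (u w)) \<in> borel_measurable N"
  using measurable_compose[OF measurable_Pair h, of e N u] by simp

lemma prod_g_meas [measurable]: "(\<lambda>\<omega>. \<Prod>r\<leftarrow>rs. g r \<omega>) \<in> borel_measurable M"
  by (induction rs) auto

text \<open>The k free times below r build up \<open>kern\<close>, the fixed times from r onwards
  stay in \<open>chain\<close>. The induction step turns the largest free time s into a new head of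
  the list, hence \<open>r\<close> and \<open>rs\<close> are arbitrary.\<close>

lemma occupation_moment_chain:
  assumes "sorted_wrt (<) (r # rs)" "set (r # rs) \<subseteq> J"
  shows "(\<integral>\<^sup>+\<omega>. (occ_time g {..<r} \<omega>) ^ k * (\<Prod>r\<leftarrow>r # rs. g r \<omega>) \<partial>M)
    = of_nat (fact k) * (\<integral>\<^sup>+z. kern f k a r z * f z * chain f h r z rs \<partial>lborel)"
  using assms
proof (induction k arbitrary: r rs)
  case 0
  then show ?case using fdd[of "r # rs"] by simp
next
  case (Suc k)
  have r: "0 < r" using Suc.prems J_pos by auto
  let ?K = "\<lambda>s z u. indicator {0<..<r} s * (kern f k a s z * f z * (heat (r - s) z u * f u * chain f h r u rs))"
  have K_m: "(\<lambda>w. ?K (a' w) (b w) (c w)) \<in> borel_measurable N"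
    if [measurable]: "a' \<in> borel_measurable N" "b \<in> borel_measurable N" "c \<in> borel_measurable N"
    for a' b c and N :: "'n measure"
    by measurable
  note [measurable] = K_m
  have "(\<integral>\<^sup>+\<omega>. (occ_time g {..<r} \<omega>) ^ Suc k * (\<Prod>r\<leftarrow>r # rs. g r \<omega>) \<partial>M)
    = of_nat (Suc k) * (\<integral>\<^sup>+s\<in>{..<r}. (\<integral>\<^sup>+\<omega>. (occ_time g {..<s} \<omega>) ^ k * (g s \<omega> * (\<Prod>r\<leftarrow>r # rs. g r \<omega>)) \<partial>M) \<partial>lborel)"
    by (rule nn_integral_occupation_Suc) (use g sigma_finite_measure_axioms in auto)
  also have "(\<integral>\<^sup>+s\<in>{..<r}. (\<integral>\<^sup>+\<omega>. (occ_time g {..<s} \<omega>) ^ k * (g s \<omega> * (\<Prod>r\<leftarrow>r # rs. g r \<omega>)) \<partial>M) \<partial>lborel)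
    = (\<integral>\<^sup>+s. of_nat (fact k) * (\<integral>\<^sup>+z. \<integral>\<^sup>+u. ?K s z u \<partial>lborel \<partial>lborel) \<partial>lborel)"
  proof (intro nn_integral_cong)
    fix s :: real
    have outside: "g s \<omega> = 0" if "s \<le> 0" for \<omega>
      using that J_pos by (intro g_outside) auto
    show "(\<integral>\<^sup>+\<omega>. (occ_time g {..<s} \<omega>) ^ k * (g s \<omega> * (\<Prod>r\<leftarrow>r # rs. g r \<omega>)) \<partial>M) * indicator {..<r} s
       = of_nat (fact k) * (\<integral>\<^sup>+z. \<integral>\<^sup>+u. ?K s z u \<partial>lborel \<partial>lborel)"
    proof (cases "s \<in> {0<..<r}")
      case True
      then have "sorted_wrt (<) (s # r # rs)" "set (s # r # rs) \<subseteq> J"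
        using Suc.prems J_down[of r s] by auto
      from Suc.IH[OF this] True show ?thesis
        by (simp add: nn_integral_cmult)
    next
      case False
      then show ?thesis using outside by (auto split: split_indicator)
    qed
  qed
  also have "\<dots> = of_nat (fact k) * (\<integral>\<^sup>+s. \<integral>\<^sup>+z. \<integral>\<^sup>+u. ?K s z u \<partial>lborel \<partial>lborel \<partial>lborel)"
    by (intro nn_integral_cmult) measurable
  also have "(\<integral>\<^sup>+s. \<integral>\<^sup>+z. \<integral>\<^sup>+u. ?K s z u \<partial>lborel \<partial>lborel \<partial>lborel) = (\<integral>\<^sup>+s. \<integral>\<^sup>+u. \<integral>\<^sup>+z. ?K s z u \<partial>lborel \<partial>lborel \<partial>lborel)"
    by (intro nn_integral_cong nn_integral_swap) measurable
  also have "\<dots> = (\<integral>\<^sup>+u. \<integral>\<^sup>+s. \<integral>\<^sup>+z. ?K s z u \<partial>lborel \<partial>lborel \<partial>lborel)"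
    by (intro nn_integral_swap) measurable
  also have "\<dots> = (\<integral>\<^sup>+u. kern f (Suc k) a r u * f u * chain f h r u rs \<partial>lborel)"
  proof (intro nn_integral_cong)
    fix u
    have "(\<integral>\<^sup>+s. \<integral>\<^sup>+z. ?K s z u \<partial>lborel \<partial>lborel)
       = (\<integral>\<^sup>+s. ((\<integral>\<^sup>+z. kern f k a s z * f z * heat (r - s) z u \<partial>lborel) * indicator {0<..<r} s) * (f u * chain f h r u rs) \<partial>lborel)"
    proof (intro nn_integral_cong)
      fix s
      have "(\<integral>\<^sup>+z. ?K s z u \<partial>lborel) = (\<integral>\<^sup>+z. (kern f k a s z * f z * heat (r - s) z u) * (indicator {0<..<r} s * (f u * chain f h r u rs)) \<partial>lborel)"
        by (intro nn_integral_cong) (simp add: ac_simps)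
      also have "\<dots> = (\<integral>\<^sup>+z. kern f k a s z * f z * heat (r - s) z u \<partial>lborel) * (indicator {0<..<r} s * (f u * chain f h r u rs))"
        by (rule nn_integral_multc) measurable
      finally show "(\<integral>\<^sup>+z. ?K s z u \<partial>lborel) = ((\<integral>\<^sup>+z. kern f k a s z * f z * heat (r - s) z u \<partial>lborel) * indicator {0<..<r} s) * (f u * chain f h r u rs)"
        by (simp add: mult.assoc)
    qed
    also have "\<dots> = kern f (Suc k) a r u * (f u * chain f h r u rs)"
      unfolding kern.simps by (rule nn_integral_multc) measurable
    finally show "(\<integral>\<^sup>+s. \<integral>\<^sup>+z. ?K s z u \<partial>lborel \<partial>lborel) = kern f (Suc k) a r u * f u * chain f h r u rs"
      by (simp add: mult.assoc)
  qed
  moreover have "(of_nat (fact (Suc k)) :: ennreal) = of_nat (Suc k) * of_nat (fact k)"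
    by (simp only: fact_Suc of_nat_mult of_nat_id)
  ultimately show ?case
    by (simp only: mult.assoc)
qed

text \<open>The largest of the k + 1 times is integrated last; the inner expectation is
  \<open>occupation_moment_chain\<close> for a list of length one.\<close>

lemma occupation_moment:
  assumes S [measurable]: "S \<in> sets borel" and S_down: "\<And>r s. r \<in> S \<Longrightarrow> s < r \<Longrightarrow> s \<in> S"
  shows "(\<integral>\<^sup>+\<omega>. (occ_time g S \<omega>) ^ Suc k \<partial>M)
    = of_nat (fact (Suc k)) * (\<integral>\<^sup>+s\<in>S \<inter> J. (\<integral>\<^sup>+z. kern f k a s z * f z * h s z \<partial>lborel) \<partial>lborel)"
proof -
  have "(\<integral>\<^sup>+\<omega>. (occ_time g S \<omega>) ^ Suc k \<partial>M)
    = of_nat (Suc k) * (\<integral>\<^sup>+s\<in>S. (\<integral>\<^sup>+\<omega>. (occ_time g {..<s} \<omega>) ^ k * (g s \<omega> * 1) \<partial>M) \<partial>lborel)"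
    by (subst nn_integral_occupation_Suc[symmetric]) (use g sigma_finite_measure_axioms S_down in auto)
  also have "(\<integral>\<^sup>+s\<in>S. (\<integral>\<^sup>+\<omega>. (occ_time g {..<s} \<omega>) ^ k * (g s \<omega> * 1) \<partial>M) \<partial>lborel)
    = (\<integral>\<^sup>+s\<in>S. of_nat (fact k) * ((\<integral>\<^sup>+z. kern f k a s z * f z * h s z \<partial>lborel) * indicator J s) \<partial>lborel)"
  proof (intro nn_integral_cong arg_cong2[where f = "(*)"] refl)
    fix s
    show "(\<integral>\<^sup>+\<omega>. (occ_time g {..<s} \<omega>) ^ k * (g s \<omega> * 1) \<partial>M)
      = of_nat (fact k) * ((\<integral>\<^sup>+z. kern f k a s z * f z * h s z \<partial>lborel) * indicator J s)"
      using occupation_moment_chain[of s "[]" k] g_outside[of s] by (cases "s \<in> J") auto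
  qed
  also have "\<dots> = of_nat (fact k) * (\<integral>\<^sup>+s\<in>S \<inter> J. (\<integral>\<^sup>+z. kern f k a s z * f z * h s z \<partial>lborel) \<partial>lborel)"
    by (subst nn_integral_cmult[symmetric]) (auto intro!: nn_integral_cong split: split_indicator)
  moreover have "(of_nat (fact (Suc k)) :: ennreal) = of_nat (Suc k) * of_nat (fact k)"
    by (simp only: fact_Suc of_nat_mult of_nat_id)
  ultimately show ?thesis
    by (simp only: mult.assoc)
qed

end

section \<open>Finite-dimensional distributions\<close>

text \<open>With time rounded down to a multiple of 1 / (n + 1), only countably many time values
  occur, and joint measurability is clear. Continuity of the paths makes these processes converge
  pointwise.\<close>

lemma borel_measurable_continuous_process:
  fixes Y :: "real \<Rightarrow> 'w \<Rightarrow> 'a::euclidean_space"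
  assumes [measurable]: "\<And>s. Y s \<in> borel_measurable M"
    and cont: "\<And>\<omega>. \<omega> \<in> space M \<Longrightarrow> continuous_on UNIV (\<lambda>s. Y s \<omega>)"
  shows "(\<lambda>(s, \<omega>). Y s \<omega>) \<in> borel_measurable (borel \<Otimes>\<^sub>M M)"
proof (rule borel_measurable_LIMSEQ_metric)
  fix n :: nat
  show "(\<lambda>p. Y (of_int \<lfloor>real (Suc n) * fst p\<rfloor> / real (Suc n)) (snd p)) \<in> borel_measurable (borel \<Otimes>\<^sub>M M)"
    by (rule measurable_compose_countable[where f = "\<lambda>i p. Y (of_int i / real (Suc n)) (snd p)" and
        g = "\<lambda>p. \<lfloor>real (Suc n) * fst p\<rfloor>"]) measurable
next
  fix p :: "real \<times> 'w" assume "p \<in> space (borel \<Otimes>\<^sub>M M)"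
  then have \<omega>: "snd p \<in> space M" by (auto simp: space_pair_measure)
  have "(\<lambda>n. of_int \<lfloor>real (Suc n) * fst p\<rfloor> / real (Suc n)) \<longlonglongrightarrow> fst p"
  proof (rule tendsto_sandwich)
    show "\<forall>\<^sub>F n in sequentially. fst p - 1 / real (Suc n) \<le> of_int \<lfloor>real (Suc n) * fst p\<rfloor> / real (Suc n)"
    proof (rule always_eventually, rule allI)
      fix n
      have "real (Suc n) * fst p - 1 \<le> of_int \<lfloor>real (Suc n) * fst p\<rfloor>" by linarith
      from divide_right_mono[OF this, of "real (Suc n)"]
      show "fst p - 1 / real (Suc n) \<le> of_int \<lfloor>real (Suc n) * fst p\<rfloor> / real (Suc n)"
        by (simp add: diff_divide_distrib)
    qed
    show "\<forall>\<^sub>F n in sequentially. of_int \<lfloor>real (Suc n) * fst p\<rfloor> / real (Suc n) \<le> fst p"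
    proof (rule always_eventually, rule allI)
      fix n
      have "of_int \<lfloor>real (Suc n) * fst p\<rfloor> \<le> real (Suc n) * fst p" by linarith
      from divide_right_mono[OF this, of "real (Suc n)"]
      show "of_int \<lfloor>real (Suc n) * fst p\<rfloor> / real (Suc n) \<le> fst p"
        by simp
    qed
    show "(\<lambda>n. fst p - 1 / real (Suc n)) \<longlonglongrightarrow> fst p"
      using tendsto_diff[OF tendsto_const LIMSEQ_inverse_real_of_nat, of "fst p"] by (simp add: inverse_eq_divide)
  qed simp
  note lim = this
  have "isCont (\<lambda>s. Y s (snd p)) (fst p)"
    using cont[OF \<omega>] by (simp add: continuous_on_eq_continuous_at)
  from isCont_tendsto_compose[OF this lim] show "(\<lambda>n. Y (of_int \<lfloor>real (Suc n) * fst p\<rfloor> / real (Suc n)) (snd p)) \<longlonglongrightarrow> (case p of (s, \<omega>) \<Rightarrow> Y s \<omega>)"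
    by (simp add: case_prod_beta)
qed

lemma times_of_list:
  fixes rs :: "real list"
  assumes "sorted_wrt (<) rs" "set rs \<subseteq> {0<..<t}" "0 < t"
  obtains s :: "nat \<Rightarrow> real" where "s 0 = 0" "strict_mono s" "map s [1..<Suc (length rs)] = rs" "s (Suc (length rs)) = t"
proof -
  define k where "k = length rs"
  \<comment> \<open>Beyond index k the sequence continues from t in unit steps, which keeps it
    strictly increasing on all natural numbers.\<close>
  define s where "s i = (if i \<le> k then (0 # rs) ! i else t + real (i - Suc k))" for i
  have "strict_mono s"
  proof (rule strict_mono_Suc_iff[THEN iffD2], rule allI)
    fix i
    consider "Suc i \<le> k" | "i = k" | "k < i" by linarith
    then show "s i < s (Suc i)"
    proof cases
      case 1
      have "sorted_wrt (<) (0 # rs)" using assms by auto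
      from sorted_wrt_nth_less[OF this, of i "Suc i"] 1 show ?thesis by (simp add: s_def k_def)
    next
      case 2
      have "(0 # rs) ! k \<in> set (0 # rs)" unfolding k_def by (rule nth_mem) simp
      then show ?thesis using 2 assms by (auto simp: s_def)
    next
      case 3
      then show ?thesis by (simp add: s_def Suc_diff_le)
    qed
  qed
  moreover have "map s [1..<Suc k] = rs"
    by (rule nth_equalityI) (auto simp: s_def k_def nth_append simp del: upt_Suc)
  ultimately show thesis by (intro that[of s]) (auto simp: s_def k_def)
qed

lemma prod_list_times:
  "(\<Prod>r\<leftarrow>map s [1..<Suc k]. G r) = (\<Prod>i<k. G (s (Suc i)))"
  for G :: "real \<Rightarrow> ennreal"
  by (induction k) (simp_all add: mult.commute)

text \<open>Positions are a plus partial sums of independent increments. The last increment is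
  integrated out first, with everything before it held fixed, and \<open>chain_snoc\<close> absorbs
  the result into the terminal weight.\<close>

lemma increments_chain:
  fixes f :: "'a::euclidean_space \<Rightarrow> ennreal"
  assumes N: "\<And>j. N j = density lborel (heat (s (Suc j) - s j) 0)" "\<And>j. prob_space (N j)"
    and s0: "s 0 = 0"
    and [measurable]: "f \<in> borel_measurable borel" "\<And>\<tau>. h \<tau> \<in> borel_measurable borel"
  shows "(\<integral>\<^sup>+x. (\<Prod>i<k. f (a + (\<Sum>j\<le>i. x j))) * h (s k) (a + (\<Sum>j<k. x j)) \<partial>PiM {..<k} N)
    = chain f h 0 a (map s [1..<Suc k])"
  using assms(5)
proof (induction k arbitrary: h)
  case 0
  interpret product_prob_space N by (intro product_prob_spaceI N)
  show ?case using s0 by (simp add: PiM_empty nn_integral_count_space_finite)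
next
  case (Suc k)
  note [measurable] = Suc.prems
  interpret product_prob_space N by (intro product_prob_spaceI N)
  have [measurable_cong]: "sets (N j) = sets borel" for j by (simp add: N(1))
  have eq: "{..<Suc k} = insert k {..<k}" by auto
  define h' where "h' \<tau>' w = (\<integral>\<^sup>+u. heat (s (Suc k) - \<tau>') w u * f u * h (s (Suc k)) u \<partial>lborel)" for \<tau>' w
  have h'_m: "h' \<tau>' \<in> borel_measurable borel" for \<tau>' unfolding h'_def[abs_def] by measurable
  have "(\<integral>\<^sup>+x. (\<Prod>i<Suc k. f (a + (\<Sum>j\<le>i. x j))) * h (s (Suc k)) (a + (\<Sum>j<Suc k. x j)) \<partial>PiM {..<Suc k} N)
    = (\<integral>\<^sup>+x. \<integral>\<^sup>+y. (\<Prod>i<Suc k. f (a + (\<Sum>j\<le>i. (x(k := y)) j))) * h (s (Suc k)) (a + (\<Sum>j<Suc k. (x(k := y)) j)) \<partial>N k \<partial>PiM {..<k} N)"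
    unfolding eq
  proof (rule product_nn_integral_insert)
    have x_m: "(\<lambda>x. x j) \<in> borel_measurable (PiM (insert k {..<k}) N)" if "j \<le> k" for j
    proof -
      have sets_N: "sets (N j) = sets borel" by (simp add: N(1))
      have "(\<lambda>x. x j) \<in> PiM (insert k {..<k}) N \<rightarrow>\<^sub>M N j"
        using that by (intro measurable_component_singleton) auto
      then show ?thesis by (simp only: measurable_cong_sets[OF refl sets_N])
    qed
    have x_m': "(\<lambda>x. sum x {..i}) \<in> borel_measurable (PiM (insert k {..<k}) N)" if "i \<le> k" for i
      using that by (intro borel_measurable_sum x_m) auto
    show "(\<lambda>x. (\<Prod>i\<in>insert k {..<k}. f (a + (\<Sum>j\<le>i. x j))) * h (s (Suc k)) (a + (\<Sum>j\<in>insert k {..<k}. x j)))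
        \<in> borel_measurable (PiM (insert k {..<k}) N)"
      by (intro borel_measurable_times_ennreal borel_measurable_prod_ennreal measurable_compose[OF _ assms(4)]
          measurable_compose[OF _ Suc.prems] borel_measurable_add borel_measurable_const x_m')
         (auto simp del: sum.insert intro!: borel_measurable_sum x_m)
  qed auto
  also have "\<dots> = (\<integral>\<^sup>+x. (\<Prod>i<k. f (a + (\<Sum>j\<le>i. x j))) * h' (s k) (a + (\<Sum>j<k. x j)) \<partial>PiM {..<k} N)"
  proof (intro nn_integral_cong)
    fix x
    let ?w = "a + (\<Sum>j<k. x j)"
    have 1: "(\<Prod>i<k. f (a + (\<Sum>j\<le>i. (x(k := y)) j))) = (\<Prod>i<k. f (a + (\<Sum>j\<le>i. x j)))" for y
      by (intro prod.cong refl arg_cong[where f=f] arg_cong2[where f="(+)"] sum.cong) auto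
    have 2: "(\<Sum>j<k. (x(k := y)) j) = (\<Sum>j<k. x j)" for y
      by (intro sum.cong) auto
    have "(\<integral>\<^sup>+y. (\<Prod>i<Suc k. f (a + (\<Sum>j\<le>i. (x(k := y)) j))) * h (s (Suc k)) (a + (\<Sum>j<Suc k. (x(k := y)) j)) \<partial>N k)
      = (\<integral>\<^sup>+y. (\<Prod>i<k. f (a + (\<Sum>j\<le>i. x j))) * (f (?w + y) * h (s (Suc k)) (?w + y)) \<partial>N k)"
    proof (intro nn_integral_cong)
      fix y
      have "(\<Sum>j\<le>k. (x(k := y)) j) = (\<Sum>j<k. x j) + y"
        using 2[of y] by (simp add: lessThan_Suc_atMost[symmetric])
      then show "(\<Prod>i<Suc k. f (a + (\<Sum>j\<le>i. (x(k := y)) j))) * h (s (Suc k)) (a + (\<Sum>j<Suc k. (x(k := y)) j)) =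
        (\<Prod>i<k. f (a + (\<Sum>j\<le>i. x j))) * (f (?w + y) * h (s (Suc k)) (?w + y))"
        unfolding prod.lessThan_Suc sum.lessThan_Suc 1 2 by (simp add: ac_simps)
    qed
    also have "\<dots> = (\<Prod>i<k. f (a + (\<Sum>j\<le>i. x j))) * (\<integral>\<^sup>+y. f (?w + y) * h (s (Suc k)) (?w + y) \<partial>N k)"
      by (rule nn_integral_cmult) measurable
    also have "(\<integral>\<^sup>+y. f (?w + y) * h (s (Suc k)) (?w + y) \<partial>N k)
      = (\<integral>\<^sup>+y. heat (s (Suc k) - s k) ?w (?w + y) * f (?w + y) * h (s (Suc k)) (?w + y) \<partial>lborel)"
      unfolding N(1) by (subst nn_integral_density) (auto simp: heat_def mult.assoc)
    \<comment> \<open>The increment y gives way to the position u = \<open>?w + y\<close>, by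
      translation invariance of Lebesgue measure.\<close>
    also have "\<dots> = (\<integral>\<^sup>+u. heat (s (Suc k) - s k) ?w u * f u * h (s (Suc k)) u \<partial>distr lborel borel ((+) ?w))"
      by (subst nn_integral_distr) auto
    also have "\<dots> = h' (s k) ?w"
      unfolding h'_def lborel_distr_plus ..
    finally show "(\<integral>\<^sup>+y. (\<Prod>i<Suc k. f (a + (\<Sum>j\<le>i. (x(k := y)) j))) * h (s (Suc k)) (a + (\<Sum>j<Suc k. (x(k := y)) j)) \<partial>N k)
      = (\<Prod>i<k. f (a + (\<Sum>j\<le>i. x j))) * h' (s k) ?w" .
  qed
  also have "\<dots> = chain f h' 0 a (map s [1..<Suc k])" by (rule Suc.IH[OF h'_m])
  also have "\<dots> = chain f h 0 a (map s [1..<Suc (Suc k)])"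
    unfolding h'_def using chain_snoc[of f h 0 a "map s [1..<Suc k]" "s (Suc k)"] by simp
  finally show ?case .
qed

lemma brownian_motion_fdd:
  fixes f :: "'a::euclidean_space \<Rightarrow> ennreal"
  assumes BM: "brownian_motion M a W" and [measurable]: "f \<in> borel_measurable borel"
    and rs: "rs \<noteq> []" "sorted_wrt (<) rs" "set rs \<subseteq> {0<..}"
  shows "(\<integral>\<^sup>+\<omega>. (\<Prod>r\<leftarrow>rs. f (W r \<omega>)) \<partial>M) = chain f (\<lambda>_ _. 1) 0 a rs"
proof -
  interpret prob_space M using BM by (simp add: brownian_motion_def)
  define t where "t = Max (set rs) + 1"
  have t: "r < t" if "r \<in> set rs" for r
  proof -
    have "r \<le> Max (set rs)" using that by simp
    then show ?thesis unfolding t_def by linarith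
  qed
  obtain r0 where "r0 \<in> set rs" using rs(1) by fastforce
  with t[OF this] rs(3) have "0 < t" by auto
  obtain s where s: "s 0 = 0" "strict_mono s" and rs_eq: "map s [1..<Suc (length rs)] = rs"
    by (rule times_of_list[of rs t]) (use rs t \<open>0 < t\<close> in auto)
  define k where "k = length rs"
  have k: "k \<noteq> 0" using rs(1) by (simp add: k_def)
  have s_nonneg: "0 \<le> s j" for j using strict_mono_less_eq[OF s(2), of 0 j] s(1) by simp
  define D where "D j \<omega> = W (s (Suc j)) \<omega> - W (s j) \<omega>" for j \<omega>
  have [measurable]: "W (s j) \<in> borel_measurable M" for j
    using BM s_nonneg[of j] by (simp add: brownian_motion_def)
  have D_m [measurable]: "D j \<in> borel_measurable M" for j
    unfolding D_def[abs_def] by measurable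
  define N where "N j = distr M borel (D j)" for j
  have N: "N j = density lborel (heat (s (Suc j) - s j) 0)" for j
  proof -
    have "distributed M lborel (D j) (\<lambda>u. ennreal (heat_kernel (s (Suc j) - s j) u))"
      using BM s_nonneg[of j] strict_monoD[OF s(2), of j "Suc j"] unfolding brownian_motion_def D_def by simp
    from distributed_distr_eq_density[OF this] show ?thesis
      unfolding N_def heat_def by (simp add: distr_cong[OF refl sets_lborel[symmetric] refl, of M "D j"])
  qed
  have "indep_vars (\<lambda>_. borel) D {..<k}"
    using BM s strict_monoD[OF s(2)] s_nonneg[of 0] unfolding brownian_motion_def D_def by simp
  \<comment> \<open>Independence is read as equality of the joint law with the product of the
    increment laws; the index set is nonempty because \<open>rs\<close> is.\<close>
  then have distr: "distr M (PiM {..<k} (\<lambda>_. borel)) (\<lambda>\<omega>. \<lambda>i\<in>{..<k}. D i \<omega>) = PiM {..<k} N"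
    using indep_vars_iff_distr_eq_PiM[where I = "{..<k}" and M' = "\<lambda>_. borel" and X = D] k unfolding N_def by (auto simp: lessThan_empty_iff)
  have W_eq: "W (s i) \<omega> = a + (\<Sum>j<i. D j \<omega>)" if "\<omega> \<in> space M" for i \<omega>
  proof (induction i)
    case 0 show ?case using BM that s(1) by (simp add: brownian_motion_def)
  next
    case (Suc i) then show ?case by (simp add: D_def)
  qed
  have "(\<integral>\<^sup>+\<omega>. (\<Prod>r\<leftarrow>rs. f (W r \<omega>)) \<partial>M) = (\<integral>\<^sup>+\<omega>. (\<Prod>i<k. f (W (s (Suc i)) \<omega>)) \<partial>M)"
    by (subst rs_eq[symmetric]) (simp only: prod_list_times k_def)
  also have "\<dots> = (\<integral>\<^sup>+\<omega>. (\<Prod>i<k. f (a + (\<Sum>j\<le>i. (\<lambda>i\<in>{..<k}. D i \<omega>) j))) * 1 \<partial>M)"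
  proof (intro nn_integral_cong)
    fix \<omega> assume "\<omega> \<in> space M"
    then show "(\<Prod>i<k. f (W (s (Suc i)) \<omega>)) = (\<Prod>i<k. f (a + (\<Sum>j\<le>i. (\<lambda>i\<in>{..<k}. D i \<omega>) j))) * 1"
      by (auto simp: W_eq lessThan_Suc_atMost[symmetric] simp del: sum.lessThan_Suc intro!: prod.cong arg_cong[where f=f] sum.cong)
  qed
  also have "\<dots> = (\<integral>\<^sup>+x. (\<Prod>i<k. f (a + (\<Sum>j\<le>i. x j))) * 1 \<partial>PiM {..<k} N)"
    unfolding distr[symmetric]
    by (subst nn_integral_distr) (auto intro!: borel_measurable_times_ennreal borel_measurable_prod_ennreal measurable_compose[of _ _ borel f] borel_measurable_add borel_measurable_sum)
  also have "\<dots> = chain f (\<lambda>_ _. 1) 0 a (map s [1..<Suc k])"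
    by (rule increments_chain[OF N _ s(1), where h = "\<lambda>_ _. 1"]) (auto simp: N_def prob_space_distr)
  finally show ?thesis unfolding k_def rs_eq .
qed

text \<open>The counterpart of \<open>increments_chain\<close> in the coordinates of a bridge, whose
  law is given by a joint density of positions. Index 0 lies outside the product space and is pinned
  to a by the update.\<close>

lemma positions_chain:
  fixes f :: "'a::euclidean_space \<Rightarrow> ennreal"
  assumes s0: "s 0 = 0"
    and [measurable]: "f \<in> borel_measurable borel" "\<And>\<tau>. h \<tau> \<in> borel_measurable borel"
  shows "(\<integral>\<^sup>+z. (\<Prod>i<k. heat (s (Suc i) - s i) ((z(0 := a)) i) (z (Suc i)) * f (z (Suc i))) * h (s k) ((z(0 := a)) k) \<partial>PiM {1..k} (\<lambda>_. lborel))
    = chain f h 0 a (map s [1..<Suc k])"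
  using assms(3)
proof (induction k arbitrary: h)
  case 0
  interpret product_sigma_finite "\<lambda>_. lborel :: 'a measure" ..
  show ?case using s0 by (simp add: PiM_empty nn_integral_count_space_finite)
next
  case (Suc k)
  note [measurable] = Suc.prems
  interpret product_sigma_finite "\<lambda>_. lborel :: 'a measure" ..
  have eq: "{1..Suc k} = insert (Suc k) {1..k}" by auto
  define h' where "h' \<tau>' w = (\<integral>\<^sup>+u. heat (s (Suc k) - \<tau>') w u * f u * h (s (Suc k)) u \<partial>lborel)" for \<tau>' w
  have h'_m: "h' \<tau>' \<in> borel_measurable borel" for \<tau>' unfolding h'_def[abs_def] by measurable
  let ?F = "\<lambda>k z. (\<Prod>i<k. heat (s (Suc i) - s i) ((z(0 := a)) i) (z (Suc i)) * f (z (Suc i)))"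
  have z_m: "(\<lambda>z. (z(0 := a)) i) \<in> borel_measurable (PiM {1..Suc k} (\<lambda>_. lborel))" if "i \<le> Suc k" for i
    using that by (cases "i = 0") auto
  have "(\<integral>\<^sup>+z. ?F (Suc k) z * h (s (Suc k)) ((z(0 := a)) (Suc k)) \<partial>PiM {1..Suc k} (\<lambda>_. lborel))
    = (\<integral>\<^sup>+z. \<integral>\<^sup>+u. ?F (Suc k) (z(Suc k := u)) * h (s (Suc k)) (((z(Suc k := u))(0 := a)) (Suc k)) \<partial>lborel \<partial>PiM {1..k} (\<lambda>_. lborel))"
    unfolding eq
  proof (rule product_nn_integral_insert)
    have z_m': "(\<lambda>z. z i) \<in> borel_measurable (PiM (insert (Suc k) {1..k}) (\<lambda>_. lborel))" if "i \<in> {1..Suc k}" for i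
      using z_m[of i] that unfolding eq by simp
    show "(\<lambda>z. ?F (Suc k) z * h (s (Suc k)) ((z(0 := a)) (Suc k))) \<in> borel_measurable (PiM (insert (Suc k) {1..k}) (\<lambda>_. lborel))"
      by (intro borel_measurable_times_ennreal borel_measurable_prod_ennreal borel_measurable_heat measurable_compose[OF _ assms(2)]
          measurable_compose[OF _ Suc.prems] borel_measurable_const z_m[unfolded eq] z_m') auto
  qed auto
  also have "\<dots> = (\<integral>\<^sup>+z. ?F k z * h' (s k) ((z(0 := a)) k) \<partial>PiM {1..k} (\<lambda>_. lborel))"
  proof (intro nn_integral_cong)
    fix z
    have 1: "?F k (z(Suc k := u)) = ?F k z" for u
      by (intro prod.cong) auto
    have "(\<integral>\<^sup>+u. ?F (Suc k) (z(Suc k := u)) * h (s (Suc k)) (((z(Suc k := u))(0 := a)) (Suc k)) \<partial>lborel)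
       = (\<integral>\<^sup>+u. ?F k z * (heat (s (Suc k) - s k) ((z(0 := a)) k) u * f u * h (s (Suc k)) u) \<partial>lborel)"
      unfolding prod.lessThan_Suc 1 by (intro nn_integral_cong) (simp add: mult.assoc)
    also have "\<dots> = ?F k z * h' (s k) ((z(0 := a)) k)"
      unfolding h'_def by (rule nn_integral_cmult) measurable
    finally show "(\<integral>\<^sup>+u. ?F (Suc k) (z(Suc k := u)) * h (s (Suc k)) (((z(Suc k := u))(0 := a)) (Suc k)) \<partial>lborel)
       = ?F k z * h' (s k) ((z(0 := a)) k)" .
  qed
  also have "\<dots> = chain f h' 0 a (map s [1..<Suc k])" by (rule Suc.IH[OF h'_m])
  also have "\<dots> = chain f h 0 a (map s [1..<Suc (Suc k)])"
    unfolding h'_def using chain_snoc[of f h 0 a "map s [1..<Suc k]" "s (Suc k)"] by simp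
  finally show ?case .
qed

text \<open>The density ratio of the Doob transform: up to time \<tau> < t, the bridge is Brownian
  motion reweighted by this function of its position at \<tau>.\<close>

definition bridge_weight :: "real \<Rightarrow> 'a::euclidean_space \<Rightarrow> 'a \<Rightarrow> real \<Rightarrow> 'a \<Rightarrow> ennreal" where
  "bridge_weight t a b \<tau> z = ennreal (heat_kernel (t - \<tau>) (b - z) / heat_kernel t (b - a))"

lemma borel_measurable_bridge_weight [measurable (raw)]:
  assumes [measurable]: "g \<in> borel_measurable M" "e \<in> borel_measurable M"
  shows "(\<lambda>w. bridge_weight t a b (g w) (e w)) \<in> borel_measurable M"
  unfolding bridge_weight_def by measurable

lemma brownian_bridge_fdd:
  fixes f :: "'a::euclidean_space \<Rightarrow> ennreal"
  assumes BB: "brownian_bridge M t a b X" and [measurable]: "f \<in> borel_measurable borel"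
    and rs: "rs \<noteq> []" "sorted_wrt (<) rs" "set rs \<subseteq> {0<..<t}"
  shows "(\<integral>\<^sup>+\<omega>. (\<Prod>r\<leftarrow>rs. f (X r \<omega>)) \<partial>M) = chain f (bridge_weight t a b) 0 a rs"
proof -
  obtain r0 where "r0 \<in> set rs" using rs(1) by fastforce
  with rs(3) have "0 < t" by auto
  obtain s where s: "s 0 = 0" "strict_mono s" and rs_eq: "map s [1..<Suc (length rs)] = rs" and st: "s (Suc (length rs)) = t"
    by (rule times_of_list[of rs t]) (use rs \<open>0 < t\<close> in auto)
  define k where "k = length rs"
  have k: "1 \<le> k" using rs(1) by (simp add: k_def Suc_le_eq)
  have dist: "distributed M (PiM {1..k} (\<lambda>_. lborel)) (\<lambda>\<omega>. \<lambda>i\<in>{1..k}. X (s i) \<omega>) (\<lambda>z. ennreal (bridge_density t a b k s z))"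
    using BB k s(1) st strict_monoD[OF s(2)] unfolding brownian_bridge_def k_def by simp
  have "(\<integral>\<^sup>+\<omega>. (\<Prod>r\<leftarrow>rs. f (X r \<omega>)) \<partial>M) = (\<integral>\<^sup>+\<omega>. (\<Prod>i<k. f (X (s (Suc i)) \<omega>)) \<partial>M)"
    by (subst rs_eq[symmetric]) (simp only: prod_list_times k_def)
  also have "\<dots> = (\<integral>\<^sup>+\<omega>. (\<Prod>i<k. f ((\<lambda>i\<in>{1..k}. X (s i) \<omega>) (Suc i))) \<partial>M)"
    by (intro nn_integral_cong prod.cong) auto
  also have "\<dots> = (\<integral>\<^sup>+z. ennreal (bridge_density t a b k s z) * (\<Prod>i<k. f (z (Suc i))) \<partial>PiM {1..k} (\<lambda>_. lborel))"
    by (rule distributed_nn_integral[OF dist, symmetric])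
       (auto intro!: borel_measurable_prod_ennreal measurable_compose[of _ _ borel f])
  also have "\<dots> = (\<integral>\<^sup>+z. (\<Prod>i<k. heat (s (Suc i) - s i) ((z(0 := a)) i) (z (Suc i)) * f (z (Suc i))) * bridge_weight t a b (s k) ((z(0 := a)) k) \<partial>PiM {1..k} (\<lambda>_. lborel))"
  proof (intro nn_integral_cong)
    fix z
    \<comment> \<open>The factor j = k, for the last gap up to t, is split off and joins the
      normalisation to form the terminal weight.\<close>
    have "bridge_density t a b k s z = (\<Prod>j<k. heat_kernel (s (Suc j) - s j) (z (Suc j) - (z(0 := a)) j)) * (heat_kernel (t - s k) (b - (z(0 := a)) k) / heat_kernel t (b - a))"
    proof -
      have "(\<Prod>j=0..k. heat_kernel (s (Suc j) - s j) ((z(0 := a, Suc k := b)) (Suc j) - (z(0 := a, Suc k := b)) j))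
        = (\<Prod>j<k. heat_kernel (s (Suc j) - s j) ((z(0 := a, Suc k := b)) (Suc j) - (z(0 := a, Suc k := b)) j)) * heat_kernel (t - s k) (b - (z(0 := a)) k)"
        unfolding atLeast0AtMost lessThan_Suc_atMost[symmetric] prod.lessThan_Suc using st by (simp add: k_def)
      also have "(\<Prod>j<k. heat_kernel (s (Suc j) - s j) ((z(0 := a, Suc k := b)) (Suc j) - (z(0 := a, Suc k := b)) j))
        = (\<Prod>j<k. heat_kernel (s (Suc j) - s j) (z (Suc j) - (z(0 := a)) j))"
        by (intro prod.cong) auto
      finally show ?thesis by (simp only: bridge_density_def Let_def times_divide_eq_right)
    qed
    then have "ennreal (bridge_density t a b k s z)
        = (\<Prod>j<k. heat (s (Suc j) - s j) ((z(0 := a)) j) (z (Suc j))) * bridge_weight t a b (s k) ((z(0 := a)) k)"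
      by (simp add: heat_def bridge_weight_def ennreal_mult prod_nonneg prod_ennreal
          del: times_divide_eq_right fun_upd_apply)
    then show "ennreal (bridge_density t a b k s z) * (\<Prod>i<k. f (z (Suc i))) =
      (\<Prod>i<k. heat (s (Suc i) - s i) ((z(0 := a)) i) (z (Suc i)) * f (z (Suc i))) * bridge_weight t a b (s k) ((z(0 := a)) k)"
      by (simp only: prod.distrib ac_simps)
  qed
  also have "\<dots> = chain f (bridge_weight t a b) 0 a (map s [1..<Suc k])"
    by (rule positions_chain[where s = s, OF s(1)]) measurable
  finally show ?thesis unfolding k_def rs_eq .
qed

section \<open>Occupation moments of Brownian motions and bridges\<close>

text \<open>The clamp \<open>max 0 s\<close> extends the paths continuously to the whole line, since
  nothing is known about W at negative times.\<close>

lemma brownian_motion_measurable: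
  assumes BM: "brownian_motion M a (W :: real \<Rightarrow> 'w \<Rightarrow> 'a::euclidean_space)"
  shows "(\<lambda>(s, \<omega>). W (max 0 s) \<omega>) \<in> borel_measurable (borel \<Otimes>\<^sub>M M)"
proof (rule borel_measurable_continuous_process)
  show "W (max 0 s) \<in> borel_measurable M" for s
    using BM by (simp add: brownian_motion_def)
  show "continuous_on UNIV (\<lambda>s. W (max 0 s) \<omega>)" if "\<omega> \<in> space M" for \<omega>
    using BM that unfolding brownian_motion_def
    by (intro continuous_on_compose2[of "{0..}" "\<lambda>s. W s \<omega>" UNIV "\<lambda>s. max 0 s"] continuous_intros) auto
qed

lemma brownian_motion_occupation:
  fixes f :: "'a::euclidean_space \<Rightarrow> ennreal"
  assumes BM: "brownian_motion M a W" and f [measurable]: "f \<in> borel_measurable borel"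
  shows "occupation M (\<lambda>s \<omega>. indicator {0<..} s * f (W (max 0 s) \<omega>)) {0<..} f (\<lambda>_ _. 1) a"
proof -
  interpret prob_space M using BM by (simp add: brownian_motion_def)
  note brownian_motion_measurable[OF BM, measurable]
  show ?thesis
  proof unfold_locales
    show "(\<lambda>(s, \<omega>). indicator {0<..} s * f (W (max 0 s) \<omega>)) \<in> borel_measurable (borel \<Otimes>\<^sub>M M)"
      by measurable
    fix rs :: "real list" assume rs: "rs \<noteq> []" "sorted_wrt (<) rs" "set rs \<subseteq> {0<..}"
    have eq: "map (\<lambda>r. indicator {0<..} r * f (W (max 0 r) \<omega>)) rs = map (\<lambda>r. f (W r \<omega>)) rs" for \<omega>
      using rs(3) by (auto intro!: map_cong)
    show "(\<integral>\<^sup>+\<omega>. (\<Prod>r\<leftarrow>rs. indicator {0<..} r * f (W (max 0 r) \<omega>)) \<partial>M) = chain f (\<lambda>_ _. 1) 0 a rs"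
      unfolding eq by (rule brownian_motion_fdd[OF BM f rs])
  qed (use f in auto)
qed

lemma brownian_bridge_measurable:
  assumes BB: "brownian_bridge M t a b (X :: real \<Rightarrow> 'w \<Rightarrow> 'a::euclidean_space)" and "0 < t"
  shows "(\<lambda>(s, \<omega>). X (max 0 (min t s)) \<omega>) \<in> borel_measurable (borel \<Otimes>\<^sub>M M)"
proof (rule borel_measurable_continuous_process)
  show "X (max 0 (min t s)) \<in> borel_measurable M" for s
    using BB \<open>0 < t\<close> by (simp add: brownian_bridge_def)
  show "continuous_on UNIV (\<lambda>s. X (max 0 (min t s)) \<omega>)" if "\<omega> \<in> space M" for \<omega>
    using BB \<open>0 < t\<close> that unfolding brownian_bridge_def
    by (intro continuous_on_compose2[of "{0..t}" "\<lambda>s. X s \<omega>" UNIV "\<lambda>s. max 0 (min t s)"] continuous_intros) auto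
qed

lemma brownian_bridge_occupation:
  fixes f :: "'a::euclidean_space \<Rightarrow> ennreal"
  assumes BB: "brownian_bridge M t a b X" and f [measurable]: "f \<in> borel_measurable borel" and "0 < t"
  shows "occupation M (\<lambda>s \<omega>. indicator {0<..<t} s * f (X (max 0 (min t s)) \<omega>)) {0<..<t} f (bridge_weight t a b) a"
proof -
  interpret prob_space M using BB by (simp add: brownian_bridge_def)
  note brownian_bridge_measurable[OF BB \<open>0 < t\<close>, measurable]
  show ?thesis
  proof unfold_locales
    show "(\<lambda>(s, \<omega>). indicator {0<..<t} s * f (X (max 0 (min t s)) \<omega>)) \<in> borel_measurable (borel \<Otimes>\<^sub>M M)"
      by measurable
    show "(\<lambda>(\<tau>, z). bridge_weight t a b \<tau> z) \<in> borel_measurable (borel \<Otimes>\<^sub>M borel)"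
      by measurable
    fix rs :: "real list" assume rs: "rs \<noteq> []" "sorted_wrt (<) rs" "set rs \<subseteq> {0<..<t}"
    have eq: "map (\<lambda>r. indicator {0<..<t} r * f (X (max 0 (min t r)) \<omega>)) rs = map (\<lambda>r. f (X r \<omega>)) rs" for \<omega>
      using rs(3) by (auto intro!: map_cong simp: min_def max_def)
    show "(\<integral>\<^sup>+\<omega>. (\<Prod>r\<leftarrow>rs. indicator {0<..<t} r * f (X (max 0 (min t r)) \<omega>)) \<partial>M) = chain f (bridge_weight t a b) 0 a rs"
      unfolding eq by (rule brownian_bridge_fdd[OF BB f rs])
  qed (use f in auto)
qed

abbreviation nn_path_integral :: "('a \<Rightarrow> ennreal) \<Rightarrow> real set \<Rightarrow> (real \<Rightarrow> 'w \<Rightarrow> 'a) \<Rightarrow> 'w \<Rightarrow> ennreal" where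
  "nn_path_integral f A X \<omega> \<equiv> (\<integral>\<^sup>+s\<in>A. f (X s \<omega>) \<partial>lborel)"

text \<open>Path integrals run over closed intervals, the locale \<open>occupation\<close> over open
  ones. The endpoints are null, and on the open interval the clamp is the identity.\<close>

lemma nn_integral_drop_endpoints:
  fixes u :: "real \<Rightarrow> ennreal"
  shows "(\<integral>\<^sup>+s\<in>{0..}. u s \<partial>lborel) = (\<integral>\<^sup>+s. indicator {0<..} s * u (max 0 s) \<partial>lborel)"
    and "(\<integral>\<^sup>+s\<in>{0..t}. u s \<partial>lborel) = (\<integral>\<^sup>+s. indicator {0<..<t} s * u (max 0 (min t s)) \<partial>lborel)"
proof -
  have ae: "AE s::real in lborel. s \<noteq> 0 \<and> s \<noteq> t"
    using AE_lborel_singleton[of 0] AE_lborel_singleton[of t] by eventually_elim auto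
  from ae show "(\<integral>\<^sup>+s\<in>{0..}. u s \<partial>lborel) = (\<integral>\<^sup>+s. indicator {0<..} s * u (max 0 s) \<partial>lborel)"
    by (intro nn_integral_cong_AE, elim eventually_mono) (auto split: split_indicator)
  from ae show "(\<integral>\<^sup>+s\<in>{0..t}. u s \<partial>lborel) = (\<integral>\<^sup>+s. indicator {0<..<t} s * u (max 0 (min t s)) \<partial>lborel)"
    by (intro nn_integral_cong_AE, elim eventually_mono) (auto split: split_indicator)
qed

lemma brownian_motion_moment:
  fixes f :: "'a::euclidean_space \<Rightarrow> ennreal"
  assumes BM: "brownian_motion M a W" and f [measurable]: "f \<in> borel_measurable borel"
  shows "(\<integral>\<^sup>+\<omega>. (nn_path_integral f {0..} W \<omega>) ^ k \<partial>M) = of_nat (fact k) * pot_iter f k a"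
proof (cases k)
  case 0
  interpret prob_space M using BM by (simp add: brownian_motion_def)
  show ?thesis by (simp add: 0 emeasure_space_1)
next
  case (Suc j)
  interpret occupation M "\<lambda>s \<omega>. indicator {0<..} s * f (W (max 0 s) \<omega>)" "{0<..}" f "\<lambda>_ _. 1" a
    by (rule brownian_motion_occupation[OF BM f])
  show ?thesis
    unfolding Suc nn_integral_drop_endpoints
    using occupation_moment[of UNIV j] nn_integral_kern_pot_iter[OF f, of j a 0] by (simp add: Suc)
qed

text \<open>The terminal weight supplies the heat kernel of the last gap, which raises
  \<open>kern\<close> from k - 1 to k intermediate times, and the normalising factor comes out of
  the integral.\<close>

lemma brownian_bridge_moment:
  fixes f :: "'a::euclidean_space \<Rightarrow> ennreal"
  assumes BB: "brownian_bridge M t a b X" and f [measurable]: "f \<in> borel_measurable borel" and "0 < t"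
  shows "(\<integral>\<^sup>+\<omega>. (nn_path_integral f {0..t} X \<omega>) ^ k \<partial>M)
    = of_nat (fact k) * (kern f k a t b * ennreal (1 / heat_kernel t (b - a)))"
proof (cases k)
  case 0
  interpret prob_space M using BB by (simp add: brownian_bridge_def)
  show ?thesis
    using heat_kernel_pos[OF \<open>0 < t\<close>, of "b - a"]
    by (simp add: 0 emeasure_space_1 heat_def ennreal_mult[symmetric])
next
  case (Suc j)
  interpret occupation M "\<lambda>s \<omega>. indicator {0<..<t} s * f (X (max 0 (min t s)) \<omega>)" "{0<..<t}" f "bridge_weight t a b" a
    by (rule brownian_bridge_occupation[OF BB f \<open>0 < t\<close>])
  have "(\<integral>\<^sup>+\<omega>. (nn_path_integral f {0..t} X \<omega>) ^ k \<partial>M)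
    = of_nat (fact k) * (\<integral>\<^sup>+s\<in>{0<..<t}. (\<integral>\<^sup>+z. kern f j a s z * f z * bridge_weight t a b s z \<partial>lborel) \<partial>lborel)"
    unfolding Suc nn_integral_drop_endpoints using occupation_moment[of UNIV j] by simp
  also have "(\<integral>\<^sup>+s\<in>{0<..<t}. (\<integral>\<^sup>+z. kern f j a s z * f z * bridge_weight t a b s z \<partial>lborel) \<partial>lborel)
    = (\<integral>\<^sup>+s. (\<integral>\<^sup>+z. kern f j a s z * f z * heat (t - s) z b \<partial>lborel) * indicator {0<..<t} s * ennreal (1 / heat_kernel t (b - a)) \<partial>lborel)"
  proof (intro nn_integral_cong)
    fix s
    have w: "bridge_weight t a b s z = heat (t - s) z b * ennreal (1 / heat_kernel t (b - a))" for z
      by (simp add: bridge_weight_def heat_def ennreal_mult[symmetric])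
    have "(\<integral>\<^sup>+z. kern f j a s z * f z * bridge_weight t a b s z \<partial>lborel)
      = (\<integral>\<^sup>+z. kern f j a s z * f z * heat (t - s) z b * ennreal (1 / heat_kernel t (b - a)) \<partial>lborel)"
      unfolding w by (simp add: mult.assoc)
    also have "\<dots> = (\<integral>\<^sup>+z. kern f j a s z * f z * heat (t - s) z b \<partial>lborel) * ennreal (1 / heat_kernel t (b - a))"
      by (rule nn_integral_multc) measurable
    finally show "(\<integral>\<^sup>+z. kern f j a s z * f z * bridge_weight t a b s z \<partial>lborel) * indicator {0<..<t} s
      = (\<integral>\<^sup>+z. kern f j a s z * f z * heat (t - s) z b \<partial>lborel) * indicator {0<..<t} s * ennreal (1 / heat_kernel t (b - a))"
      by (simp add: ac_simps)
  qed
  also have "\<dots> = kern f k a t b * ennreal (1 / heat_kernel t (b - a))"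
    unfolding Suc kern.simps by (rule nn_integral_multc) measurable
  finally show ?thesis .
qed

section \<open>Estimates for the bridge uniform in its duration\<close>

lemma one_div_heat_kernel:
  assumes "0 < t"
  shows "1 / heat_kernel t (x::'a::euclidean_space) = exp ((norm x)\<^sup>2 / (2 * t)) * (2 * pi * t) powr (real DIM('a) / 2)"
  using assms by (simp add: heat_kernel_def powr_minus exp_minus field_simps)

text \<open>The numerator is bounded by its maximum over z; the two normalisations then combine to a
  power of t / (t - s), which is harmless up to half time.\<close>

lemma bridge_weight_le:
  assumes "0 < t" "s < t"
  shows "bridge_weight t a (b::'a::euclidean_space) s z \<le>
    ennreal (exp ((norm (b - a))\<^sup>2 / (2 * t)) * (t / (t - s)) powr (real DIM('a) / 2))"
proof -
  have "heat_kernel (t - s) (b - z) / heat_kernel t (b - a)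
      = heat_kernel (t - s) (b - z) * (exp ((norm (b - a))\<^sup>2 / (2 * t)) * (2 * pi * t) powr (real DIM('a) / 2))"
    using one_div_heat_kernel[OF \<open>0 < t\<close>, of "b - a"] by (metis times_divide_eq_right mult.right_neutral)
  also have "\<dots> \<le> (2 * pi * (t - s)) powr (- (real DIM('a) / 2)) * (exp ((norm (b - a))\<^sup>2 / (2 * t)) * (2 * pi * t) powr (real DIM('a) / 2))"
    using assms by (intro mult_right_mono) (auto simp: heat_kernel_def intro!: mult_left_le)
  also have "\<dots> = exp ((norm (b - a))\<^sup>2 / (2 * t)) *
      ((2 * pi * t) powr (real DIM('a) / 2) / (2 * pi * (t - s)) powr (real DIM('a) / 2))"
    by (simp add: powr_minus field_simps)
  also have "(2 * pi * t) powr (real DIM('a) / 2) / (2 * pi * (t - s)) powr (real DIM('a) / 2)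
      = (t / (t - s)) powr (real DIM('a) / 2)"
    using assms by (subst powr_divide[symmetric]) auto
  finally show ?thesis unfolding bridge_weight_def by (rule ennreal_leI)
qed

text \<open>\<open>kern_le\<close> is applied with \<delta> = t / (k + 1). The powers of t cancel
  against the normalisation; what remains is (k + 1)^(d/2) from the gap, k + 1 from the number of
  summands, and the decay \<beta>^(-k) shared by the two potentials in each summand.\<close>

lemma brownian_bridge_moment_le:
  fixes f :: "'a::euclidean_space \<Rightarrow> ennreal"
  assumes BB: "brownian_bridge M t a b X" and f [measurable]: "f \<in> borel_measurable borel" and t: "0 < t"
    and \<beta>: "0 < \<beta>" "0 \<le> C" "\<And>k x. ennreal (\<beta> ^ k) * pot_iter f k x \<le> ennreal C"
  shows "(\<integral>\<^sup>+\<omega>. (nn_path_integral f {0..t} X \<omega>) ^ k \<partial>M)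
    \<le> ennreal (fact k * (exp ((norm (b - a))\<^sup>2 / (2 * t)) * (real (Suc k) ^ (DIM('a) + 1) * (C\<^sup>2 * (1 / \<beta>) ^ k))))"
proof -
  let ?p = "real DIM('a) / 2"
  have p: "0 \<le> ?p" by simp
  have B: "pot_iter f i x \<le> ennreal (C * (1 / \<beta>) ^ i)" for i x
  proof -
    have "pot_iter f i x = ennreal ((1 / \<beta>) ^ i) * (ennreal (\<beta> ^ i) * pot_iter f i x)"
      using \<beta>(1) by (simp add: mult.assoc[symmetric] ennreal_mult[symmetric] power_mult_distrib[symmetric])
    also have "\<dots> \<le> ennreal ((1 / \<beta>) ^ i) * ennreal C"
      by (intro mult_left_mono \<beta>) simp
    finally show ?thesis using \<beta> by (simp add: ennreal_mult[symmetric] mult.commute)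
  qed
  have "kern f k a t b \<le> heat_max TYPE('a) (t / real (Suc k)) * (\<Sum>i\<le>k. pot_iter f i a * pot_iter f (k - i) b)"
    using t by (intro kern_le f) auto
  also have "\<dots> \<le> heat_max TYPE('a) (t / real (Suc k)) * (\<Sum>i\<le>k. ennreal (C * (1 / \<beta>) ^ i) * ennreal (C * (1 / \<beta>) ^ (k - i)))"
    by (intro mult_left_mono sum_mono mult_mono B) auto
  also have "(\<Sum>i\<le>k. ennreal (C * (1 / \<beta>) ^ i) * ennreal (C * (1 / \<beta>) ^ (k - i))) = (\<Sum>i\<le>k. ennreal (C\<^sup>2 * (1 / \<beta>) ^ k))"
  proof (intro sum.cong refl)
    fix i assume "i \<in> {..k}"
    then have "(1 / \<beta>) ^ k = (1 / \<beta>) ^ i * (1 / \<beta>) ^ (k - i)" by (simp add: power_add[symmetric])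
    then show "ennreal (C * (1 / \<beta>) ^ i) * ennreal (C * (1 / \<beta>) ^ (k - i)) = ennreal (C\<^sup>2 * (1 / \<beta>) ^ k)"
      using \<beta> by (simp add: ennreal_mult[symmetric] power2_eq_square ac_simps)
  qed
  also have "\<dots> = ennreal (real (Suc k) * (C\<^sup>2 * (1 / \<beta>) ^ k))"
    using \<beta> by (subst sum_ennreal) auto
  also have "heat_max TYPE('a) (t / real (Suc k)) * \<dots> = ennreal ((2 * pi * (t / real (Suc k))) powr - ?p * (real (Suc k) * (C\<^sup>2 * (1 / \<beta>) ^ k)))"
    unfolding heat_max_def using \<beta> by (subst ennreal_mult) auto
  finally have "kern f k a t b * ennreal (1 / heat_kernel t (b - a))
    \<le> ennreal ((2 * pi * (t / real (Suc k))) powr - ?p * (real (Suc k) * (C\<^sup>2 * (1 / \<beta>) ^ k))) * ennreal (1 / heat_kernel t (b - a))"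
    by (rule mult_right_mono) simp
  also have "\<dots> = ennreal ((2 * pi * (t / real (Suc k))) powr - ?p * (real (Suc k) * (C\<^sup>2 * (1 / \<beta>) ^ k)) * (1 / heat_kernel t (b - a)))"
    using \<beta> by (subst ennreal_mult) auto
  also have "\<dots> \<le> ennreal (exp ((norm (b - a))\<^sup>2 / (2 * t)) * (real (Suc k) ^ (DIM('a) + 1) * (C\<^sup>2 * (1 / \<beta>) ^ k)))"
  proof (rule ennreal_leI)
    let ?e = "exp ((norm (b - a))\<^sup>2 / (2 * t))" and ?c = "C\<^sup>2 * (1 / \<beta>) ^ k"
    have n: "(2 * pi * (t / real (Suc k))) powr - ?p = real (Suc k) powr ?p * (2 * pi * t) powr - ?p"
    proof -
      have "(2 * pi * (t / real (Suc k))) powr - ?p = (2 * pi * t / real (Suc k)) powr - ?p" by simp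
      also have "\<dots> = (2 * pi * t) powr - ?p / real (Suc k) powr - ?p"
        using t by (intro powr_divide)
      finally show ?thesis by (simp add: powr_minus field_simps del: of_nat_Suc)
    qed
    have "(2 * pi * (t / real (Suc k))) powr - ?p * (real (Suc k) * ?c) * (1 / heat_kernel t (b - a))
       = ((2 * pi * t) powr - ?p * (2 * pi * t) powr ?p) * (?e * (real (Suc k) powr ?p * real (Suc k) * ?c))"
      unfolding one_div_heat_kernel[OF t] n by (simp only: ac_simps)
    also have "(2 * pi * t) powr - ?p * (2 * pi * t) powr ?p = 1"
      using t by (simp add: powr_minus)
    \<comment> \<open>Rounding d/2 up to d makes the factor a polynomial in k with a natural
      exponent.\<close>
    also have "real (Suc k) powr ?p \<le> real (Suc k) ^ DIM('a)"
    proof -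
      have "real (Suc k) powr ?p \<le> real (Suc k) powr real DIM('a)"
        by (intro powr_mono) auto
      then show ?thesis by (simp add: powr_realpow)
    qed
    finally show "(2 * pi * (t / real (Suc k))) powr - ?p * (real (Suc k) * ?c) * (1 / heat_kernel t (b - a))
      \<le> ?e * (real (Suc k) ^ (DIM('a) + 1) * ?c)"
      using \<beta> by (simp add: mult_right_mono mult_left_mono ac_simps)
  qed
  finally have "of_nat (fact k) * (kern f k a t b * ennreal (1 / heat_kernel t (b - a)))
    \<le> of_nat (fact k) * ennreal (exp ((norm (b - a))\<^sup>2 / (2 * t)) * (real (Suc k) ^ (DIM('a) + 1) * (C\<^sup>2 * (1 / \<beta>) ^ k)))"
    by (rule mult_left_mono) simp
  also have "\<dots> = ennreal (fact k * (exp ((norm (b - a))\<^sup>2 / (2 * t)) * (real (Suc k) ^ (DIM('a) + 1) * (C\<^sup>2 * (1 / \<beta>) ^ k))))"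
    using \<beta> by (subst ennreal_mult) (auto simp: ennreal_of_nat_eq_real_of_nat)
  finally show ?thesis
    unfolding brownian_bridge_moment[OF BB f t] .
qed

text \<open>Up to t / 2 the bridge weight is bounded, which leaves the transience estimate for free
  Brownian motion. After t / 2 the kernel from a is bounded by its maximum instead, and the kernel
  from z to b integrates in reversed time to the potential at b.\<close>

lemma brownian_bridge_tail_le:
  fixes f :: "'a::euclidean_space \<Rightarrow> ennreal"
  assumes BB: "brownian_bridge M t a b X" and f [measurable]: "f \<in> borel_measurable borel"
    and T: "0 < T" "T < t" and d: "3 \<le> DIM('a)"
    and f_le: "\<And>z. f z \<le> ennreal K * indicator (cball 0 R) z"
  shows "(\<integral>\<^sup>+\<omega>. (nn_path_integral f {T..t} X \<omega>) \<partial>M)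
    \<le> ennreal (exp ((norm (b - a))\<^sup>2 / (2 * t)) * 2 powr (real DIM('a) / 2)) *
       (ennreal K * emeasure lborel (cball 0 R :: 'a set) * ennreal (heat_tail TYPE('a) T) + pot f b)"
proof -
  let ?p = "real DIM('a) / 2" and ?B = "cball 0 R :: 'a set"
  let ?E = "exp ((norm (b - a))\<^sup>2 / (2 * t)) * 2 powr ?p"
  have t: "0 < t" using T by simp
  have [measurable]: "?B \<in> sets borel" by simp
  interpret prob_space M using BB by (simp add: brownian_bridge_def)
  interpret occupation M "\<lambda>s \<omega>. indicator {0<..<t} s * f (X (max 0 (min t s)) \<omega>)" "{0<..<t}" f "bridge_weight t a b" a
    by (rule brownian_bridge_occupation[OF BB f t])
  interpret pair_sigma_finite lborel M ..
  note g[measurable]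
  have "(\<integral>\<^sup>+\<omega>. (nn_path_integral f {T..t} X \<omega>) \<partial>M)
     = (\<integral>\<^sup>+\<omega>. \<integral>\<^sup>+s. indicator {0<..<t} s * f (X (max 0 (min t s)) \<omega>) * indicator {T..} s \<partial>lborel \<partial>M)"
  proof (rule nn_integral_cong, rule nn_integral_cong_AE)
    fix \<omega>
    show "AE s in lborel. f (X s \<omega>) * indicator {T..t} s = indicator {0<..<t} s * f (X (max 0 (min t s)) \<omega>) * indicator {T..} s"
      using AE_lborel_singleton[of t] by eventually_elim (use T in \<open>auto split: split_indicator\<close>)
  qed
  also have "\<dots> = (\<integral>\<^sup>+s. \<integral>\<^sup>+\<omega>. indicator {0<..<t} s * f (X (max 0 (min t s)) \<omega>) * indicator {T..} s \<partial>M \<partial>lborel)"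
    using g by (intro Fubini') (auto intro!: borel_measurable_times_ennreal simp: case_prod_beta)
  also have "\<dots> = (\<integral>\<^sup>+s. (\<integral>\<^sup>+\<omega>. indicator {0<..<t} s * f (X (max 0 (min t s)) \<omega>) \<partial>M) * indicator {T..} s \<partial>lborel)"
    by (intro nn_integral_cong nn_integral_multc) measurable
  also have "\<dots> = (\<integral>\<^sup>+s\<in>{T..<t}. chain f (bridge_weight t a b) 0 a [s] \<partial>lborel)"
  proof (intro nn_integral_cong)
    fix s
    show "(\<integral>\<^sup>+\<omega>. indicator {0<..<t} s * f (X (max 0 (min t s)) \<omega>) \<partial>M) * indicator {T..} s
      = chain f (bridge_weight t a b) 0 a [s] * indicator {T..<t} s"
      using fdd[of "[s]"] T by (auto split: split_indicator)
  qed
  also have "\<dots> \<le> (\<integral>\<^sup>+s. ennreal ?E * (ennreal K * emeasure lborel ?B * (heat_max TYPE('a) s * indicator {T..} s)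
      + (\<integral>\<^sup>+z. heat (t - s) b z * f z \<partial>lborel) * indicator {..<t} s) \<partial>lborel)"
  proof (intro nn_integral_mono)
    fix s
    show "chain f (bridge_weight t a b) 0 a [s] * indicator {T..<t} s \<le>
      ennreal ?E * (ennreal K * emeasure lborel ?B * (heat_max TYPE('a) s * indicator {T..} s)
      + (\<integral>\<^sup>+z. heat (t - s) b z * f z \<partial>lborel) * indicator {..<t} s)"
    proof (cases "s \<in> {T..<t}")
      case True
      then have s: "0 < s" "s < t" "T \<le> s" using T by auto
      show ?thesis
      proof (cases "s \<le> t / 2")
        case early: True
        have w: "bridge_weight t a b s z \<le> ennreal ?E" for z
        proof (rule order.trans[OF bridge_weight_le[OF t s(2)]], rule ennreal_leI, rule mult_left_mono)
          show "(t / (t - s)) powr ?p \<le> 2 powr ?p"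
            using early s by (intro powr_mono2) (auto simp: field_simps)
        qed simp
        have "chain f (bridge_weight t a b) 0 a [s] \<le> (\<integral>\<^sup>+z. heat s a z * (ennreal K * indicator ?B z) * ennreal ?E \<partial>lborel)"
          using w f_le by (auto intro!: nn_integral_mono mult_mono)
        also have "\<dots> = ennreal ?E * (ennreal K * (\<integral>\<^sup>+z. heat s a z * indicator ?B z \<partial>lborel))"
          by (subst nn_integral_multc, measurable, subst mult.left_commute, subst nn_integral_cmult) (auto simp: ac_simps)
        also have "\<dots> \<le> ennreal ?E * (ennreal K * (heat_max TYPE('a) s * emeasure lborel ?B))"
          using s by (intro mult_left_mono nn_integral_heat_indicator_le) auto
        finally have "chain f (bridge_weight t a b) 0 a [s] \<le> ennreal ?E * (ennreal K * emeasure lborel ?B * heat_max TYPE('a) s)"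
          by (simp only: ac_simps)
        also have "\<dots> \<le> ennreal ?E * (ennreal K * emeasure lborel ?B * heat_max TYPE('a) s + (\<integral>\<^sup>+z. heat (t - s) b z * f z \<partial>lborel))"
          by (intro mult_left_mono add_increasing2) auto
        finally show ?thesis using True s by simp
      next
        \<comment> \<open>The constant agrees with the early case: the maximal kernel at t / 2
          exceeds that at t by the factor 2^(d/2).\<close>
        case late: False
        have w: "heat s a z * bridge_weight t a b s z \<le> ennreal ?E * heat (t - s) b z" for z
        proof -
          have "heat s a z \<le> heat_max TYPE('a) (t / 2)"
            using late t by (intro order.trans[OF heat_le_heat_max heat_max_antimono]) auto
          then have "heat s a z * bridge_weight t a b s z \<le> heat_max TYPE('a) (t / 2) * bridge_weight t a b s z"
            by (rule mult_right_mono) simp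
          also have "\<dots> = ennreal (((2 * pi * (t / 2)) powr - ?p * (1 / heat_kernel t (b - a))) * heat_kernel (t - s) (b - z))"
            unfolding heat_max_def bridge_weight_def by (subst ennreal_mult[symmetric]) (auto simp: ac_simps)
          also have "(2 * pi * (t / 2)) powr - ?p * (1 / heat_kernel t (b - a)) = ?E"
            unfolding one_div_heat_kernel[OF t] using t by (simp add: powr_minus powr_mult field_simps)
          also have "ennreal (?E * heat_kernel (t - s) (b - z)) = ennreal ?E * heat (t - s) z b"
            unfolding heat_def by (subst ennreal_mult) auto
          finally show ?thesis by (simp add: heat_commute)
        qed
        have "chain f (bridge_weight t a b) 0 a [s] = (\<integral>\<^sup>+z. heat s a z * bridge_weight t a b s z * f z \<partial>lborel)"
          by (simp add: ac_simps)
        also have "\<dots> \<le> (\<integral>\<^sup>+z. ennreal ?E * heat (t - s) b z * f z \<partial>lborel)"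
          by (intro nn_integral_mono mult_right_mono w) simp
        also have "\<dots> = ennreal ?E * (\<integral>\<^sup>+z. heat (t - s) b z * f z \<partial>lborel)"
          by (simp add: nn_integral_cmult mult.assoc)
        finally show ?thesis using True s
          by (simp add: distrib_left add_increasing)
      qed
    qed simp
  qed
  also have "\<dots> = ennreal ?E * (ennreal K * emeasure lborel ?B * (\<integral>\<^sup>+s\<in>{T..}. heat_max TYPE('a) s \<partial>lborel)
      + (\<integral>\<^sup>+s\<in>{..<t}. (\<integral>\<^sup>+z. heat (t - s) b z * f z \<partial>lborel) \<partial>lborel))"
    by (subst nn_integral_cmult, measurable, subst nn_integral_add, measurable, subst nn_integral_cmult, measurable)
  also have "(\<integral>\<^sup>+s\<in>{..<t}. (\<integral>\<^sup>+z. heat (t - s) b z * f z \<partial>lborel) \<partial>lborel) = pot f b"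
    unfolding pot_def
    by (subst nn_integral_real_affine[where c="-1" and t=t])
       (auto intro!: nn_integral_cong split: split_indicator)
  finally show ?thesis
    unfolding nn_integral_heat_max_tail[OF T(1) d] .
qed

text \<open>Termwise differentiation inside the unit disc raises the power N by one;
  \<open>diffs\<close> takes the coefficients k^N to (k + 1)^(N + 1).\<close>

lemma summable_power_times_geometric:
  fixes r :: real
  assumes "\<bar>r\<bar> < 1"
  shows "summable (\<lambda>k. real k ^ N * r ^ k)"
  using assms
proof (induction N arbitrary: r)
  case 0
  then show ?case by (simp add: summable_geometric)
next
  case (Suc N)
  have "summable (\<lambda>k. diffs (\<lambda>k. real k ^ N) k * r ^ k)"
    using Suc.IH Suc.prems by (intro termdiff_converges[where K = 1]) auto
  then have "summable (\<lambda>k. r * (real (Suc k) ^ Suc N * r ^ k))"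
    by (intro summable_mult) (simp add: diffs_def)
  then have "summable (\<lambda>k. real (Suc k) ^ Suc N * r ^ Suc k)"
    by (simp add: ac_simps)
  then show ?case by (subst (asm) summable_Suc_iff)
qed

section \<open>Convergence of truncated moments\<close>

text \<open>An integrable majorant for a moving starting point. From |u - z|^2 \<le> 2 |u - z'|^2 +
  2, doubling the time absorbs the shift; the 2 yields exp(1 / (2 s)), and the change of
  normalisation 2^(d/2).\<close>

lemma heat_le_heat_double:
  assumes "0 < s" "dist z' z \<le> 1"
  shows "heat s z' (u::'a::euclidean_space) \<le> ennreal (2 powr (real DIM('a) / 2) * exp (1 / (2 * s))) * heat (2 * s) z u"
proof -
  have "norm (u - z) \<le> norm (u - z') + 1"
    using norm_triangle_ineq[of "u - z'" "z' - z"] assms(2) by (simp add: dist_norm)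
  then have "(norm (u - z))\<^sup>2 \<le> (norm (u - z') + 1)\<^sup>2" by (intro power_mono) auto
  also have "\<dots> \<le> 2 * (norm (u - z'))\<^sup>2 + 2"
    using zero_le_power2[of "norm (u - z') - 1"] by (simp add: power2_eq_square algebra_simps)
  finally have le: "(norm (u - z))\<^sup>2 / (4 * s) \<le> (2 * (norm (u - z'))\<^sup>2 + 2) / (4 * s)"
    using assms(1) by (intro divide_right_mono) auto
  then have "- (norm (u - z'))\<^sup>2 / (2 * s) \<le> 1 / (2 * s) + - (norm (u - z))\<^sup>2 / (2 * (2 * s))"
  proof -
    have "(2 * (norm (u - z'))\<^sup>2 + 2) / (4 * s) = (norm (u - z'))\<^sup>2 / (2 * s) + 1 / (2 * s)"
      using assms(1) by (simp add: field_simps)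
    with le show ?thesis by simp
  qed
  then have "exp (- (norm (u - z'))\<^sup>2 / (2 * s)) \<le> exp (1 / (2 * s)) * exp (- (norm (u - z))\<^sup>2 / (2 * (2 * s)))"
    unfolding exp_add[symmetric] by simp
  then have "heat_kernel s (u - z') \<le> (2 * pi * s) powr - (real DIM('a) / 2) * (exp (1 / (2 * s)) * exp (- (norm (u - z))\<^sup>2 / (2 * (2 * s))))"
    unfolding heat_kernel_def by (intro mult_left_mono) auto
  also have "(2 * pi * s) powr - (real DIM('a) / 2) = 2 powr (real DIM('a) / 2) * (2 * pi * (2 * s)) powr - (real DIM('a) / 2)"
  proof -
    have "(2 * pi * (2 * s)) powr - (real DIM('a) / 2) = (2 * (2 * pi * s)) powr - (real DIM('a) / 2)"
      by (simp only: ac_simps)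
    also have "\<dots> = 2 powr - (real DIM('a) / 2) * (2 * pi * s) powr - (real DIM('a) / 2)"
      by (rule powr_mult)
    finally show ?thesis by (simp add: powr_minus)
  qed
  finally have "heat_kernel s (u - z') \<le> (2 powr (real DIM('a) / 2) * exp (1 / (2 * s))) * heat_kernel (2 * s) (u - z)"
    unfolding heat_kernel_def by (simp only: ac_simps)
  then show ?thesis
    unfolding heat_def by (subst ennreal_mult[symmetric]) (auto intro: ennreal_leI)
qed

lemma heat_tendsto:
  assumes "z \<longlonglongrightarrow> z\<^sub>0"
  shows "(\<lambda>n. heat s (z n) u) \<longlonglongrightarrow> heat s z\<^sub>0 (u::'a::euclidean_space)"
proof (cases "s = 0")
  case True
  then show ?thesis by (simp add: heat_def heat_kernel_def)
next
  case False
  then show ?thesis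
    unfolding heat_def heat_kernel_def by (intro tendsto_ennrealI tendsto_intros assms) auto
qed

lemma nn_integral_heat_tendsto:
  fixes z :: "nat \<Rightarrow> 'a::euclidean_space"
  assumes s: "0 < s" and z: "z \<longlonglongrightarrow> z\<^sub>0"
    and [measurable]: "\<And>n. G n \<in> borel_measurable borel" "G' \<in> borel_measurable borel"
    and G: "\<And>u. (\<lambda>n. G n u) \<longlonglongrightarrow> G' u"
    and bound: "\<forall>\<^sub>F n in sequentially. \<forall>u. G n u \<le> ennreal C"
  shows "(\<lambda>n. \<integral>\<^sup>+u. heat s (z n) u * G n u \<partial>lborel) \<longlonglongrightarrow> (\<integral>\<^sup>+u. heat s z\<^sub>0 u * G' u \<partial>lborel)"
proof -
  let ?c = "ennreal (2 powr (real DIM('a) / 2) * exp (1 / (2 * s)))"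
  have "\<forall>\<^sub>F n in sequentially. dist (z n) z\<^sub>0 < 1"
    using z by (rule tendstoD) simp
  with bound have "\<forall>\<^sub>F n in sequentially. dist (z n) z\<^sub>0 < 1 \<and> (\<forall>u. G n u \<le> ennreal C)"
    by eventually_elim auto
  then obtain N where N: "\<And>n. N \<le> n \<Longrightarrow> dist (z n) z\<^sub>0 < 1 \<and> (\<forall>u. G n u \<le> ennreal C)"
    by (auto simp: eventually_sequentially)
  have G': "G' u \<le> ennreal C" for u
    using G[of u] bound by (intro tendsto_upperbound[OF G]) (auto elim: eventually_mono)
  \<comment> \<open>The domination holds only from N on, so the sequence is shifted and the limit
    transferred back at the end.\<close>
  have "(\<lambda>n. \<integral>\<^sup>+u. heat s (z (n + N)) u * G (n + N) u \<partial>lborel) \<longlonglongrightarrow> (\<integral>\<^sup>+u. heat s z\<^sub>0 u * G' u \<partial>lborel)"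
  proof (rule nn_integral_dominated_convergence[where w = "\<lambda>u. ?c * ennreal C * heat (2 * s) z\<^sub>0 u"])
    show "AE u in lborel. heat s (z (n + N)) u * G (n + N) u \<le> ?c * ennreal C * heat (2 * s) z\<^sub>0 u" for n
    proof (rule AE_I2)
      fix u
      have "heat s (z (n + N)) u * G (n + N) u \<le> (?c * heat (2 * s) z\<^sub>0 u) * ennreal C"
        using N[of "n + N"] s by (intro mult_mono heat_le_heat_double) auto
      then show "heat s (z (n + N)) u * G (n + N) u \<le> ?c * ennreal C * heat (2 * s) z\<^sub>0 u"
        by (simp add: ac_simps)
    qed
    show "(\<integral>\<^sup>+u. ?c * ennreal C * heat (2 * s) z\<^sub>0 u \<partial>lborel) < \<infinity>"
      using s by (simp add: nn_integral_cmult nn_integral_heat ennreal_mult_less_top)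
    show "AE u in lborel. (\<lambda>n. heat s (z (n + N)) u * G (n + N) u) \<longlonglongrightarrow> heat s z\<^sub>0 u * G' u"
    proof (rule AE_I2)
      fix u
      have "G' u \<noteq> \<top>" using G'[of u] by (auto simp: top_unique)
      then show "(\<lambda>n. heat s (z (n + N)) u * G (n + N) u) \<longlonglongrightarrow> heat s z\<^sub>0 u * G' u"
        by (intro tendsto_mult_ennreal LIMSEQ_ignore_initial_segment[OF heat_tendsto[OF z]]
            LIMSEQ_ignore_initial_segment[OF G]) (auto simp: heat_def)
    qed
  qed measurable
  then show ?thesis by (rule LIMSEQ_offset)
qed

text \<open>Every heat kernel has total mass 1, so each time contributes one factor K and the end
  one factor E.\<close>

lemma chain_le:
  fixes f :: "'a::euclidean_space \<Rightarrow> ennreal"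
  assumes f: "\<And>z. f z \<le> ennreal K" and h: "\<And>r z. r \<in> set (\<tau> # rs) \<Longrightarrow> h r z \<le> ennreal E"
    and rs: "sorted_wrt (<) (\<tau> # rs)"
  shows "chain f h \<tau> x rs \<le> ennreal K ^ length rs * ennreal E"
  using h rs
proof (induction rs arbitrary: \<tau> x)
  case Nil
  then show ?case by simp
next
  case (Cons r rs)
  have "chain f h \<tau> x (r # rs) \<le> (\<integral>\<^sup>+z. heat (r - \<tau>) x z * (ennreal K * (ennreal K ^ length rs * ennreal E)) \<partial>lborel)"
    unfolding chain.simps mult.assoc using Cons.prems f
    by (intro nn_integral_mono mult_left_mono mult_mono Cons.IH) auto
  also have "\<dots> = ennreal K ^ length (r # rs) * ennreal E"
    using Cons.prems(2) by (subst nn_integral_multc) (auto simp: nn_integral_heat mult.assoc)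
  finally show ?case .
qed

text \<open>The hypotheses along a sequence of durations, as dominated convergence requires; t n
  \<ge> 1 keeps the divisions under control.\<close>

locale escaping_endpoints =
  fixes t :: "nat \<Rightarrow> real" and x y :: "nat \<Rightarrow> 'a::euclidean_space" and x\<^sub>0 :: 'a and C :: real
  assumes t: "\<And>n. 1 \<le> t n" "filterlim t at_top sequentially"
    and x: "x \<longlonglongrightarrow> x\<^sub>0"
    and y: "filterlim (\<lambda>n. norm (y n)) at_top sequentially" "\<And>n. (norm (y n))\<^sup>2 / t n \<le> C"
begin

text \<open>One constant for all bridge estimates. It exists because x n is bounded and |y n|^2 / t
  n is; being at least 1, it also dominates the corresponding bounds for Brownian motion.\<close>

definition weight_bound :: real where
  "weight_bound = (SOME B. 1 \<le> B \<and> (\<forall>n. exp ((norm (y n - x n))\<^sup>2 / (2 * t n)) * 2 powr (real DIM('a) / 2) \<le> B))"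

lemma weight_bound: "1 \<le> weight_bound" "exp ((norm (y n - x n))\<^sup>2 / (2 * t n)) * 2 powr (real DIM('a) / 2) \<le> weight_bound"
proof -
  obtain B where B: "\<And>n. norm (x n) \<le> B"
    using convergent_imp_Bseq[OF convergentI[OF x]] by (auto simp: Bseq_def)
  have "(norm (y n - x n))\<^sup>2 / (2 * t n) \<le> C + B\<^sup>2" for n
  proof -
    have "(norm (y n - x n))\<^sup>2 \<le> (norm (y n) + norm (x n))\<^sup>2"
      by (intro power_mono norm_triangle_ineq4) auto
    also have "\<dots> \<le> 2 * (norm (y n))\<^sup>2 + 2 * (norm (x n))\<^sup>2"
      using zero_le_power2[of "norm (y n) - norm (x n)"] by (simp add: power2_eq_square algebra_simps)
    finally have "(norm (y n - x n))\<^sup>2 / (2 * t n) \<le> (2 * (norm (y n))\<^sup>2 + 2 * (norm (x n))\<^sup>2) / (2 * t n)"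
      using t(1)[of n] by (intro divide_right_mono) auto
    also have "\<dots> = (norm (y n))\<^sup>2 / t n + (norm (x n))\<^sup>2 / t n"
      by (simp add: add_divide_distrib)
    also have "(norm (x n))\<^sup>2 / t n \<le> B\<^sup>2"
    proof -
      have "(norm (x n))\<^sup>2 / t n \<le> (norm (x n))\<^sup>2"
        using t(1)[of n] mult_left_mono[OF t(1)[of n], of "(norm (x n))\<^sup>2"] by (simp add: divide_le_eq)
      also have "\<dots> \<le> B\<^sup>2" by (intro power_mono B) auto
      finally show ?thesis .
    qed
    finally show ?thesis using y(2)[of n] by simp
  qed
  then have "exp ((norm (y n - x n))\<^sup>2 / (2 * t n)) * 2 powr (real DIM('a) / 2)
      \<le> max 1 (exp (C + B\<^sup>2) * 2 powr (real DIM('a) / 2))" for n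
    by (intro max.coboundedI2 mult_right_mono) auto
  then have "\<exists>B\<ge>1. \<forall>n. exp ((norm (y n - x n))\<^sup>2 / (2 * t n)) * 2 powr (real DIM('a) / 2) \<le> B"
    by (intro exI[of _ "max 1 (exp (C + B\<^sup>2) * 2 powr (real DIM('a) / 2))"]) auto
  from someI_ex[OF this] show "1 \<le> weight_bound" "exp ((norm (y n - x n))\<^sup>2 / (2 * t n)) * 2 powr (real DIM('a) / 2) \<le> weight_bound"
    unfolding weight_bound_def by auto
qed

lemma bridge_weight_bounded:
  assumes "\<tau> \<le> t n / 2"
  shows "bridge_weight (t n) (x n) (y n) \<tau> z \<le> ennreal weight_bound"
proof -
  have tn: "0 < t n" using t(1)[of n] by simp
  have "bridge_weight (t n) (x n) (y n) \<tau> z \<le>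
      ennreal (exp ((norm (y n - x n))\<^sup>2 / (2 * t n)) * (t n / (t n - \<tau>)) powr (real DIM('a) / 2))"
    using assms tn by (intro bridge_weight_le) auto
  also have "\<dots> \<le> ennreal (exp ((norm (y n - x n))\<^sup>2 / (2 * t n)) * 2 powr (real DIM('a) / 2))"
    using assms tn by (intro ennreal_leI mult_left_mono powr_mono2) (auto simp: field_simps)
  also have "\<dots> \<le> ennreal weight_bound" by (intro ennreal_leI weight_bound)
  finally show ?thesis .
qed

text \<open>In the exponent |y|^2 / (2 t) and |y|^2 / (2 (t - \<tau>)) differ by \<tau> |y|^2 / (2 t
  (t - \<tau>)), which vanishes because |y|^2 / t is bounded. The cross terms vanish because |y| / t
  does, and t / (t - \<tau>) tends to 1.\<close>

lemma bridge_weight_tendsto: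
  assumes z: "z \<longlonglongrightarrow> z\<^sub>0"
  shows "(\<lambda>n. bridge_weight (t n) (x n) (y n) \<tau> (z n)) \<longlonglongrightarrow> 1"
proof -
  have inv_t: "(\<lambda>n. 1 / t n) \<longlonglongrightarrow> 0"
    using tendsto_inverse_0_at_top[OF t(2)] by (simp add: inverse_eq_divide)
  have y_t: "(\<lambda>n. norm (y n) / t n) \<longlonglongrightarrow> 0"
  proof (rule tendsto_sandwich[OF _ _ tendsto_const])
    have "C \<ge> 0" using y(2)[of 0] t(1)[of 0] by (smt (verit) divide_nonneg_nonneg zero_le_power2)
    have "norm (y n) / t n \<le> sqrt C * sqrt (1 / t n)" for n
    proof -
      have "(norm (y n) / t n)\<^sup>2 = (norm (y n))\<^sup>2 / t n * (1 / t n)"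
        by (simp add: power2_eq_square)
      also have "\<dots> \<le> C * (1 / t n)"
        using t(1)[of n] by (intro mult_right_mono y) auto
      finally show ?thesis
        using real_le_rsqrt by (simp add: real_sqrt_mult[symmetric] del: real_sqrt_divide)
    qed
    then show "\<forall>\<^sub>F n in sequentially. norm (y n) / t n \<le> sqrt C * sqrt (1 / t n)" by simp
    show "(\<lambda>n. sqrt C * sqrt (1 / t n)) \<longlonglongrightarrow> 0"
      using tendsto_mult[OF tendsto_const tendsto_real_sqrt[OF inv_t], of "sqrt C"] by simp
    show "\<forall>\<^sub>F n in sequentially. 0 \<le> norm (y n) / t n"
      using t(1) by (intro always_eventually allI divide_nonneg_nonneg) (auto intro: order.trans[of 0 1])
  qed
  have r_t: "(\<lambda>n. t n / (t n - \<tau>)) \<longlonglongrightarrow> 1"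
  proof -
    have "(\<lambda>n. 1 / (1 - \<tau> * (1 / t n))) \<longlonglongrightarrow> 1 / (1 - \<tau> * 0)"
      by (intro tendsto_intros inv_t) auto
    moreover have "1 / (1 - \<tau> * (1 / t n)) = t n / (t n - \<tau>)" for n
      using t(1)[of n] by (simp add: field_simps)
    ultimately show ?thesis by simp
  qed
  define D where "D n = (norm (y n - x n))\<^sup>2 / (2 * t n) - (norm (y n - z n))\<^sup>2 / (2 * (t n - \<tau>))" for n
  have D: "D \<longlonglongrightarrow> 0"
  proof -
    have yx: "(\<lambda>n. (y n \<bullet> w n) / t n) \<longlonglongrightarrow> 0" if w: "w \<longlonglongrightarrow> w\<^sub>0" for w w\<^sub>0
    proof (rule Lim_null_comparison)
      show "\<forall>\<^sub>F n in sequentially. norm ((y n \<bullet> w n) / t n) \<le> norm (y n) / t n * norm (w n)"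
      proof (intro always_eventually allI)
        fix n
        have "\<bar>y n \<bullet> w n\<bar> / t n \<le> norm (y n) * norm (w n) / t n"
          using t(1)[of n] by (intro divide_right_mono Cauchy_Schwarz_ineq2) auto
        then show "norm ((y n \<bullet> w n) / t n) \<le> norm (y n) / t n * norm (w n)"
          using t(1)[of n] by simp
      qed
      show "(\<lambda>n. norm (y n) / t n * norm (w n)) \<longlonglongrightarrow> 0"
        using tendsto_mult[OF y_t tendsto_norm[OF w]] by simp
    qed
    let ?q = "\<lambda>n. t n / (t n - \<tau>)"
    have "(\<lambda>n. - (y n \<bullet> x n) / t n + (x n \<bullet> x n) / 2 * (1 / t n) + ?q n * ((y n \<bullet> z n) / t n) - ?q n * ((z n \<bullet> z n) / 2 * (1 / t n))
         - \<tau> / 2 * ((norm (y n))\<^sup>2 / t n * (1 / t n)) * ?q n) \<longlonglongrightarrow> - 0 + (x\<^sub>0 \<bullet> x\<^sub>0) / 2 * 0 + 1 * 0 - 1 * ((z\<^sub>0 \<bullet> z\<^sub>0) / 2 * 0) - \<tau> / 2 * 0 * 1"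
    proof (intro tendsto_intros inv_t r_t x z yx[OF z])
      show "(\<lambda>n. - (y n \<bullet> x n) / t n) \<longlonglongrightarrow> - 0"
        using tendsto_minus[OF yx[OF x]] by simp
      show "(\<lambda>n. (norm (y n))\<^sup>2 / t n * (1 / t n)) \<longlonglongrightarrow> 0"
        using tendsto_power[OF y_t, of 2] by (simp add: power2_eq_square)
    qed auto
    moreover have "\<forall>\<^sub>F n in sequentially. \<tau> < t n"
      using t(2) by (simp add: filterlim_at_top_dense)
    then have "\<forall>\<^sub>F n in sequentially. D n = - (y n \<bullet> x n) / t n + (x n \<bullet> x n) / 2 * (1 / t n) + ?q n * ((y n \<bullet> z n) / t n) - ?q n * ((z n \<bullet> z n) / 2 * (1 / t n))
         - \<tau> / 2 * ((norm (y n))\<^sup>2 / t n * (1 / t n)) * ?q n"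
    proof eventually_elim
      case (elim n)
      have tn: "0 < t n" using t(1)[of n] by simp
      have "(norm (y n - x n))\<^sup>2 = y n \<bullet> y n - 2 * (y n \<bullet> x n) + x n \<bullet> x n"
        "(norm (y n - z n))\<^sup>2 = y n \<bullet> y n - 2 * (y n \<bullet> z n) + z n \<bullet> z n"
        by (simp_all add: power2_norm_eq_inner inner_diff_left inner_diff_right inner_commute)
      \<comment> \<open>The expansion of \<open>D\<close> as an identity of real numbers, with A =
        |y|^2, p and q the inner products of y with x and z, X and Z the squared norms of x and z, T
        = t n and u = t n - \<tau>.\<close>
      moreover have "(A - 2 * p + X) / (2 * T) - (A - 2 * q + Z) / (2 * u)
          = - p / T + X / 2 * (1 / T) + T / u * (q / T) - T / u * (Z / 2 * (1 / T)) - (T - u) / 2 * (A / T * (1 / T)) * (T / u)"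
        if "0 < T" "0 < u" for A p q X Z T u :: real
      proof -
        have "T / u * (q / T) = q / u" "T / u * (Z / 2 * (1 / T)) = Z / (2 * u)"
          "(T - u) / 2 * (A / T * (1 / T)) * (T / u) = A / (2 * u) - A / (2 * T)"
          using that by (simp_all add: field_simps)
        then show ?thesis
          by (simp add: add_divide_distrib diff_divide_distrib)
      qed
      note this[of "t n" "t n - \<tau>" "y n \<bullet> y n" "y n \<bullet> x n" "x n \<bullet> x n" "y n \<bullet> z n" "z n \<bullet> z n"]
      ultimately show ?case
        unfolding D_def using elim tn by (simp add: power2_norm_eq_inner)
    qed
    ultimately show ?thesis by (subst tendsto_cong) (auto simp: eventually_sequentially)
  qed
  have "(\<lambda>n. (t n / (t n - \<tau>)) powr (real DIM('a) / 2) * exp (D n)) \<longlonglongrightarrow> 1 powr (real DIM('a) / 2) * exp 0"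
    by (intro tendsto_intros r_t D) auto
  moreover have "\<forall>\<^sub>F n in sequentially. \<tau> < t n"
    using t(2) by (simp add: filterlim_at_top_dense)
  then have "\<forall>\<^sub>F n in sequentially. heat_kernel (t n - \<tau>) (y n - z n) / heat_kernel (t n) (y n - x n)
      = (t n / (t n - \<tau>)) powr (real DIM('a) / 2) * exp (D n)"
  proof eventually_elim
    case (elim n)
    have tn: "0 < t n" using t(1)[of n] by simp
    have "(t n / (t n - \<tau>)) powr (real DIM('a) / 2) = (2 * pi * t n) powr (real DIM('a) / 2) / (2 * pi * (t n - \<tau>)) powr (real DIM('a) / 2)"
      using elim tn by (subst powr_divide[symmetric]) auto
    moreover have "exp (D n) = exp ((norm (y n - x n))\<^sup>2 / (2 * t n)) * exp (- (norm (y n - z n))\<^sup>2 / (2 * (t n - \<tau>)))"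
      unfolding D_def exp_add[symmetric] by simp
    moreover have "heat_kernel (t n - \<tau>) (y n - z n) / heat_kernel (t n) (y n - x n)
        = heat_kernel (t n - \<tau>) (y n - z n) * (1 / heat_kernel (t n) (y n - x n))"
      by simp
    ultimately show ?case
      unfolding one_div_heat_kernel[OF tn] heat_kernel_def[of "t n - \<tau>"]
      by (simp only: powr_minus divide_inverse ac_simps)
  qed
  ultimately have "(\<lambda>n. heat_kernel (t n - \<tau>) (y n - z n) / heat_kernel (t n) (y n - x n)) \<longlonglongrightarrow> 1"
    by (subst tendsto_cong) auto
  from tendsto_ennrealI[OF this] show ?thesis unfolding bridge_weight_def by simp
qed

text \<open>Convergence passes through one heat kernel at a time, from the terminal weight
  backwards. The starting point is allowed to move because the bridges start at x n.\<close>

lemma chain_tendsto: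
  fixes f :: "'a \<Rightarrow> ennreal"
  assumes [measurable]: "f \<in> borel_measurable borel" and f: "\<And>z. f z \<le> ennreal K"
    and K: "0 \<le> K" and rs: "sorted_wrt (<) (\<tau> # rs)" and z: "z \<longlonglongrightarrow> z\<^sub>0"
  shows "(\<lambda>n. chain f (bridge_weight (t n) (x n) (y n)) \<tau> (z n) rs) \<longlonglongrightarrow> chain f (\<lambda>_ _. 1) \<tau> z\<^sub>0 rs"
  using rs z
proof (induction rs arbitrary: \<tau> z z\<^sub>0)
  case Nil
  then show ?case using bridge_weight_tendsto by simp
next
  case (Cons r rs)
  have f_top: "f u \<noteq> \<top>" for u using f[of u] by (auto simp: top_unique)
  show ?case
    unfolding chain.simps mult.assoc
  proof (rule nn_integral_heat_tendsto[where C = "K * (K ^ length rs * weight_bound)"])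
    show "0 < r - \<tau>" using Cons.prems by simp
    show "(\<lambda>n. f u * chain f (bridge_weight (t n) (x n) (y n)) r u rs) \<longlonglongrightarrow> f u * chain f (\<lambda>_ _. 1) r u rs" for u
    proof -
      have "chain f (\<lambda>_ _. 1) r u rs \<le> ennreal K ^ length rs * ennreal 1"
        using Cons.prems by (intro chain_le f) auto
      also have "\<dots> < \<top>" by (simp add: power_less_top_ennreal)
      finally have "chain f (\<lambda>_ _. 1) r u rs \<noteq> \<top>" by simp
      with f_top[of u] Cons.prems show ?thesis
        by (intro tendsto_mult_ennreal Cons.IH tendsto_const) auto
    qed
    \<comment> \<open>The sum dominates every time in the list, so eventually all of them lie before
      half time, where the weight is bounded.\<close>
    have "\<forall>\<^sub>F n in sequentially. 2 * (\<Sum>q\<leftarrow>r # rs. \<bar>q\<bar>) \<le> t n"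
      using t(2) by (simp add: filterlim_at_top)
    then show "\<forall>\<^sub>F n in sequentially. \<forall>u. f u * chain f (bridge_weight (t n) (x n) (y n)) r u rs \<le> ennreal (K * (K ^ length rs * weight_bound))"
    proof (eventually_elim, intro allI)
      fix n u assume le: "2 * (\<Sum>q\<leftarrow>r # rs. \<bar>q\<bar>) \<le> t n"
      have "chain f (bridge_weight (t n) (x n) (y n)) r u rs \<le> ennreal K ^ length rs * ennreal weight_bound"
      proof (rule chain_le)
        show "f z \<le> ennreal K" for z by (rule f)
        fix q z assume "q \<in> set (r # rs)"
        then have "\<bar>q\<bar> \<le> (\<Sum>q\<leftarrow>r # rs. \<bar>q\<bar>)" by (intro member_le_sum_list) auto
        with le have "q \<le> t n / 2" by simp
        then show "bridge_weight (t n) (x n) (y n) q z \<le> ennreal weight_bound" by (rule bridge_weight_bounded)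
      qed (use Cons.prems in auto)
      then have "f u * chain f (bridge_weight (t n) (x n) (y n)) r u rs \<le> ennreal K * (ennreal K ^ length rs * ennreal weight_bound)"
        by (intro mult_mono f) auto
      then show "f u * chain f (bridge_weight (t n) (x n) (y n)) r u rs \<le> ennreal (K * (K ^ length rs * weight_bound))"
        using weight_bound(1) K by (simp add: ennreal_mult ennreal_power)
    qed
  qed (use Cons.prems in measurable)
qed

end

text \<open>Each power is traded for an integral over one more time by
  \<open>nn_integral_occupation_Suc\<close>, until only the values at finitely many times are left
  and convergence of \<open>chain\<close> applies. The bounded horizon and g \<le> K give the
  majorant; the processes may live on different probability spaces.\<close>

lemma truncated_moment_tendsto:
  fixes f :: "'a::euclidean_space \<Rightarrow> ennreal"
  assumes occ: "\<And>n. occupation (M n) (g n) (J n) f (h n) (a n)" "\<And>n. prob_space (M n)"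
    and occ': "occupation M' g' J' f h' a'" "prob_space M'"
    and J: "{0<..} \<subseteq> J'" "\<And>T. \<forall>\<^sub>F n in sequentially. {0<..<T} \<subseteq> J n"
    and g: "\<And>n s \<omega>. g n s \<omega> \<le> ennreal K" "\<And>s \<omega>. g' s \<omega> \<le> ennreal K"
    and fdd: "\<And>rs. sorted_wrt (<) (0 # rs) \<Longrightarrow> rs \<noteq> [] \<Longrightarrow> (\<lambda>n. chain f (h n) 0 (a n) rs) \<longlonglongrightarrow> chain f h' 0 a' rs"
    and rs: "sorted_wrt (<) rs" "\<And>q. q \<in> set rs \<Longrightarrow> 0 < q" "\<And>q. q \<in> set rs \<Longrightarrow> r \<le> q"
  shows "(\<lambda>n. \<integral>\<^sup>+\<omega>. (occ_time (g n) {..<r} \<omega>) ^ k * (\<Prod>q\<leftarrow>rs. g n q \<omega>) \<partial>M n)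
    \<longlonglongrightarrow> (\<integral>\<^sup>+\<omega>. (occ_time g' {..<r} \<omega>) ^ k * (\<Prod>q\<leftarrow>rs. g' q \<omega>) \<partial>M')"
  using rs
proof (induction k arbitrary: r rs)
  case 0
  show ?case
  proof (cases "rs = []")
    case True
    then show ?thesis using occ(2) occ'(2) by (simp add: prob_space.emeasure_space_1)
  next
    case False
    have sorted: "sorted_wrt (<) (0 # rs)" using 0 by simp
    define T where "T = (\<Sum>q\<leftarrow>rs. \<bar>q\<bar>) + 1"
    have "set rs \<subseteq> {0<..<T}"
      using 0 member_le_sum_list[of _ "map abs rs"] by (fastforce simp: T_def)
    with J(2)[of T] have "\<forall>\<^sub>F n in sequentially. (\<integral>\<^sup>+\<omega>. (\<Prod>q\<leftarrow>rs. g n q \<omega>) \<partial>M n) = chain f (h n) 0 (a n) rs"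
      by (auto elim!: eventually_mono intro!: occupation.fdd[OF occ(1) False 0(1)])
    moreover have "(\<integral>\<^sup>+\<omega>. (\<Prod>q\<leftarrow>rs. g' q \<omega>) \<partial>M') = chain f h' 0 a' rs"
      using J(1) 0 by (intro occupation.fdd[OF occ'(1) False 0(1)]) auto
    ultimately show ?thesis
      using fdd[OF sorted False] by (simp add: tendsto_cong)
  qed
next
  case (Suc k)
  let ?I = "\<lambda>n s. \<integral>\<^sup>+\<omega>. (occ_time (g n) {..<s} \<omega>) ^ k * (g n s \<omega> * (\<Prod>q\<leftarrow>rs. g n q \<omega>)) \<partial>M n"
  let ?I' = "\<lambda>s. \<integral>\<^sup>+\<omega>. (occ_time g' {..<s} \<omega>) ^ k * (g' s \<omega> * (\<Prod>q\<leftarrow>rs. g' q \<omega>)) \<partial>M'"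
  \<comment> \<open>An occupation integral up to r is at most K r, and each of the remaining factors
    at most K.\<close>
  let ?b = "(ennreal K * ennreal r) ^ k * (ennreal K * ennreal K ^ length rs)"
  have outside: "g0 s \<omega> = 0" if "occupation M0 g0 J0 f h0 a0" "s \<le> 0" for M0 :: "'m measure" and g0 J0 h0 a0 s \<omega>
    using occupation.J_pos[OF that(1)] that(2) by (intro occupation.g_outside[OF that(1)]) auto
  have le: "(\<integral>\<^sup>+\<omega>. (occ_time g0 {..<s} \<omega>) ^ k * (g0 s \<omega> * (\<Prod>q\<leftarrow>rs. g0 q \<omega>)) \<partial>M0) * indicator {..<r} s
      \<le> ?b * indicator {0..r} s"
    if o: "occupation M0 g0 J0 f h0 a0" and p: "prob_space M0" and g0: "\<And>s \<omega>. g0 s \<omega> \<le> ennreal K"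
    for M0 :: "'m measure" and g0 J0 h0 a0 s
  proof (cases "s \<in> {0<..<r}")
    case True
    interpret prob_space M0 by fact
    have prod_le: "(\<Prod>q\<leftarrow>qs. g0 q \<omega>) \<le> ennreal K ^ length qs" for qs \<omega>
      by (induction qs) (auto intro!: mult_mono g0)
    have int_le: "(occ_time g0 {..<s} \<omega>) \<le> ennreal K * ennreal r" for \<omega>
    proof -
      have "(occ_time g0 {..<s} \<omega>) \<le> (\<integral>\<^sup>+u. ennreal K * indicator {0..r} u \<partial>lborel)"
        using g0 outside[OF o] True by (intro nn_integral_mono) (force split: split_indicator simp: not_le)
      then show ?thesis using True by (simp add: nn_integral_cmult)
    qed
    have "(\<integral>\<^sup>+\<omega>. (occ_time g0 {..<s} \<omega>) ^ k * (g0 s \<omega> * (\<Prod>q\<leftarrow>rs. g0 q \<omega>)) \<partial>M0) \<le> (\<integral>\<^sup>+\<omega>. ?b \<partial>M0)"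
      by (intro nn_integral_mono mult_mono power_mono int_le g0 prod_le) auto
    then show ?thesis using True by (simp add: emeasure_space_1)
  next
    case False
    then show ?thesis using outside[OF o, of s] by (auto split: split_indicator)
  qed
  have meas: "(\<lambda>s. (\<integral>\<^sup>+\<omega>. (occ_time g0 {..<s} \<omega>) ^ k * (g0 s \<omega> * (\<Prod>q\<leftarrow>rs. g0 q \<omega>)) \<partial>M0) * indicator {..<r} s) \<in> borel_measurable lborel"
    if o: "occupation M0 g0 J0 f h0 a0" for M0 :: "'m measure" and g0 J0 h0 a0
  proof -
    interpret occupation M0 g0 J0 f h0 a0 by fact
    have [measurable]: "(\<lambda>w. g0 (a w) (b w)) \<in> borel_measurable N"
      if "a \<in> borel_measurable N" "b \<in> N \<rightarrow>\<^sub>M M0" for a b and N :: "'n measure"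
      using measurable_compose[OF measurable_Pair[OF that] g] by simp
    show ?thesis by measurable
  qed
  have "(\<lambda>n. \<integral>\<^sup>+s. ?I n s * indicator {..<r} s \<partial>lborel) \<longlonglongrightarrow> (\<integral>\<^sup>+s. ?I' s * indicator {..<r} s \<partial>lborel)"
  proof (rule nn_integral_dominated_convergence[where w = "\<lambda>s. ?b * indicator {0..r} s"])
    show "(\<lambda>s. ?I n s * indicator {..<r} s) \<in> borel_measurable lborel" for n by (rule meas[OF occ(1)])
    show "(\<lambda>s. ?I' s * indicator {..<r} s) \<in> borel_measurable lborel" by (rule meas[OF occ'(1)])
    show "AE s in lborel. ?I n s * indicator {..<r} s \<le> ?b * indicator {0..r} s" for n
      by (intro AE_I2 le[OF occ g(1)])
    show "(\<integral>\<^sup>+s. ?b * indicator {0..r} s \<partial>lborel) < \<infinity>"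
      by (cases "0 \<le> r") (auto simp: nn_integral_cmult ennreal_mult_less_top power_less_top_ennreal)
    show "AE s in lborel. (\<lambda>n. ?I n s * indicator {..<r} s) \<longlonglongrightarrow> ?I' s * indicator {..<r} s"
    proof (rule AE_I2)
      fix s
      show "(\<lambda>n. ?I n s * indicator {..<r} s) \<longlonglongrightarrow> ?I' s * indicator {..<r} s"
      proof (cases "s \<in> {0<..<r}")
        case True
        \<comment> \<open>As s < r and r is at most every entry of \<open>rs\<close>, prepending s
          keeps the list strictly sorted.\<close>
        then have "sorted_wrt (<) (s # rs)" "\<And>q. q \<in> set (s # rs) \<Longrightarrow> 0 < q" "\<And>q. q \<in> set (s # rs) \<Longrightarrow> s \<le> q"
          using Suc.prems by force+
        from Suc.IH[OF this] True show ?thesis by simp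
      next
        case False
        then show ?thesis using outside[OF occ(1), of s] outside[OF occ'(1), of s]
          by (auto split: split_indicator)
      qed
    qed
  qed measurable
  then have lim: "(\<lambda>n. of_nat (Suc k) * (\<integral>\<^sup>+s\<in>{..<r}. ?I n s \<partial>lborel)) \<longlonglongrightarrow> of_nat (Suc k) * (\<integral>\<^sup>+s\<in>{..<r}. ?I' s \<partial>lborel)"
    by (intro tendsto_mult_ennreal tendsto_const) auto
  have E: "(\<integral>\<^sup>+\<omega>. (occ_time g0 {..<r} \<omega>) ^ Suc k * (\<Prod>q\<leftarrow>rs. g0 q \<omega>) \<partial>M0)
    = of_nat (Suc k) * (\<integral>\<^sup>+s\<in>{..<r}. (\<integral>\<^sup>+\<omega>. (occ_time g0 {..<s} \<omega>) ^ k * (g0 s \<omega> * (\<Prod>q\<leftarrow>rs. g0 q \<omega>)) \<partial>M0) \<partial>lborel)"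
    if o: "occupation M0 g0 J0 f h0 a0" for M0 :: "'m measure" and g0 J0 h0 a0
    by (rule nn_integral_occupation_Suc)
       (use occupation.prod_g_meas[OF o] occupation.g[OF o] in \<open>auto intro: occupation.axioms(1)[OF o]\<close>)
  show ?case
    unfolding E[OF occ(1)] E[OF occ'(1)] by (rule lim)
qed

section \<open>From moments to continuous test functions\<close>

text \<open>All values lie in one compact interval, on which \<phi> is uniformly close to a
  polynomial, and the expectation of a polynomial is a finite combination of moments.\<close>

lemma expectation_tendsto_of_moments:
  fixes F :: "nat \<Rightarrow> 'b \<Rightarrow> real" and F' :: "'w \<Rightarrow> real" and \<phi> :: "real \<Rightarrow> real"
  assumes M: "\<And>n. prob_space (M n)" "prob_space M'"
    and F_m [measurable]: "\<And>n. F n \<in> borel_measurable (M n)" "F' \<in> borel_measurable M'"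
    and F: "\<And>n \<omega>. F n \<omega> \<in> {0..B}" "\<And>\<omega>. F' \<omega> \<in> {0..B}"
    and moments: "\<And>k. (\<lambda>n. \<integral>\<omega>. F n \<omega> ^ k \<partial>M n) \<longlonglongrightarrow> (\<integral>\<omega>. F' \<omega> ^ k \<partial>M')"
    and \<phi>: "continuous_on UNIV \<phi>"
  shows "(\<lambda>n. \<integral>\<omega>. \<phi> (F n \<omega>) \<partial>M n) \<longlonglongrightarrow> (\<integral>\<omega>. \<phi> (F' \<omega>) \<partial>M')"
proof (rule tendstoI)
  fix \<epsilon> :: real assume "0 < \<epsilon>"
  have [measurable]: "\<phi> \<in> borel_measurable borel"
    using \<phi> by (rule borel_measurable_continuous_onI)
  obtain p where p: "real_polynomial_function p" "\<And>z. z \<in> {0..B} \<Longrightarrow> \<bar>\<phi> z - p z\<bar> < \<epsilon> / 3"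
    by (rule Stone_Weierstrass_real_polynomial_function[of "{0..B}" \<phi> "\<epsilon> / 3"])
       (use \<phi> \<open>0 < \<epsilon>\<close> in \<open>auto intro: continuous_on_subset\<close>)
  obtain c N where p_eq: "p = (\<lambda>z. \<Sum>i\<le>N. c i * z ^ i)"
    using p(1) unfolding real_polynomial_function_iff_sum by blast
  have bounded: "integrable M0 (\<lambda>\<omega>. \<psi> (F0 \<omega>))"
    if "prob_space M0" "\<And>\<omega>. F0 \<omega> \<in> {0..B}" "continuous_on UNIV \<psi>" and [measurable]: "F0 \<in> borel_measurable M0"
    for M0 :: "'m measure" and F0 and \<psi> :: "real \<Rightarrow> real"
  proof -
    interpret prob_space M0 by fact
    have [measurable]: "\<psi> \<in> borel_measurable borel"
      using that(3) by (rule borel_measurable_continuous_onI)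
    have "bounded (\<psi> ` {0..B})"
      using that(3) by (intro compact_imp_bounded compact_continuous_image) (auto intro: continuous_on_subset)
    then obtain b where b: "\<And>z. z \<in> {0..B} \<Longrightarrow> \<bar>\<psi> z\<bar> \<le> b" unfolding bounded_iff by fastforce
    show ?thesis by (rule integrable_const_bound[where B = b]) (use b that(2) in auto)
  qed
  have close: "\<bar>(\<integral>\<omega>. \<phi> (F0 \<omega>) \<partial>M0) - (\<integral>\<omega>. p (F0 \<omega>) \<partial>M0)\<bar> \<le> \<epsilon> / 3"
    and expand: "(\<integral>\<omega>. p (F0 \<omega>) \<partial>M0) = (\<Sum>i\<le>N. c i * (\<integral>\<omega>. F0 \<omega> ^ i \<partial>M0))"
    if M0: "prob_space M0" and F0: "\<And>\<omega>. F0 \<omega> \<in> {0..B}" and F0_m: "F0 \<in> borel_measurable M0"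
    for M0 :: "'m measure" and F0
  proof -
    interpret prob_space M0 by fact
    have p_cont: "continuous_on UNIV p" unfolding p_eq by (intro continuous_intros)
    note int = bounded[OF M0 F0 \<phi> F0_m] bounded[OF M0 F0 p_cont F0_m]
    have "\<bar>(\<integral>\<omega>. \<phi> (F0 \<omega>) \<partial>M0) - (\<integral>\<omega>. p (F0 \<omega>) \<partial>M0)\<bar> = \<bar>\<integral>\<omega>. \<phi> (F0 \<omega>) - p (F0 \<omega>) \<partial>M0\<bar>"
      using int by (subst Bochner_Integration.integral_diff) auto
    also have "\<dots> \<le> (\<integral>\<omega>. \<bar>\<phi> (F0 \<omega>) - p (F0 \<omega>)\<bar> \<partial>M0)"
      by (rule integral_abs_bound)
    also have "\<dots> \<le> (\<integral>\<omega>. \<epsilon> / 3 \<partial>M0)"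
      using int p(2)[OF F0] by (intro integral_mono) (auto intro: less_imp_le)
    finally show "\<bar>(\<integral>\<omega>. \<phi> (F0 \<omega>) \<partial>M0) - (\<integral>\<omega>. p (F0 \<omega>) \<partial>M0)\<bar> \<le> \<epsilon> / 3"
      by (simp add: prob_space)
    have "integrable M0 (\<lambda>\<omega>. F0 \<omega> ^ i)" for i
      by (rule bounded[OF M0 F0 _ F0_m, of "\<lambda>z. z ^ i"]) (intro continuous_intros)
    then show "(\<integral>\<omega>. p (F0 \<omega>) \<partial>M0) = (\<Sum>i\<le>N. c i * (\<integral>\<omega>. F0 \<omega> ^ i \<partial>M0))"
      unfolding p_eq by simp
  qed
  have "(\<lambda>n. \<integral>\<omega>. p (F n \<omega>) \<partial>M n) \<longlonglongrightarrow> (\<integral>\<omega>. p (F' \<omega>) \<partial>M')"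
    unfolding expand[OF M(1) F(1) F_m(1)] expand[OF M(2) F(2) F_m(2)]
    by (intro tendsto_intros moments)
  from tendstoD[OF this, of "\<epsilon> / 3"] \<open>0 < \<epsilon>\<close>
  have "\<forall>\<^sub>F n in sequentially. dist (\<integral>\<omega>. p (F n \<omega>) \<partial>M n) (\<integral>\<omega>. p (F' \<omega>) \<partial>M') < \<epsilon> / 3" by simp
  then show "\<forall>\<^sub>F n in sequentially. dist (\<integral>\<omega>. \<phi> (F n \<omega>) \<partial>M n) (\<integral>\<omega>. \<phi> (F' \<omega>) \<partial>M') < \<epsilon>"
  proof eventually_elim
    case (elim n)
    then show ?case
      using close[OF M(1) F(1) F_m(1), of n] close[OF M(2) F(2) F_m(2)] unfolding dist_real_def by linarith
  qed
qed

text \<open>A substitute for uniform continuity under exponential growth. In the application s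
  bounds the absolute path integral and d its tail, so the error needs only a small mean of d and an
  exponential moment of s at the larger rate \<beta>.\<close>

lemma exponential_growth_modulus:
  fixes \<phi> :: "real \<Rightarrow> real"
  assumes \<phi>: "continuous_on UNIV \<phi>" and growth: "\<And>z. \<bar>\<phi> z\<bar> \<le> C * exp (b * \<bar>z\<bar>)" and b: "0 \<le> b" "b < \<beta>"
    and "0 < \<epsilon>" "0 \<le> \<Gamma>"
  obtains L c where "0 \<le> L" "0 \<le> c" "c * \<Gamma> \<le> \<epsilon>"
    "\<And>(z::real) z' s d. \<bar>z\<bar> \<le> s \<Longrightarrow> \<bar>z'\<bar> \<le> s \<Longrightarrow> \<bar>z - z'\<bar> \<le> d \<Longrightarrow> \<bar>\<phi> z - \<phi> z'\<bar> \<le> \<epsilon> + L * d + c * exp (\<beta> * s)"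
proof -
  have C: "0 \<le> C" using growth[of 0] by simp
  have growth': "\<bar>\<phi> z\<bar> \<le> C * exp (b * s)" if "\<bar>z\<bar> \<le> s" for z s
    using that b C by (intro order.trans[OF growth] mult_left_mono) (auto intro: mult_left_mono)
  have "((\<lambda>m. 2 * C * exp (- ((\<beta> - b) * m)) * \<Gamma>) \<longlongrightarrow> 2 * C * 0 * \<Gamma>) at_top"
    using b by (intro tendsto_intros filterlim_compose[OF exp_at_bot] filterlim_uminus_at_bot[THEN iffD1])
      (auto intro!: filterlim_tendsto_pos_mult_at_top[OF tendsto_const] filterlim_ident simp: filterlim_uminus_at_bot)
  then have "\<forall>\<^sub>F m in at_top. 2 * C * exp (- ((\<beta> - b) * m)) * \<Gamma> < \<epsilon>"
    using \<open>0 < \<epsilon>\<close> by (intro order_tendstoD(2)) auto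
  then obtain m where m: "2 * C * exp (- ((\<beta> - b) * m)) * \<Gamma> \<le> \<epsilon>"
    by (metis eventually_at_top_linorder less_imp_le order_refl)
  have "uniformly_continuous_on {- m..m} \<phi>"
    using \<phi> by (intro compact_uniformly_continuous) (auto intro: continuous_on_subset)
  then obtain \<delta> where \<delta>: "0 < \<delta>"
    "\<And>z z'. z \<in> {- m..m} \<Longrightarrow> z' \<in> {- m..m} \<Longrightarrow> \<bar>z' - z\<bar> < \<delta> \<Longrightarrow> \<bar>\<phi> z' - \<phi> z\<bar> < \<epsilon>"
    using \<open>0 < \<epsilon>\<close> unfolding uniformly_continuous_on_def dist_real_def by metis
  \<comment> \<open>For s \<le> m, uniform continuity handles d < \<delta>, and for d \<ge> \<delta>
    the crude bound is multiplied by d / \<delta>. For s > m, the margin \<beta> - b gains the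
    factor exp(-(\<beta> - b) m), with m chosen to make c \<Gamma> at most \<epsilon>.\<close>
  let ?L = "2 * C * exp (b * m) / \<delta>" and ?c = "2 * C * exp (- ((\<beta> - b) * m))"
  show thesis
  proof
    show "0 \<le> ?L" "0 \<le> ?c" "?c * \<Gamma> \<le> \<epsilon>" using C \<delta> m by auto
    fix z z' s d :: real assume s: "\<bar>z\<bar> \<le> s" "\<bar>z'\<bar> \<le> s" and d: "\<bar>z - z'\<bar> \<le> d"
    have "0 \<le> d" using d by simp
    have 2: "\<bar>\<phi> z - \<phi> z'\<bar> \<le> 2 * C * exp (b * s)"
      using growth'[OF s(1)] growth'[OF s(2)] by simp
    have pos: "0 \<le> ?L * d" "0 \<le> ?c * exp (\<beta> * s)" using C \<delta> \<open>0 \<le> d\<close> by auto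
    consider "s \<le> m" "d < \<delta>" | "s \<le> m" "\<delta> \<le> d" | "m < s" by linarith
    then show "\<bar>\<phi> z - \<phi> z'\<bar> \<le> \<epsilon> + ?L * d + ?c * exp (\<beta> * s)"
    proof cases
      case 1
      then have "\<bar>\<phi> z - \<phi> z'\<bar> < \<epsilon>" using s d by (intro \<delta>(2)) auto
      with pos show ?thesis by linarith
    next
      case 2
      have "2 * C * exp (b * s) \<le> 2 * C * exp (b * m)"
        using 2 b C by (intro mult_left_mono) (auto intro: mult_left_mono)
      also have "\<dots> = ?L * \<delta>" using \<delta>(1) by simp
      also have "\<dots> \<le> ?L * d" using 2 C \<delta> by (intro mult_left_mono) auto
      finally show ?thesis using \<open>\<bar>\<phi> z - \<phi> z'\<bar> \<le> 2 * C * exp (b * s)\<close> pos \<open>0 < \<epsilon>\<close> by linarith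
    next
      case 3
      have "b * s = - ((\<beta> - b) * s) + \<beta> * s" by (simp add: algebra_simps)
      then have "2 * C * exp (b * s) = 2 * C * exp (- ((\<beta> - b) * s)) * exp (\<beta> * s)"
        by (simp only: exp_add mult.assoc)
      also have "\<dots> \<le> ?c * exp (\<beta> * s)"
        using 3 b C by (intro mult_right_mono mult_left_mono) (auto intro: mult_left_mono)
      finally show ?thesis using 2 pos \<open>0 < \<epsilon>\<close> by linarith
    qed
  qed
qed

text \<open>The exponential as a series in [0, \<infinity>]: its expectation is the sum of the
  moments by monotone convergence, and for \<beta> > 0 an infinite argument gives \<infinity>, in
  agreement with \<open>exp_ereal\<close>.\<close>

definition exp_series :: "real \<Rightarrow> ennreal \<Rightarrow> ennreal" where
  "exp_series \<beta> u = (\<Sum>k. ennreal (\<beta> ^ k / fact k) * u ^ k)"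

lemma borel_measurable_exp_series [measurable (raw)]:
  "g \<in> borel_measurable M \<Longrightarrow> (\<lambda>w. exp_series \<beta> (g w)) \<in> borel_measurable M"
  unfolding exp_series_def by measurable

lemma exp_series_ennreal:
  assumes "0 \<le> \<beta>" "0 \<le> u"
  shows "exp_series \<beta> (ennreal u) = ennreal (exp (\<beta> * u))"
proof -
  have "(\<lambda>k. (\<beta> * u) ^ k / fact k) sums exp (\<beta> * u)"
    using exp_converges[of "\<beta> * u"] by (simp add: divide_inverse mult.commute)
  then have "(\<Sum>k. ennreal ((\<beta> * u) ^ k / fact k)) = ennreal (exp (\<beta> * u))"
    using assms by (intro suminf_ennreal_eq) auto
  moreover have "ennreal (\<beta> ^ k / fact k) * ennreal u ^ k = ennreal ((\<beta> * u) ^ k / fact k)" for k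
    using assms by (simp add: ennreal_power ennreal_mult[symmetric] power_mult_distrib)
  ultimately show ?thesis unfolding exp_series_def by simp
qed

lemma exp_series_top:
  assumes "0 < \<beta>"
  shows "exp_series \<beta> \<top> = \<top>"
proof -
  have "(\<Sum>k\<in>{1}. ennreal (\<beta> ^ k / fact k) * \<top> ^ k) \<le> exp_series \<beta> \<top>"
    unfolding exp_series_def by (rule sum_le_suminf) auto
  then show ?thesis using assms by (simp add: ennreal_mult_top top_unique)
qed

lemma exp_ereal_eq_exp_series:
  assumes "0 < \<beta>"
  shows "exp_ereal (ereal \<beta> * enn2ereal u) = exp_series \<beta> u"
proof (cases u)
  case (real r)
  then show ?thesis using assms by (simp add: exp_series_ennreal exp_ereal_def enn2ereal_ennreal)
next
  case top
  then show ?thesis using assms by (simp add: exp_series_top exp_ereal_def)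
qed

text \<open>The error of cutting the path integral at T is controlled by three sources: \<epsilon>
  from continuity, L \<eta> from the mean time integral after T, and c \<Gamma> from paths with a
  large absolute integral.\<close>

lemma truncation_error:
  fixes V :: "real \<Rightarrow> 'w \<Rightarrow> real" and \<phi> :: "real \<Rightarrow> real"
  assumes "prob_space M" and V: "(\<lambda>(s, \<omega>). V s \<omega>) \<in> borel_measurable (borel \<Otimes>\<^sub>M M)"
    and \<phi>: "continuous_on UNIV \<phi>" and growth: "\<And>z. \<bar>\<phi> z\<bar> \<le> C * exp (b * \<bar>z\<bar>)" and b: "0 \<le> b" "b < \<beta>"
    and modulus: "\<And>(z::real) z' s d. \<bar>z\<bar> \<le> s \<Longrightarrow> \<bar>z'\<bar> \<le> s \<Longrightarrow> \<bar>z - z'\<bar> \<le> d \<Longrightarrow> \<bar>\<phi> z - \<phi> z'\<bar> \<le> \<epsilon> + L * d + c * exp (\<beta> * s)"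
    and nonneg: "0 \<le> \<epsilon>" "0 \<le> L" "0 \<le> c" "0 \<le> \<eta>" "0 \<le> \<Gamma>"
    and exp_moment: "(\<integral>\<^sup>+\<omega>. exp_series \<beta> (\<integral>\<^sup>+s. ennreal \<bar>V s \<omega>\<bar> \<partial>lborel) \<partial>M) \<le> ennreal \<Gamma>"
    and tail: "(\<integral>\<^sup>+\<omega>. (\<integral>\<^sup>+s\<in>{T..}. ennreal \<bar>V s \<omega>\<bar> \<partial>lborel) \<partial>M) \<le> ennreal \<eta>"
  shows "integrable M (\<lambda>\<omega>. \<phi> (\<integral>s. V s \<omega> \<partial>lborel))"
    and "\<bar>(\<integral>\<omega>. \<phi> (\<integral>s. V s \<omega> \<partial>lborel) \<partial>M) - (\<integral>\<omega>. \<phi> (\<integral>s. V s \<omega> * indicator {..<T} s \<partial>lborel) \<partial>M)\<bar>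
      \<le> \<epsilon> + L * \<eta> + c * \<Gamma>"
proof -
  interpret prob_space M by fact
  interpret pair_sigma_finite lborel M ..
  have [measurable]: "\<phi> \<in> borel_measurable borel"
    using \<phi> by (rule borel_measurable_continuous_onI)
  have [measurable]: "(\<lambda>w. V (a w) (e w)) \<in> borel_measurable N"
    if "a \<in> borel_measurable N" "e \<in> N \<rightarrow>\<^sub>M M" for a e and N :: "'n measure"
    using measurable_compose[OF measurable_Pair[OF that] V] by simp
  have Vs: "(\<lambda>s. V s \<omega>) \<in> borel_measurable borel" if "\<omega> \<in> space M" for \<omega>
    using measurable_compose[OF measurable_Pair2'[OF that] V] by simp
  define S where "S \<omega> = (\<integral>\<^sup>+s. ennreal \<bar>V s \<omega>\<bar> \<partial>lborel)" for \<omega>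
  define D where "D \<omega> = (\<integral>\<^sup>+s\<in>{T..}. ennreal \<bar>V s \<omega>\<bar> \<partial>lborel)" for \<omega>
  define Z where "Z \<omega> = (\<integral>s. V s \<omega> \<partial>lborel)" for \<omega>
  define Z' where "Z' \<omega> = (\<integral>s. V s \<omega> * indicator {..<T} s \<partial>lborel)" for \<omega>
  have [measurable]: "S \<in> borel_measurable M" "D \<in> borel_measurable M" "Z \<in> borel_measurable M" "Z' \<in> borel_measurable M"
    unfolding S_def[abs_def] D_def[abs_def] Z_def[abs_def] Z'_def[abs_def] by measurable
  have "AE \<omega> in M. exp_series \<beta> (S \<omega>) \<noteq> \<infinity>"
    using exp_moment by (intro nn_integral_PInf_AE) (auto simp: S_def top_unique)
  moreover have "AE \<omega> in M. \<omega> \<in> space M" by simp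
  ultimately have bounds: "AE \<omega> in M. ennreal \<bar>\<phi> (Z \<omega>)\<bar> \<le> ennreal C * exp_series \<beta> (S \<omega>) \<and>
      ennreal \<bar>\<phi> (Z' \<omega>)\<bar> \<le> ennreal C * exp_series \<beta> (S \<omega>) \<and>
      ennreal \<bar>\<phi> (Z \<omega>) - \<phi> (Z' \<omega>)\<bar> \<le> ennreal \<epsilon> + ennreal L * D \<omega> + ennreal c * exp_series \<beta> (S \<omega>)"
  proof eventually_elim
    case (elim \<omega>)
    note [measurable] = Vs[OF elim(2)]
    \<comment> \<open>A finite exponential series forces a finite absolute integral, so the Bochner
      integrals along this path are genuine and not the default value 0.\<close>
    have "S \<omega> \<noteq> \<top>" using elim(1) exp_series_top[of \<beta>] b by auto
    then obtain s where s: "S \<omega> = ennreal s" "0 \<le> s" by (cases "S \<omega>") auto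
    have "D \<omega> \<le> S \<omega>" unfolding D_def S_def by (intro nn_integral_mono) (auto split: split_indicator)
    with s obtain d where d: "D \<omega> = ennreal d" "0 \<le> d" by (cases "D \<omega>") (auto simp: top_unique)
    have int: "integrable lborel (\<lambda>s. V s \<omega>)"
      using s unfolding S_def by (intro integrableI_bounded) auto
    have int_on: "integrable lborel (\<lambda>s. V s \<omega> * indicator A s)" if [measurable]: "A \<in> sets borel" for A
      using integrable_mult_indicator[OF _ int, of A] that by (simp add: mult.commute)
    have abs_le: "\<bar>\<integral>s. V s \<omega> * indicator A s \<partial>lborel\<bar> \<le> r"
      if [measurable]: "A \<in> sets borel" and "(\<integral>\<^sup>+s\<in>A. ennreal \<bar>V s \<omega>\<bar> \<partial>lborel) \<le> ennreal r" "0 \<le> r" for A r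
    proof -
      have "ennreal \<bar>\<integral>s. V s \<omega> * indicator A s \<partial>lborel\<bar> \<le> (\<integral>\<^sup>+s. ennreal (norm (V s \<omega> * indicator A s)) \<partial>lborel)"
        using integral_norm_bound_ennreal[OF int_on[OF that(1)]] by simp
      also have "\<dots> = (\<integral>\<^sup>+s\<in>A. ennreal \<bar>V s \<omega>\<bar> \<partial>lborel)"
        by (intro nn_integral_cong) (auto split: split_indicator)
      finally show ?thesis using that(2,3) by (auto dest: order.trans)
    qed
    have Z: "\<bar>Z \<omega>\<bar> \<le> s" using abs_le[of UNIV s] s unfolding Z_def S_def by simp
    have Z': "\<bar>Z' \<omega>\<bar> \<le> s" unfolding Z'_def
    proof (rule abs_le)
      have "(\<integral>\<^sup>+u\<in>{..<T}. ennreal \<bar>V u \<omega>\<bar> \<partial>lborel) \<le> S \<omega>"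
        unfolding S_def by (intro nn_integral_mono) (auto split: split_indicator)
      then show "(\<integral>\<^sup>+u\<in>{..<T}. ennreal \<bar>V u \<omega>\<bar> \<partial>lborel) \<le> ennreal s" using s by simp
    qed (use s in auto)
    have "Z \<omega> - Z' \<omega> = (\<integral>s. V s \<omega> - V s \<omega> * indicator {..<T} s \<partial>lborel)"
      unfolding Z_def Z'_def using int int_on by (subst Bochner_Integration.integral_diff) auto
    also have "\<dots> = (\<integral>s. V s \<omega> * indicator {T..} s \<partial>lborel)"
      by (intro Bochner_Integration.integral_cong) (auto split: split_indicator)
    finally have ZZ': "\<bar>Z \<omega> - Z' \<omega>\<bar> \<le> d"
      using abs_le[of "{T..}" d] d unfolding D_def by simp
    have E: "exp_series \<beta> (S \<omega>) = ennreal (exp (\<beta> * s))" using s b by (simp add: exp_series_ennreal)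
    have C: "0 \<le> C" using growth[of 0] by simp
    have growth': "\<bar>\<phi> z\<bar> \<le> C * exp (\<beta> * s)" if "\<bar>z\<bar> \<le> s" for z
    proof -
      have "b * \<bar>z\<bar> \<le> \<beta> * s" using that b s by (intro mult_mono) auto
      then show ?thesis using C by (intro order.trans[OF growth] mult_left_mono) auto
    qed
    have "ennreal \<bar>\<phi> (Z \<omega>)\<bar> \<le> ennreal C * exp_series \<beta> (S \<omega>)" "ennreal \<bar>\<phi> (Z' \<omega>)\<bar> \<le> ennreal C * exp_series \<beta> (S \<omega>)"
      unfolding E using growth'[OF Z] growth'[OF Z'] C by (auto simp: ennreal_mult[symmetric] intro!: ennreal_leI)
    moreover have "ennreal \<bar>\<phi> (Z \<omega>) - \<phi> (Z' \<omega>)\<bar> \<le> ennreal \<epsilon> + ennreal L * D \<omega> + ennreal c * exp_series \<beta> (S \<omega>)"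
      unfolding E d using modulus[OF Z Z' ZZ'] nonneg d(2)
      by (simp add: ennreal_mult[symmetric] ennreal_plus[symmetric] ennreal_leI del: ennreal_plus)
    ultimately show ?case by simp
  qed
  have CE: "(\<integral>\<^sup>+\<omega>. ennreal C * exp_series \<beta> (S \<omega>) \<partial>M) < \<infinity>"
  proof -
    have "(\<integral>\<^sup>+\<omega>. ennreal C * exp_series \<beta> (S \<omega>) \<partial>M) = ennreal C * (\<integral>\<^sup>+\<omega>. exp_series \<beta> (S \<omega>) \<partial>M)"
      by (rule nn_integral_cmult) measurable
    also have "\<dots> \<le> ennreal C * ennreal \<Gamma>" using exp_moment by (intro mult_left_mono) (auto simp: S_def)
    also have "\<dots> < \<infinity>" by (simp add: ennreal_mult_less_top)
    finally show ?thesis .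
  qed
  have int_Z: "integrable M (\<lambda>\<omega>. \<phi> (Z \<omega>))"
  proof (rule integrableI_bounded)
    have "(\<integral>\<^sup>+\<omega>. ennreal (norm (\<phi> (Z \<omega>))) \<partial>M) \<le> (\<integral>\<^sup>+\<omega>. ennreal C * exp_series \<beta> (S \<omega>) \<partial>M)"
      by (rule nn_integral_mono_AE) (use bounds in eventually_elim, simp)
    from this CE show "(\<integral>\<^sup>+\<omega>. ennreal (norm (\<phi> (Z \<omega>))) \<partial>M) < \<infinity>" by (rule le_less_trans)
  qed measurable
  have int_Z': "integrable M (\<lambda>\<omega>. \<phi> (Z' \<omega>))"
  proof (rule integrableI_bounded)
    have "(\<integral>\<^sup>+\<omega>. ennreal (norm (\<phi> (Z' \<omega>))) \<partial>M) \<le> (\<integral>\<^sup>+\<omega>. ennreal C * exp_series \<beta> (S \<omega>) \<partial>M)"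
      by (rule nn_integral_mono_AE) (use bounds in eventually_elim, simp)
    from this CE show "(\<integral>\<^sup>+\<omega>. ennreal (norm (\<phi> (Z' \<omega>))) \<partial>M) < \<infinity>" by (rule le_less_trans)
  qed measurable
  show "integrable M (\<lambda>\<omega>. \<phi> (\<integral>s. V s \<omega> \<partial>lborel))"
    using int_Z unfolding Z_def .
  have "ennreal \<bar>(\<integral>\<omega>. \<phi> (Z \<omega>) \<partial>M) - (\<integral>\<omega>. \<phi> (Z' \<omega>) \<partial>M)\<bar> = ennreal \<bar>\<integral>\<omega>. \<phi> (Z \<omega>) - \<phi> (Z' \<omega>) \<partial>M\<bar>"
    using int_Z int_Z' by (subst Bochner_Integration.integral_diff) auto
  also have "\<dots> \<le> (\<integral>\<^sup>+\<omega>. ennreal \<bar>\<phi> (Z \<omega>) - \<phi> (Z' \<omega>)\<bar> \<partial>M)"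
    using integral_norm_bound_ennreal[of M "\<lambda>\<omega>. \<phi> (Z \<omega>) - \<phi> (Z' \<omega>)"] int_Z int_Z' by simp
  also have "\<dots> \<le> (\<integral>\<^sup>+\<omega>. ennreal \<epsilon> + ennreal L * D \<omega> + ennreal c * exp_series \<beta> (S \<omega>) \<partial>M)"
    by (rule nn_integral_mono_AE) (use bounds in eventually_elim, simp)
  also have "\<dots> = ennreal \<epsilon> + ennreal L * (\<integral>\<^sup>+\<omega>. D \<omega> \<partial>M) + ennreal c * (\<integral>\<^sup>+\<omega>. exp_series \<beta> (S \<omega>) \<partial>M)"
    by (simp add: nn_integral_add nn_integral_cmult emeasure_space_1)
  also have "\<dots> \<le> ennreal \<epsilon> + ennreal L * ennreal \<eta> + ennreal c * ennreal \<Gamma>"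
    using exp_moment tail by (intro add_mono mult_left_mono) (auto simp: S_def D_def)
  also have "\<dots> = ennreal (\<epsilon> + L * \<eta> + c * \<Gamma>)"
    using nonneg by (simp add: ennreal_mult)
  finally show "\<bar>(\<integral>\<omega>. \<phi> (\<integral>s. V s \<omega> \<partial>lborel) \<partial>M) - (\<integral>\<omega>. \<phi> (\<integral>s. V s \<omega> * indicator {..<T} s \<partial>lborel) \<partial>M)\<bar>
      \<le> \<epsilon> + L * \<eta> + c * \<Gamma>"
    unfolding Z_def[symmetric] Z'_def[symmetric] using nonneg by (subst (asm) ennreal_le_iff) auto
qed

section \<open>Convergence of bridge expectations\<close>

text \<open>Monotone convergence exchanges expectation and series, and the k! of the k-th moment
  cancels. Finite exponential moments thus become convergence of a power series in the
  potentials.\<close>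

lemma nn_exp_moment_eq:
  assumes BM: "brownian_motion M a W" and f [measurable]: "f \<in> borel_measurable borel" and "0 < \<beta>"
  shows "nn_exp_moment M \<beta> f W = (\<Sum>k. ennreal (\<beta> ^ k) * pot_iter (\<lambda>u. ennreal (f u)) k a)"
    and "(\<integral>\<^sup>+\<omega>. exp_series \<beta> (nn_path_integral (\<lambda>u. ennreal (f u)) {0..} W \<omega>) \<partial>M)
      = (\<Sum>k. ennreal (\<beta> ^ k) * pot_iter (\<lambda>u. ennreal (f u)) k a)"
proof -
  note brownian_motion_measurable[OF BM, measurable]
  have [measurable]: "(\<lambda>\<omega>. \<integral>\<^sup>+s\<in>{0..}. ennreal (f (W s \<omega>)) \<partial>lborel) \<in> borel_measurable M"
    unfolding nn_integral_drop_endpoints by measurable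
  have "(\<integral>\<^sup>+\<omega>. exp_series \<beta> (nn_path_integral (\<lambda>u. ennreal (f u)) {0..} W \<omega>) \<partial>M)
    = (\<Sum>k. \<integral>\<^sup>+\<omega>. ennreal (\<beta> ^ k / fact k) * (nn_path_integral (\<lambda>u. ennreal (f u)) {0..} W \<omega>) ^ k \<partial>M)"
    unfolding exp_series_def by (rule nn_integral_suminf) measurable
  also have "\<dots> = (\<Sum>k. ennreal (\<beta> ^ k) * pot_iter (\<lambda>u. ennreal (f u)) k a)"
  proof (intro suminf_cong)
    fix k
    have "(\<integral>\<^sup>+\<omega>. ennreal (\<beta> ^ k / fact k) * (nn_path_integral (\<lambda>u. ennreal (f u)) {0..} W \<omega>) ^ k \<partial>M)
      = ennreal (\<beta> ^ k / fact k) * (of_nat (fact k) * pot_iter (\<lambda>u. ennreal (f u)) k a)"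
      by (subst nn_integral_cmult, measurable, subst brownian_motion_moment[OF BM]) auto
    also have "ennreal (\<beta> ^ k / fact k) * (of_nat (fact k) * pot_iter (\<lambda>u. ennreal (f u)) k a)
      = ennreal (\<beta> ^ k / fact k * fact k) * pot_iter (\<lambda>u. ennreal (f u)) k a"
      using \<open>0 < \<beta>\<close> unfolding mult.assoc[symmetric]
      by (subst ennreal_mult) (auto simp: ennreal_of_nat_eq_real_of_nat)
    finally show "(\<integral>\<^sup>+\<omega>. ennreal (\<beta> ^ k / fact k) * (nn_path_integral (\<lambda>u. ennreal (f u)) {0..} W \<omega>) ^ k \<partial>M)
      = ennreal (\<beta> ^ k) * pot_iter (\<lambda>u. ennreal (f u)) k a" by simp
  qed
  finally show *: "(\<integral>\<^sup>+\<omega>. exp_series \<beta> (nn_path_integral (\<lambda>u. ennreal (f u)) {0..} W \<omega>) \<partial>M)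
      = (\<Sum>k. ennreal (\<beta> ^ k) * pot_iter (\<lambda>u. ennreal (f u)) k a)" .
  show "nn_exp_moment M \<beta> f W = (\<Sum>k. ennreal (\<beta> ^ k) * pot_iter (\<lambda>u. ennreal (f u)) k a)"
    unfolding nn_exp_moment_def exp_ereal_eq_exp_series[OF \<open>0 < \<beta>\<close>] by (rule *)
qed

text \<open>At time s the position has density at most \<open>heat_max\<close>, whose integral over
  \<open>{T..}\<close> is finite.\<close>

lemma brownian_motion_tail_le:
  fixes f :: "'a::euclidean_space \<Rightarrow> ennreal"
  assumes BM: "brownian_motion M a W" and f [measurable]: "f \<in> borel_measurable borel"
    and T: "0 < T" and d: "3 \<le> DIM('a)"
    and f_le: "\<And>z. f z \<le> ennreal K * indicator (cball 0 R) z"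
  shows "(\<integral>\<^sup>+\<omega>. (\<integral>\<^sup>+s\<in>{T..}. indicator {0<..} s * f (W (max 0 s) \<omega>) \<partial>lborel) \<partial>M)
    \<le> ennreal K * emeasure lborel (cball 0 R :: 'a set) * ennreal (heat_tail TYPE('a) T)"
proof -
  let ?B = "cball 0 R :: 'a set"
  have [measurable]: "?B \<in> sets borel" by simp
  interpret prob_space M using BM by (simp add: brownian_motion_def)
  interpret occupation M "\<lambda>s \<omega>. indicator {0<..} s * f (W (max 0 s) \<omega>)" "{0<..}" f "\<lambda>_ _. 1" a
    by (rule brownian_motion_occupation[OF BM f])
  interpret pair_sigma_finite lborel M ..
  note g[measurable]
  have "(\<integral>\<^sup>+\<omega>. (\<integral>\<^sup>+s\<in>{T..}. indicator {0<..} s * f (W (max 0 s) \<omega>) \<partial>lborel) \<partial>M)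
     = (\<integral>\<^sup>+s. \<integral>\<^sup>+\<omega>. indicator {0<..} s * f (W (max 0 s) \<omega>) * indicator {T..} s \<partial>M \<partial>lborel)"
    using g by (intro Fubini') (auto intro!: borel_measurable_times_ennreal simp: case_prod_beta)
  also have "\<dots> = (\<integral>\<^sup>+s. (\<integral>\<^sup>+\<omega>. indicator {0<..} s * f (W (max 0 s) \<omega>) \<partial>M) * indicator {T..} s \<partial>lborel)"
    by (intro nn_integral_cong nn_integral_multc) measurable
  also have "\<dots> \<le> (\<integral>\<^sup>+s. ennreal K * emeasure lborel ?B * (heat_max TYPE('a) s * indicator {T..} s) \<partial>lborel)"
  proof (intro nn_integral_mono)
    fix s
    show "(\<integral>\<^sup>+\<omega>. indicator {0<..} s * f (W (max 0 s) \<omega>) \<partial>M) * indicator {T..} s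
      \<le> ennreal K * emeasure lborel ?B * (heat_max TYPE('a) s * indicator {T..} s)"
    proof (cases "T \<le> s")
      case True
      then have s: "0 < s" using T by simp
      have "(\<integral>\<^sup>+\<omega>. indicator {0<..} s * f (W (max 0 s) \<omega>) \<partial>M) = (\<integral>\<^sup>+z. heat s a z * f z \<partial>lborel)"
        using fdd[of "[s]"] s by simp
      also have "\<dots> \<le> (\<integral>\<^sup>+z. ennreal K * (heat s a z * indicator ?B z) \<partial>lborel)"
        using mult_left_mono[OF f_le, of "heat s a _"] by (intro nn_integral_mono) (simp add: ac_simps)
      also have "\<dots> = ennreal K * (\<integral>\<^sup>+z. heat s a z * indicator ?B z \<partial>lborel)"
        by (rule nn_integral_cmult) measurable
      also have "\<dots> \<le> ennreal K * (heat_max TYPE('a) s * emeasure lborel ?B)"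
        using s by (intro mult_left_mono nn_integral_heat_indicator_le) auto
      finally show ?thesis using True by (simp add: ac_simps)
    qed simp
  qed
  also have "\<dots> = ennreal K * emeasure lborel ?B * (\<integral>\<^sup>+s\<in>{T..}. heat_max TYPE('a) s \<partial>lborel)"
    by (rule nn_integral_cmult) measurable
  finally show ?thesis unfolding nn_integral_heat_max_tail[OF T d] .
qed

text \<open>Lowering the rate from \<beta> to b turns the moment bounds into a polynomial times (b /
  \<beta>)^k, which is summable. The constant depends on the duration and the endpoints only through
  E.\<close>

lemma brownian_bridge_exp_moment_le:
  fixes f :: "'a::euclidean_space \<Rightarrow> ennreal"
  assumes f: "f \<in> borel_measurable borel" and b: "0 < b" "b < \<beta>" and C: "0 \<le> C" and E: "0 \<le> E"
    and pot_le: "\<And>k x. ennreal (\<beta> ^ k) * pot_iter f k x \<le> ennreal C"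
  obtains \<Gamma> where "0 \<le> \<Gamma>" "\<And>(M :: 'w measure) t a y X. 0 < t \<Longrightarrow> brownian_bridge M t a y X \<Longrightarrow>
      exp ((norm (y - a))\<^sup>2 / (2 * t)) \<le> E \<Longrightarrow>
      (\<integral>\<^sup>+\<omega>. exp_series b (nn_path_integral f {0..t} X \<omega>) \<partial>M) \<le> ennreal \<Gamma>"
proof -
  note [measurable] = f
  let ?N = "DIM('a) + 1"
  define r where "r = b / \<beta>"
  have r: "0 < r" "r < 1" using b by (auto simp: r_def)
  have "summable (\<lambda>k. real (Suc k) ^ ?N * r ^ Suc k)"
    using summable_power_times_geometric[of r ?N] r by (subst summable_Suc_iff) auto
  \<comment> \<open>The factor 1 / r undoes the index shift in r^(k + 1).\<close>
  then have *: "summable (\<lambda>k. (E * C\<^sup>2 / r) * (real (Suc k) ^ ?N * r ^ Suc k))"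
    by (rule summable_mult)
  have sum: "summable (\<lambda>k. E * (real (Suc k) ^ ?N * (C\<^sup>2 * r ^ k)))"
  proof -
    have "(E * C\<^sup>2 / r) * (real (Suc k) ^ ?N * r ^ Suc k) = E * (real (Suc k) ^ ?N * (C\<^sup>2 * r ^ k))" for k
      using r by simp
    with * show ?thesis by (simp only:)
  qed
  show thesis
  proof
    show "0 \<le> (\<Sum>k. E * (real (Suc k) ^ ?N * (C\<^sup>2 * r ^ k)))"
      using sum E r by (intro suminf_nonneg) auto
    fix M :: "'w measure" and t :: real and a y :: 'a and X :: "real \<Rightarrow> 'w \<Rightarrow> 'a"
    assume t: "0 < t" and BB: "brownian_bridge M t a y X" and e: "exp ((norm (y - a))\<^sup>2 / (2 * t)) \<le> E"
    note brownian_bridge_measurable[OF BB t, measurable]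
    have [measurable]: "(\<lambda>\<omega>. \<integral>\<^sup>+s\<in>{0..t}. f (X s \<omega>) \<partial>lborel) \<in> borel_measurable M"
      unfolding nn_integral_drop_endpoints by measurable
    have "(\<integral>\<^sup>+\<omega>. exp_series b (nn_path_integral f {0..t} X \<omega>) \<partial>M)
      = (\<Sum>k. \<integral>\<^sup>+\<omega>. ennreal (b ^ k / fact k) * (nn_path_integral f {0..t} X \<omega>) ^ k \<partial>M)"
      unfolding exp_series_def by (rule nn_integral_suminf) measurable
    also have "\<dots> \<le> (\<Sum>k. ennreal (E * (real (Suc k) ^ ?N * (C\<^sup>2 * r ^ k))))"
    proof (intro suminf_le)
      fix k
      have "(\<integral>\<^sup>+\<omega>. ennreal (b ^ k / fact k) * (nn_path_integral f {0..t} X \<omega>) ^ k \<partial>M)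
        = ennreal (b ^ k / fact k) * (\<integral>\<^sup>+\<omega>. (nn_path_integral f {0..t} X \<omega>) ^ k \<partial>M)"
        by (rule nn_integral_cmult) measurable
      also have "\<dots> \<le> ennreal (b ^ k / fact k) * ennreal (fact k * (exp ((norm (y - a))\<^sup>2 / (2 * t)) * (real (Suc k) ^ ?N * (C\<^sup>2 * (1 / \<beta>) ^ k))))"
        using b C by (intro mult_left_mono brownian_bridge_moment_le[OF BB f t _ _ pot_le]) auto
      also have "\<dots> = ennreal (exp ((norm (y - a))\<^sup>2 / (2 * t)) * (real (Suc k) ^ ?N * (C\<^sup>2 * r ^ k)))"
      proof -
        have "r ^ k = b ^ k * (1 / \<beta>) ^ k"
          by (simp add: r_def power_mult_distrib[symmetric])
        moreover have "b ^ k / fact k * (fact k * Y) = b ^ k * Y" for Y by simp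
        ultimately show ?thesis
          using b by (subst ennreal_mult[symmetric]) (auto simp: mult.left_commute)
      qed
      also have "\<dots> \<le> ennreal (E * (real (Suc k) ^ ?N * (C\<^sup>2 * r ^ k)))"
        using e r by (intro ennreal_leI mult_right_mono) auto
      finally show "(\<integral>\<^sup>+\<omega>. ennreal (b ^ k / fact k) * (nn_path_integral f {0..t} X \<omega>) ^ k \<partial>M)
        \<le> ennreal (E * (real (Suc k) ^ ?N * (C\<^sup>2 * r ^ k)))" .
    qed auto
    also have "\<dots> = ennreal (\<Sum>k. E * (real (Suc k) ^ ?N * (C\<^sup>2 * r ^ k)))"
      using sum E r by (intro suminf_ennreal2) auto
    finally show "(\<integral>\<^sup>+\<omega>. exp_series b (nn_path_integral f {0..t} X \<omega>) \<partial>M)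
      \<le> ennreal (\<Sum>k. E * (real (Suc k) ^ ?N * (C\<^sup>2 * r ^ k)))" .
  qed
qed

text \<open>The moment formulas concern nonnegative integrands. Adding K to a signed integrand makes
  it nonnegative, and on a horizon of length T changes the integral by exactly K T.\<close>

lemma nn_integral_shifted_truncation:
  fixes u :: "real \<Rightarrow> real"
  assumes [measurable]: "u \<in> borel_measurable borel" and u: "\<And>s. \<bar>u s\<bar> \<le> K" and T: "0 \<le> T"
    and g: "\<And>s. s \<in> {0<..<T} \<Longrightarrow> g s = ennreal (u s + K)" "\<And>s. s \<le> 0 \<Longrightarrow> g s = 0" "\<And>s. s \<le> 0 \<Longrightarrow> u s = 0"
  shows "(\<integral>\<^sup>+s\<in>{..<T}. g s \<partial>lborel) = ennreal ((\<integral>s. u s * indicator {..<T} s \<partial>lborel) + K * T)"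
    and "0 \<le> (\<integral>s. u s * indicator {..<T} s \<partial>lborel) + K * T"
proof -
  have K: "0 \<le> K" using u[of 0] by simp
  have int: "integrable lborel (\<lambda>s. u s * indicator {..<T} s)"
  proof (rule Bochner_Integration.integrable_bound)
    show "integrable lborel (\<lambda>s. K * indicator {0..T} s :: real)"
      using T by (intro integrable_mult_right integrable_real_indicator) auto
    show "AE s in lborel. norm (u s * indicator {..<T} s) \<le> norm (K * indicator {0..T} s :: real)"
    proof (rule AE_I2)
      fix s
      show "norm (u s * indicator {..<T} s) \<le> norm (K * indicator {0..T} s :: real)"
        using u[of s] g(3)[of s] K by (cases "s \<le> 0") (auto split: split_indicator)
    qed
  qed measurable
  let ?w = "\<lambda>s. u s * indicator {..<T} s + K * indicator {0<..<T} s"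
  have w: "0 \<le> ?w s" for s
    using u[of s] g(3)[of s] by (cases "s \<le> 0") (auto split: split_indicator simp: abs_le_iff)
  have intK: "integrable lborel (\<lambda>s. K * indicator {0<..<T} s :: real)"
    using T by (intro integrable_mult_right integrable_real_indicator) auto
  have w_int: "(\<integral>s. ?w s \<partial>lborel) = (\<integral>s. u s * indicator {..<T} s \<partial>lborel) + K * T"
    using T int intK by (subst Bochner_Integration.integral_add) auto
  have "(\<integral>\<^sup>+s\<in>{..<T}. g s \<partial>lborel) = (\<integral>\<^sup>+s. ennreal (?w s) \<partial>lborel)"
  proof (intro nn_integral_cong)
    fix s show "g s * indicator {..<T} s = ennreal (?w s)"
      using g(1)[of s] g(2)[of s] g(3)[of s] by (cases "s \<le> 0") (auto split: split_indicator)
  qed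
  also have "\<dots> = ennreal (\<integral>s. ?w s \<partial>lborel)"
    using int intK w by (intro nn_integral_eq_integral Bochner_Integration.integrable_add) auto
  finally show "(\<integral>\<^sup>+s\<in>{..<T}. g s \<partial>lborel) = ennreal ((\<integral>s. u s * indicator {..<T} s \<partial>lborel) + K * T)"
    unfolding w_int .
  show "0 \<le> (\<integral>s. u s * indicator {..<T} s \<partial>lborel) + K * T"
    unfolding w_int[symmetric] using w by (intro Bochner_Integration.integral_nonneg) auto
qed

lemma path_integral_eq:
  assumes [measurable]: "(\<lambda>s. indicator {0<..<t} s * v (X (max 0 (min t s)) \<omega>)) \<in> borel_measurable borel"
  shows "path_integral v {0..t} X \<omega> = (\<integral>s. indicator {0<..<t} s * v (X (max 0 (min t s)) \<omega>) \<partial>lborel)"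
proof -
  let ?u = "\<lambda>s. indicator {0<..<t} s * v (X (max 0 (min t s)) \<omega>)"
  \<comment> \<open>Off 0 and t the two integrands agree, and \<open>c\<close> records the original
    values at these two points; its indicator covers t < 0 as well. The modified integrand is
    measurable as a change of the clamped one at two points.\<close>
  define c where "c s = indicator {0..t} s * v (X s \<omega>)" for s
  have "path_integral v {0..t} X \<omega> = (\<integral>s. (if s = 0 then c 0 else if s = t then c t else ?u s) \<partial>lborel)"
    unfolding path_integral_def set_lebesgue_integral_def real_scaleR_def
    by (intro Bochner_Integration.integral_cong) (auto simp: c_def split: split_indicator)
  also have "\<dots> = (\<integral>s. ?u s \<partial>lborel)"
  proof (rule integral_cong_AE)
    show "AE s in lborel. (if s = 0 then c 0 else if s = t then c t else ?u s) = ?u s"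
      using AE_lborel_singleton[of 0] AE_lborel_singleton[of t] by eventually_elim simp
  qed measurable
  finally show ?thesis .
qed

lemma path_integral_infinite_eq:
  assumes [measurable]: "(\<lambda>s. indicator {0<..} s * v (W (max 0 s) \<omega>)) \<in> borel_measurable borel"
  shows "path_integral v {0..} W \<omega> = (\<integral>s. indicator {0<..} s * v (W (max 0 s) \<omega>) \<partial>lborel)"
proof -
  let ?u = "\<lambda>s. indicator {0<..} s * v (W (max 0 s) \<omega>)"
  have "path_integral v {0..} W \<omega> = (\<integral>s. (if s = 0 then v (W 0 \<omega>) else ?u s) \<partial>lborel)"
    unfolding path_integral_def set_lebesgue_integral_def real_scaleR_def
    by (intro Bochner_Integration.integral_cong) (auto split: split_indicator)
  also have "\<dots> = (\<integral>s. ?u s \<partial>lborel)"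
  proof (rule integral_cong_AE)
    show "AE s in lborel. (if s = 0 then v (W 0 \<omega>) else ?u s) = ?u s"
      using AE_lborel_singleton[of 0] by eventually_elim simp
  qed measurable
  finally show ?thesis .
qed

text \<open>On a fixed horizon the shifted path integrals take values in a bounded interval, where
  convergence of moments is enough; the shift K T is then undone inside \<phi>.\<close>

lemma bridge_truncated_tendsto:
  fixes v :: "'a::euclidean_space \<Rightarrow> real" and \<phi> :: "real \<Rightarrow> real"
  assumes v [measurable]: "v \<in> borel_measurable borel" and K: "\<And>u. \<bar>v u\<bar> \<le> K"
    and esc: "escaping_endpoints t x y x\<^sub>0 C\<^sub>y"
    and BB: "\<And>n. brownian_bridge (Q n) (t n) (x n) (y n) (X n)"
    and BM: "brownian_motion P x\<^sub>0 W"
    and \<phi>: "continuous_on UNIV \<phi>" and T: "0 < T"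
  shows "(\<lambda>n. \<integral>\<omega>. \<phi> (\<integral>s. indicator {0<..<t n} s * v (X n (max 0 (min (t n) s)) \<omega>) * indicator {..<T} s \<partial>lborel) \<partial>Q n)
    \<longlonglongrightarrow> (\<integral>\<omega>. \<phi> (\<integral>s. indicator {0<..} s * v (W (max 0 s) \<omega>) * indicator {..<T} s \<partial>lborel) \<partial>P)"
proof -
  interpret escaping_endpoints t x y x\<^sub>0 C\<^sub>y by fact
  have t_pos: "0 < t n" for n using t(1)[of n] by simp
  have K0: "0 \<le> K" using K[of 0] by (rule order.trans[OF abs_ge_zero])
  define f where "f u = ennreal (v u + K)" for u
  have f [measurable]: "f \<in> borel_measurable borel" unfolding f_def[abs_def] by measurable
  have f_le: "f u \<le> ennreal (2 * K)" for u
    using K[of u] unfolding f_def by (intro ennreal_leI) auto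
  define g where "g n s \<omega> = indicator {0<..<t n} s * f (X n (max 0 (min (t n) s)) \<omega>)" for n s \<omega>
  define g' where "g' s \<omega> = indicator {0<..} s * f (W (max 0 s) \<omega>)" for s \<omega>
  have occ: "occupation (Q n) (g n) {0<..<t n} f (bridge_weight (t n) (x n) (y n)) (x n)" for n
    unfolding g_def[abs_def] by (rule brownian_bridge_occupation[OF BB f t_pos])
  have occ': "occupation P g' {0<..} f (\<lambda>_ _. 1) x\<^sub>0"
    unfolding g'_def[abs_def] by (rule brownian_motion_occupation[OF BM f])
  have Q: "prob_space (Q n)" for n using BB[of n] by (simp add: brownian_bridge_def)
  have P: "prob_space P" using BM by (simp add: brownian_motion_def)
  have g_le: "g n s \<omega> \<le> ennreal (2 * K)" "g' s \<omega>' \<le> ennreal (2 * K)" for n s \<omega> \<omega>'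
    using f_le by (auto simp: g_def g'_def split: split_indicator)
  have g_neg: "g n s \<omega> = 0" "g' s \<omega>' = 0" if "s \<le> 0" for n s \<omega> \<omega>'
    using that by (auto simp: g_def g'_def)
  define G where "G n \<omega> = (occ_time (g n) {..<T} \<omega>)" for n \<omega>
  define G' where "G' \<omega> = (occ_time g' {..<T} \<omega>)" for \<omega>
  have nn_moments: "(\<lambda>n. \<integral>\<^sup>+\<omega>. G n \<omega> ^ k \<partial>Q n) \<longlonglongrightarrow> (\<integral>\<^sup>+\<omega>. G' \<omega> ^ k \<partial>P)" for k
  proof -
    have "(\<lambda>n. \<integral>\<^sup>+\<omega>. (occ_time (g n) {..<T} \<omega>) ^ k * (\<Prod>q\<leftarrow>[]. g n q \<omega>) \<partial>Q n)
      \<longlonglongrightarrow> (\<integral>\<^sup>+\<omega>. (occ_time g' {..<T} \<omega>) ^ k * (\<Prod>q\<leftarrow>[]. g' q \<omega>) \<partial>P)"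
    proof (rule truncated_moment_tendsto[OF occ Q occ' P _ _ g_le])
      show "\<forall>\<^sub>F n in sequentially. {0<..<T} \<subseteq> {0<..<t n}" for T
        using t(2)[unfolded filterlim_at_top, rule_format, of T] by eventually_elim auto
      show "(\<lambda>n. chain f (bridge_weight (t n) (x n) (y n)) 0 (x n) rs) \<longlonglongrightarrow> chain f (\<lambda>_ _. 1) 0 x\<^sub>0 rs"
        if "sorted_wrt (<) (0 # rs)" for rs
        using K0 that by (intro chain_tendsto[OF f f_le] x) auto
    qed auto
    then show ?thesis unfolding G_def G'_def by simp
  qed
  have G_le: "(\<integral>\<^sup>+s\<in>{..<T}. g0 s \<partial>lborel) \<le> ennreal (2 * K * T)"
    if "\<And>s. g0 s \<le> ennreal (2 * K)" "\<And>s. s \<le> 0 \<Longrightarrow> g0 s = 0" for g0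
  proof -
    have "(\<integral>\<^sup>+s\<in>{..<T}. g0 s \<partial>lborel) \<le> (\<integral>\<^sup>+s. ennreal (2 * K) * indicator {0..T} s \<partial>lborel)"
    proof (rule nn_integral_mono)
      fix s
      show "g0 s * indicator {..<T} s \<le> ennreal (2 * K) * indicator {0..T} s"
        using that[of s] by (cases "s \<le> 0") (auto split: split_indicator)
    qed
    also have "\<dots> = ennreal (2 * K * T)"
      using T K0 by (simp add: nn_integral_cmult ennreal_mult)
    finally show ?thesis .
  qed
  have G_bound: "G n \<omega> \<le> ennreal (2 * K * T)" "G' \<omega>' \<le> ennreal (2 * K * T)" for n \<omega> \<omega>'
    unfolding G_def G'_def by (auto intro!: G_le g_le g_neg)
  have [measurable]: "G n \<in> borel_measurable (Q n)" "G' \<in> borel_measurable P" for n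
  proof -
    have "(\<lambda>\<omega>. \<integral>\<^sup>+s\<in>A. g0 s \<omega> \<partial>lborel) \<in> borel_measurable M0"
      if o: "occupation M0 g0 J0 f h0 a0" and [measurable]: "A \<in> sets borel" for M0 :: "'m measure" and g0 J0 h0 a0 A
    proof -
      interpret occupation M0 g0 J0 f h0 a0 by fact
      note g[measurable]
      have [measurable]: "(\<lambda>w. g0 (a w) (b w)) \<in> borel_measurable N"
        if "a \<in> borel_measurable N" "b \<in> N \<rightarrow>\<^sub>M M0" for a b and N :: "'n measure"
        using measurable_compose[OF measurable_Pair[OF that] g] by simp
      show ?thesis by measurable
    qed
    from this[OF occ] this[OF occ'] show "G n \<in> borel_measurable (Q n)" "G' \<in> borel_measurable P"
      unfolding G_def[abs_def] G'_def[abs_def] by auto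
  qed
  \<comment> \<open>The bound 2 K T keeps \<open>enn2real\<close> exact, so that real and extended
    moments agree.\<close>
  have real_moment: "(\<integral>\<omega>. enn2real (G0 \<omega>) ^ k \<partial>M0) = enn2real (\<integral>\<^sup>+\<omega>. G0 \<omega> ^ k \<partial>M0)"
    and moment_finite: "(\<integral>\<^sup>+\<omega>. G0 \<omega> ^ k \<partial>M0) < \<top>"
    if "prob_space M0" and [measurable]: "G0 \<in> borel_measurable M0" and G0: "\<And>\<omega>. G0 \<omega> \<le> ennreal (2 * K * T)"
    for M0 :: "'m measure" and G0 k
  proof -
    interpret prob_space M0 by fact
    have "ennreal (enn2real (G0 \<omega>) ^ k) = G0 \<omega> ^ k" for \<omega>
      using G0[of \<omega>] by (subst ennreal_power[symmetric]) (auto simp: ennreal_enn2real_if top_unique)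
    then show "(\<integral>\<omega>. enn2real (G0 \<omega>) ^ k \<partial>M0) = enn2real (\<integral>\<^sup>+\<omega>. G0 \<omega> ^ k \<partial>M0)"
      by (subst integral_eq_nn_integral) auto
    have "(\<integral>\<^sup>+\<omega>. G0 \<omega> ^ k \<partial>M0) \<le> (\<integral>\<^sup>+\<omega>. ennreal (2 * K * T) ^ k \<partial>M0)"
      by (intro nn_integral_mono power_mono G0) auto
    also have "\<dots> < \<top>" by (simp add: emeasure_space_1 power_less_top_ennreal)
    finally show "(\<integral>\<^sup>+\<omega>. G0 \<omega> ^ k \<partial>M0) < \<top>" .
  qed
  have main: "(\<lambda>n. \<integral>\<omega>. \<phi> (enn2real (G n \<omega>) - K * T) \<partial>Q n) \<longlonglongrightarrow> (\<integral>\<omega>. \<phi> (enn2real (G' \<omega>) - K * T) \<partial>P)"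
  proof (rule expectation_tendsto_of_moments[OF Q P, where B = "2 * K * T" and \<phi> = "\<lambda>z. \<phi> (z - K * T)"])
    show "enn2real (G n \<omega>) \<in> {0..2 * K * T}" "enn2real (G' \<omega>') \<in> {0..2 * K * T}" for n \<omega> \<omega>'
      using enn2real_mono[OF G_bound(1), of n \<omega>] enn2real_mono[OF G_bound(2), of \<omega>'] K0 T by auto
    show "(\<lambda>n. \<integral>\<omega>. enn2real (G n \<omega>) ^ k \<partial>Q n) \<longlonglongrightarrow> (\<integral>\<omega>. enn2real (G' \<omega>) ^ k \<partial>P)" for k
    proof -
      have "(\<integral>\<^sup>+\<omega>. G' \<omega> ^ k \<partial>P) < \<top>"
        by (rule moment_finite[OF P _ G_bound(2)]) measurable
      then have "(\<integral>\<^sup>+\<omega>. G' \<omega> ^ k \<partial>P) = ennreal (enn2real (\<integral>\<^sup>+\<omega>. G' \<omega> ^ k \<partial>P))"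
        by simp
      with nn_moments[of k] have lim: "(\<lambda>n. enn2real (\<integral>\<^sup>+\<omega>. G n \<omega> ^ k \<partial>Q n)) \<longlonglongrightarrow> enn2real (\<integral>\<^sup>+\<omega>. G' \<omega> ^ k \<partial>P)"
        by (intro tendsto_enn2real) auto
      have eq: "(\<integral>\<omega>. enn2real (G n \<omega>) ^ k \<partial>Q n) = enn2real (\<integral>\<^sup>+\<omega>. G n \<omega> ^ k \<partial>Q n)" for n
        by (rule real_moment[OF Q _ G_bound(1)]) measurable
      have "(\<integral>\<omega>. enn2real (G' \<omega>) ^ k \<partial>P) = enn2real (\<integral>\<^sup>+\<omega>. G' \<omega> ^ k \<partial>P)"
        by (rule real_moment[OF P _ G_bound(2)]) measurable
      with lim eq show ?thesis by simp
    qed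
    show "continuous_on UNIV (\<lambda>z. \<phi> (z - K * T))"
      using \<phi> by (intro continuous_on_compose2[OF \<phi>] continuous_intros) auto
  qed measurable
  have eq': "(\<integral>\<omega>. \<phi> (\<integral>s. indicator {0<..} s * v (W (max 0 s) \<omega>) * indicator {..<T} s \<partial>lborel) \<partial>P)
    = (\<integral>\<omega>. \<phi> (enn2real (G' \<omega>) - K * T) \<partial>P)"
  proof (intro Bochner_Integration.integral_cong refl arg_cong[where f = \<phi>])
    fix \<omega> assume \<omega>: "\<omega> \<in> space P"
    note brownian_motion_measurable[OF BM, measurable]
    have [measurable]: "(\<lambda>s. W (max 0 s) \<omega>) \<in> borel_measurable borel"
      using measurable_compose[OF measurable_Pair2'[OF \<omega>] brownian_motion_measurable[OF BM]] by simp
    show "(\<integral>s. indicator {0<..} s * v (W (max 0 s) \<omega>) * indicator {..<T} s \<partial>lborel) = enn2real (G' \<omega>) - K * T"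
      using nn_integral_shifted_truncation[of "\<lambda>s. indicator {0<..} s * v (W (max 0 s) \<omega>)" K T "\<lambda>s. g' s \<omega>"] K K0 T
      by (simp add: G'_def g'_def f_def indicator_def abs_mult)
  qed
  have "\<forall>\<^sub>F n in sequentially. T < t n"
    using t(2) by (simp add: filterlim_at_top_dense)
  then have "\<forall>\<^sub>F n in sequentially.
    (\<integral>\<omega>. \<phi> (\<integral>s. indicator {0<..<t n} s * v (X n (max 0 (min (t n) s)) \<omega>) * indicator {..<T} s \<partial>lborel) \<partial>Q n)
    = (\<integral>\<omega>. \<phi> (enn2real (G n \<omega>) - K * T) \<partial>Q n)"
  proof eventually_elim
    case (elim n)
    show ?case
    proof (intro Bochner_Integration.integral_cong refl arg_cong[where f = \<phi>])
      fix \<omega> assume \<omega>: "\<omega> \<in> space (Q n)"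
      have [measurable]: "(\<lambda>s. X n (max 0 (min (t n) s)) \<omega>) \<in> borel_measurable borel"
        using measurable_compose[OF measurable_Pair2'[OF \<omega>] brownian_bridge_measurable[OF BB t_pos]] by simp
      show "(\<integral>s. indicator {0<..<t n} s * v (X n (max 0 (min (t n) s)) \<omega>) * indicator {..<T} s \<partial>lborel) = enn2real (G n \<omega>) - K * T"
        using nn_integral_shifted_truncation[of "\<lambda>s. indicator {0<..<t n} s * v (X n (max 0 (min (t n) s)) \<omega>)" K T "\<lambda>s. g n s \<omega>"] K K0 T elim
        by (simp add: G_def g_def f_def indicator_def abs_mult)
    qed
  qed
  with main eq' show ?thesis by (simp add: tendsto_cong)
qed

text \<open>The truncated expectations converge, and truncation at T is uniformly harmless: the
  early tail is small by transience, the late one by decay of the potential at y n, and large values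
  by the uniform exponential moments.\<close>

lemma bridge_expectation_tendsto:
  fixes v :: "'a::euclidean_space \<Rightarrow> real" and \<phi> :: "real \<Rightarrow> real"
  assumes d: "3 \<le> DIM('a)"
    and v [measurable]: "v \<in> borel_measurable borel" and K: "\<And>u. \<bar>v u\<bar> \<le> K" and R: "\<And>u. v u \<noteq> 0 \<Longrightarrow> norm u \<le> R"
    and esc: "escaping_endpoints t x y x\<^sub>0 C\<^sub>y"
    and BB: "\<And>n. brownian_bridge (Q n) (t n) (x n) (y n) (X n)"
    and BM: "brownian_motion P x\<^sub>0 W"
    and b: "0 \<le> b" "b < \<beta>"
    and fin: "\<And>z. (\<Sum>k. ennreal (\<beta> ^ k) * pot_iter (\<lambda>u. ennreal \<bar>v u\<bar>) k z) < \<infinity>"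
    and \<phi>: "continuous_on UNIV \<phi>" and growth: "\<And>z. \<bar>\<phi> z\<bar> \<le> C * exp (b * \<bar>z\<bar>)"
  shows "integrable P (\<lambda>\<omega>. \<phi> (path_integral v {0..} W \<omega>))"
    and "(\<lambda>n. \<integral>\<omega>. \<phi> (path_integral v {0..t n} (X n) \<omega>) \<partial>Q n) \<longlonglongrightarrow> (\<integral>\<omega>. \<phi> (path_integral v {0..} W \<omega>) \<partial>P)"
proof -
  interpret escaping_endpoints t x y x\<^sub>0 C\<^sub>y by fact
  have t_pos: "0 < t n" for n using t(1)[of n] by simp
  have K0: "0 \<le> K" using K[of 0] by (rule order.trans[OF abs_ge_zero])
  have Q: "prob_space (Q n)" for n using BB[of n] by (simp add: brownian_bridge_def)
  have P: "prob_space P" using BM by (simp add: brownian_motion_def)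
  define f where "f u = ennreal \<bar>v u\<bar>" for u
  have f [measurable]: "f \<in> borel_measurable borel" unfolding f_def[abs_def] by measurable
  have f_le: "f u \<le> ennreal K * indicator (cball 0 R) u" for u
    using K[of u] R[of u] unfolding f_def by (cases "v u = 0") (auto intro: ennreal_leI)
  obtain C\<^sub>0 where "\<And>z. (\<Sum>k. ennreal (\<beta> ^ k) * pot_iter f k z) \<le> ennreal C\<^sub>0"
    by (rule sum_pot_iter_bounded[OF d f f_le, of \<beta>]) (use fin b K0 in \<open>auto simp: f_def[abs_def]\<close>)
  then have sum_le: "(\<Sum>k. ennreal (\<beta> ^ k) * pot_iter f k z) \<le> ennreal (max 0 C\<^sub>0)" for z
    by simp
  have pot_le: "ennreal (\<beta> ^ k) * pot_iter f k z \<le> ennreal (max 0 C\<^sub>0)" for k z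
  proof -
    have "(\<Sum>i\<in>{k}. ennreal (\<beta> ^ i) * pot_iter f i z) \<le> (\<Sum>i. ennreal (\<beta> ^ i) * pot_iter f i z)"
      by (rule sum_le_suminf) auto
    with sum_le[of z] show ?thesis by simp
  qed
  \<comment> \<open>An intermediate rate leaves room on both sides: \<beta> above b' absorbs the
    polynomial factor in the bridge moments, and b' above b absorbs the growth of \<phi>.\<close>
  define b' where "b' = (b + \<beta>) / 2"
  have b': "0 < b'" "b < b'" "b' < \<beta>" using b by (auto simp: b'_def)
  have two_powr: "1 \<le> 2 powr (real DIM('a) / 2)" by (intro ge_one_powr_ge_zero) auto
  have E': "exp ((norm (y n - x n))\<^sup>2 / (2 * t n)) \<le> weight_bound" for n
  proof -
    have "exp ((norm (y n - x n))\<^sup>2 / (2 * t n)) * 1 \<le> exp ((norm (y n - x n))\<^sup>2 / (2 * t n)) * 2 powr (real DIM('a) / 2)"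
      by (intro mult_left_mono two_powr) simp
    from order.trans[OF this weight_bound(2)[of n]] show ?thesis by simp
  qed
  obtain \<Gamma>\<^sub>1 where \<Gamma>\<^sub>1: "0 \<le> \<Gamma>\<^sub>1" "\<And>n. (\<integral>\<^sup>+\<omega>. exp_series b' (nn_path_integral f {0..t n} (X n) \<omega>) \<partial>Q n) \<le> ennreal \<Gamma>\<^sub>1"
  proof (rule brownian_bridge_exp_moment_le[OF f b'(1,3), of "max 0 C\<^sub>0" weight_bound])
    fix \<Gamma> assume \<Gamma>: "0 \<le> \<Gamma>" "\<And>(M :: 'b measure) t a y X. 0 < t \<Longrightarrow> brownian_bridge M t a y X \<Longrightarrow>
      exp ((norm (y - a))\<^sup>2 / (2 * t)) \<le> weight_bound \<Longrightarrow>
      (\<integral>\<^sup>+\<omega>. exp_series b' (nn_path_integral f {0..t} X \<omega>) \<partial>M) \<le> ennreal \<Gamma>"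
    show thesis by (rule that[OF \<Gamma>(1)]) (rule \<Gamma>(2)[OF t_pos BB E'])
  qed (use pot_le weight_bound(1) in auto)
  \<comment> \<open>One bound for the bridges and for the Brownian motion, so that both use the same
    modulus of \<phi>.\<close>
  define \<Gamma> where "\<Gamma> = max \<Gamma>\<^sub>1 C\<^sub>0"
  have \<Gamma>: "0 \<le> \<Gamma>" using \<Gamma>\<^sub>1(1) by (simp add: \<Gamma>_def)
  define V where "V n s \<omega> = indicator {0<..<t n} s * v (X n (max 0 (min (t n) s)) \<omega>)" for n s \<omega>
  define V' where "V' s \<omega> = indicator {0<..} s * v (W (max 0 s) \<omega>)" for s \<omega>
  have V_m: "(\<lambda>(s, \<omega>). V n s \<omega>) \<in> borel_measurable (borel \<Otimes>\<^sub>M Q n)" for n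
  proof -
    note brownian_bridge_measurable[OF BB t_pos, measurable]
    show ?thesis unfolding V_def by measurable
  qed
  have V'_m: "(\<lambda>(s, \<omega>). V' s \<omega>) \<in> borel_measurable (borel \<Otimes>\<^sub>M P)"
  proof -
    note brownian_motion_measurable[OF BM, measurable]
    show ?thesis unfolding V'_def by measurable
  qed
  have V_abs: "ennreal \<bar>V n s \<omega>\<bar> = indicator {0<..<t n} s * f (X n (max 0 (min (t n) s)) \<omega>)" for n s \<omega>
    by (auto simp: V_def f_def split: split_indicator)
  have V'_abs: "ennreal \<bar>V' s \<omega>\<bar> = indicator {0<..} s * f (W (max 0 s) \<omega>)" for s \<omega>
    by (auto simp: V'_def f_def split: split_indicator)
  have exp_V: "(\<integral>\<^sup>+\<omega>. exp_series b' (\<integral>\<^sup>+s. ennreal \<bar>V n s \<omega>\<bar> \<partial>lborel) \<partial>Q n) \<le> ennreal \<Gamma>" for n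
    unfolding V_abs nn_integral_drop_endpoints(2)[of "\<lambda>s. f (X n s _)" "t n", symmetric]
    by (rule order.trans[OF \<Gamma>\<^sub>1(2)]) (simp add: \<Gamma>_def ennreal_leI)
  have exp_V': "(\<integral>\<^sup>+\<omega>. exp_series b' (\<integral>\<^sup>+s. ennreal \<bar>V' s \<omega>\<bar> \<partial>lborel) \<partial>P) \<le> ennreal \<Gamma>"
  proof -
    have "(\<integral>\<^sup>+\<omega>. exp_series b' (\<integral>\<^sup>+s. ennreal \<bar>V' s \<omega>\<bar> \<partial>lborel) \<partial>P) = (\<Sum>k. ennreal (b' ^ k) * pot_iter f k x\<^sub>0)"
      unfolding V'_abs nn_integral_drop_endpoints(1)[of "\<lambda>s. f (W s _)", symmetric]
      using nn_exp_moment_eq(2)[OF BM _ b'(1), of "\<lambda>u. \<bar>v u\<bar>"] by (simp add: f_def[abs_def])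
    also have "\<dots> \<le> (\<Sum>k. ennreal (\<beta> ^ k) * pot_iter f k x\<^sub>0)"
      using b' by (intro suminf_le mult_right_mono ennreal_leI power_mono) auto
    also have "\<dots> \<le> ennreal \<Gamma>"
      using \<Gamma>\<^sub>1(1) by (intro order.trans[OF sum_le] ennreal_leI) (auto simp: \<Gamma>_def)
    finally show ?thesis .
  qed
  have Z_eq: "path_integral v {0..t n} (X n) \<omega> = (\<integral>s. V n s \<omega> \<partial>lborel)" if "\<omega> \<in> space (Q n)" for n \<omega>
    using measurable_compose[OF measurable_Pair2'[OF that] V_m]
    unfolding V_def by (intro path_integral_eq) simp
  have Y_eq: "path_integral v {0..} W \<omega> = (\<integral>s. V' s \<omega> \<partial>lborel)" if "\<omega> \<in> space P" for \<omega>
    using measurable_compose[OF measurable_Pair2'[OF that] V'_m]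
    unfolding V'_def by (intro path_integral_infinite_eq) simp
  have int_eq: "(\<integral>\<omega>. \<phi> (path_integral v {0..t n} (X n) \<omega>) \<partial>Q n) = (\<integral>\<omega>. \<phi> (\<integral>s. V n s \<omega> \<partial>lborel) \<partial>Q n)" for n
    by (intro Bochner_Integration.integral_cong refl) (simp add: Z_eq)
  have int_eq': "(\<integral>\<omega>. \<phi> (path_integral v {0..} W \<omega>) \<partial>P) = (\<integral>\<omega>. \<phi> (\<integral>s. V' s \<omega> \<partial>lborel) \<partial>P)"
    by (intro Bochner_Integration.integral_cong refl) (simp add: Y_eq)
  define vol where "vol = measure lborel (cball 0 R :: 'a set)"
  have vol: "emeasure lborel (cball 0 R :: 'a set) = ennreal vol" "0 \<le> vol"
    using emeasure_lborel_cball_finite[of "0::'a" R] unfolding vol_def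
    by (auto simp: emeasure_eq_ennreal_measure)
  have tail_small: "\<exists>T>0. weight_bound * (K * vol * heat_tail TYPE('a) T) \<le> \<eta>" if "0 < \<eta>" for \<eta>
  proof -
    have "((\<lambda>T. weight_bound * (K * vol * heat_tail TYPE('a) T)) \<longlongrightarrow> weight_bound * (K * vol * 0)) at_top"
      by (intro tendsto_intros heat_tail_tendsto_0[OF d])
    then have "\<forall>\<^sub>F T in at_top. weight_bound * (K * vol * heat_tail TYPE('a) T) < \<eta>"
      using that by (intro order_tendstoD(2)) auto
    with eventually_gt_at_top[of 0] have "\<forall>\<^sub>F T in at_top. 0 < T \<and> weight_bound * (K * vol * heat_tail TYPE('a) T) < \<eta>"
      by eventually_elim simp
    then show ?thesis by (auto simp: eventually_at_top_linorder intro: less_imp_le)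
  qed
  have tail_V': "(\<integral>\<^sup>+\<omega>. (\<integral>\<^sup>+s\<in>{T..}. ennreal \<bar>V' s \<omega>\<bar> \<partial>lborel) \<partial>P) \<le> ennreal (weight_bound * (K * vol * heat_tail TYPE('a) T))"
    if T: "0 < T" for T
  proof -
    have nn: "0 \<le> K * vol * heat_tail TYPE('a) T" using K0 vol(2) heat_tail_nonneg[OF d] by simp
    have "(\<integral>\<^sup>+\<omega>. (\<integral>\<^sup>+s\<in>{T..}. ennreal \<bar>V' s \<omega>\<bar> \<partial>lborel) \<partial>P) \<le> ennreal K * ennreal vol * ennreal (heat_tail TYPE('a) T)"
      unfolding V'_abs vol(1)[symmetric] by (rule brownian_motion_tail_le[OF BM f T d f_le])
    also have "\<dots> = ennreal (K * vol * heat_tail TYPE('a) T)"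
      using K0 vol(2) heat_tail_nonneg[OF d] by (simp add: ennreal_mult)
    \<comment> \<open>The factor is inserted so that one choice of T serves the Brownian motion and
      the bridges.\<close>
    also have "\<dots> \<le> ennreal (weight_bound * (K * vol * heat_tail TYPE('a) T))"
      using mult_right_mono[OF weight_bound(1) nn] by (intro ennreal_leI) simp
    finally show ?thesis .
  qed
  have tail_V: "\<forall>\<^sub>F n in sequentially. T < t n \<and>
      (\<integral>\<^sup>+\<omega>. (\<integral>\<^sup>+s\<in>{T..}. ennreal \<bar>V n s \<omega>\<bar> \<partial>lborel) \<partial>Q n) \<le> ennreal (weight_bound * (K * vol * heat_tail TYPE('a) T) + \<eta>)"
    if T: "0 < T" and \<eta>: "0 < \<eta>" for T \<eta>
  proof -
    have "(\<lambda>n. ennreal weight_bound * pot f (y n)) \<longlonglongrightarrow> ennreal weight_bound * 0"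
      by (intro tendsto_mult_ennreal tendsto_const pot_tendsto_0[OF d f f_le y(1)]) auto
    then have "\<forall>\<^sub>F n in sequentially. ennreal weight_bound * pot f (y n) < ennreal \<eta>"
      using \<eta> by (intro order_tendstoD(2)) auto
    moreover have "\<forall>\<^sub>F n in sequentially. T < t n"
      using t(2) by (simp add: filterlim_at_top_dense)
    ultimately show ?thesis
    proof eventually_elim
      case (elim n)
      have nn: "0 \<le> K * vol * heat_tail TYPE('a) T" using K0 vol(2) heat_tail_nonneg[OF d] by simp
      have "(\<integral>\<^sup>+\<omega>. (\<integral>\<^sup>+s\<in>{T..}. ennreal \<bar>V n s \<omega>\<bar> \<partial>lborel) \<partial>Q n)
        \<le> (\<integral>\<^sup>+\<omega>. (nn_path_integral f {T..t n} (X n) \<omega>) \<partial>Q n)"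
        unfolding V_abs using T by (intro nn_integral_mono) (auto split: split_indicator)
      also have "\<dots> \<le> ennreal (exp ((norm (y n - x n))\<^sup>2 / (2 * t n)) * 2 powr (real DIM('a) / 2)) *
          (ennreal K * ennreal vol * ennreal (heat_tail TYPE('a) T) + pot f (y n))"
        unfolding vol(1)[symmetric] by (rule brownian_bridge_tail_le[OF BB f T elim(2) d f_le])
      also have "\<dots> \<le> ennreal weight_bound * (ennreal K * ennreal vol * ennreal (heat_tail TYPE('a) T) + pot f (y n))"
        by (intro mult_right_mono ennreal_leI weight_bound) simp
      also have "\<dots> = ennreal (weight_bound * (K * vol * heat_tail TYPE('a) T)) + ennreal weight_bound * pot f (y n)"
        using K0 vol(2) heat_tail_nonneg[OF d] weight_bound(1) by (simp add: ennreal_mult distrib_left)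
      also have "\<dots> \<le> ennreal (weight_bound * (K * vol * heat_tail TYPE('a) T)) + ennreal \<eta>"
        using elim(1) by (intro add_left_mono) auto
      also have "\<dots> = ennreal (weight_bound * (K * vol * heat_tail TYPE('a) T) + \<eta>)"
        using nn weight_bound(1) \<eta> by (subst ennreal_plus) auto
      finally show ?case using elim(2) by simp
    qed
  qed
  have "integrable P (\<lambda>\<omega>. \<phi> (\<integral>s. V' s \<omega> \<partial>lborel))"
  proof -
    \<comment> \<open>For integrability any modulus will do, hence \<epsilon> = 1 and T = 1.\<close>
    obtain L c where Lc: "0 \<le> L" "0 \<le> c"
      "\<And>(z::real) z' s d. \<bar>z\<bar> \<le> s \<Longrightarrow> \<bar>z'\<bar> \<le> s \<Longrightarrow> \<bar>z - z'\<bar> \<le> d \<Longrightarrow> \<bar>\<phi> z - \<phi> z'\<bar> \<le> 1 + L * d + c * exp (b' * s)"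
      by (rule exponential_growth_modulus[OF \<phi> growth b(1) b'(2), of 1 \<Gamma>]) (use \<Gamma> in auto)
    have "0 \<le> weight_bound * (K * vol * heat_tail TYPE('a) 1)"
      using weight_bound(1) K0 vol(2) heat_tail_nonneg[OF d] by simp
    then show ?thesis
      by (intro truncation_error(1)[OF P V'_m \<phi> growth b(1) b'(2) Lc(3) _ Lc(1,2) _ \<Gamma> exp_V' tail_V'[of 1]]) auto
  qed
  also have "?this \<longleftrightarrow> integrable P (\<lambda>\<omega>. \<phi> (path_integral v {0..} W \<omega>))"
    by (intro Bochner_Integration.integrable_cong refl) (simp add: Y_eq)
  finally show "integrable P (\<lambda>\<omega>. \<phi> (path_integral v {0..} W \<omega>))" .
  show "(\<lambda>n. \<integral>\<omega>. \<phi> (path_integral v {0..t n} (X n) \<omega>) \<partial>Q n) \<longlonglongrightarrow> (\<integral>\<omega>. \<phi> (path_integral v {0..} W \<omega>) \<partial>P)"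
    unfolding int_eq int_eq'
  proof (rule tendstoI)
    fix e :: real assume "0 < e"
    \<comment> \<open>Each of the two truncations costs at most 3 \<epsilon> and the truncated limit
      less than \<epsilon>, in total less than 8 \<epsilon>.\<close>
    define \<epsilon> where "\<epsilon> = e / 8"
    have \<epsilon>: "0 < \<epsilon>" using \<open>0 < e\<close> by (simp add: \<epsilon>_def)
    obtain L c where Lc: "0 \<le> L" "0 \<le> c" "c * \<Gamma> \<le> \<epsilon>"
      "\<And>(z::real) z' s d. \<bar>z\<bar> \<le> s \<Longrightarrow> \<bar>z'\<bar> \<le> s \<Longrightarrow> \<bar>z - z'\<bar> \<le> d \<Longrightarrow> \<bar>\<phi> z - \<phi> z'\<bar> \<le> \<epsilon> + L * d + c * exp (b' * s)"
      by (rule exponential_growth_modulus[OF \<phi> growth b(1) b'(2) \<epsilon> \<Gamma>]) auto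
    \<comment> \<open>This gives L \<eta> \<le> \<epsilon>, also when L = 0. Half of \<eta> is spent
      on the transience tail and half on the potential at y n.\<close>
    define \<eta> where "\<eta> = \<epsilon> / (L + 1)"
    have \<eta>: "0 < \<eta>" "L * \<eta> \<le> \<epsilon>" using \<epsilon> Lc(1) by (auto simp: \<eta>_def field_simps)
    obtain T where T: "0 < T" "weight_bound * (K * vol * heat_tail TYPE('a) T) \<le> \<eta> / 2"
      using tail_small[of "\<eta> / 2"] \<eta>(1) by auto
    let ?A = "\<lambda>n. \<integral>\<omega>. \<phi> (\<integral>s. V n s \<omega> \<partial>lborel) \<partial>Q n" and ?A' = "\<integral>\<omega>. \<phi> (\<integral>s. V' s \<omega> \<partial>lborel) \<partial>P"
    let ?B = "\<lambda>n. \<integral>\<omega>. \<phi> (\<integral>s. V n s \<omega> * indicator {..<T} s \<partial>lborel) \<partial>Q n"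
      and ?B' = "\<integral>\<omega>. \<phi> (\<integral>s. V' s \<omega> * indicator {..<T} s \<partial>lborel) \<partial>P"
    have "(\<integral>\<^sup>+\<omega>. (\<integral>\<^sup>+s\<in>{T..}. ennreal \<bar>V' s \<omega>\<bar> \<partial>lborel) \<partial>P) \<le> ennreal \<eta>"
      using T \<eta>(1) by (intro order.trans[OF tail_V'] ennreal_leI) auto
    from truncation_error(2)[OF P V'_m \<phi> growth b(1) b'(2) Lc(4) _ Lc(1,2) _ \<Gamma> exp_V' this] \<epsilon> \<eta>
    have A': "\<bar>?A' - ?B'\<bar> \<le> 3 * \<epsilon>" using Lc(3) by simp
    have "(\<lambda>n. ?B n) \<longlonglongrightarrow> ?B'"
      unfolding V_def V'_def by (rule bridge_truncated_tendsto[OF v K esc BB BM \<phi> T(1)])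
    from tendstoD[OF this \<epsilon>] have "\<forall>\<^sub>F n in sequentially. dist (?B n) ?B' < \<epsilon>" .
    with tail_V[OF T(1), of "\<eta> / 2"] \<eta>(1)
    show "\<forall>\<^sub>F n in sequentially. dist (?A n) ?A' < e"
    proof (elim eventually_elim2, simp)
      fix n
      assume tail: "T < t n \<and> (\<integral>\<^sup>+\<omega>. (\<integral>\<^sup>+s\<in>{T..}. ennreal \<bar>V n s \<omega>\<bar> \<partial>lborel) \<partial>Q n) \<le> ennreal (weight_bound * (K * vol * heat_tail TYPE('a) T) + \<eta> / 2)"
        and B: "dist (?B n) ?B' < \<epsilon>"
      have "(\<integral>\<^sup>+\<omega>. (\<integral>\<^sup>+s\<in>{T..}. ennreal \<bar>V n s \<omega>\<bar> \<partial>lborel) \<partial>Q n) \<le> ennreal \<eta>"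
        using T(2) by (intro order.trans[OF conjunct2[OF tail]] ennreal_leI) auto
      from truncation_error(2)[OF Q V_m \<phi> growth b(1) b'(2) Lc(4) _ Lc(1,2) _ \<Gamma> exp_V this] \<epsilon> \<eta>
      have "\<bar>?A n - ?B n\<bar> \<le> 3 * \<epsilon>" using Lc(3) by simp
      with A' B show "dist (?A n) ?A' < e"
        unfolding dist_real_def \<epsilon>_def using \<open>0 < e\<close> by linarith
    qed
  qed
qed

section \<open>From sequences of durations to the limit along all t\<close>

lemma power_le_exp:
  fixes b z :: real
  assumes "0 < b"
  shows "\<bar>z ^ k\<bar> \<le> fact k / b ^ k * exp (b * \<bar>z\<bar>)"
proof -
  have "(\<lambda>n. (b * \<bar>z\<bar>) ^ n / fact n) sums exp (b * \<bar>z\<bar>)"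
    using exp_converges[of "b * \<bar>z\<bar>"] by (simp add: divide_inverse mult.commute)
  note sums = this
  have "(\<Sum>n\<in>{k}. (b * \<bar>z\<bar>) ^ n / fact n) \<le> (\<Sum>n. (b * \<bar>z\<bar>) ^ n / fact n)"
    using assms by (intro sum_le_suminf sums_summable[OF sums]) auto
  then have "(b * \<bar>z\<bar>) ^ k / fact k \<le> exp (b * \<bar>z\<bar>)"
    unfolding sums_unique[OF sums, symmetric] by simp
  then show ?thesis
    using assms by (simp add: power_mult_distrib power_abs field_simps)
qed

text \<open>A limit at infinity may be tested on sequences. Dropping finitely many terms of a
  sequence gives t n \<ge> 1 and the bound on |y|^2 / t throughout.\<close>

lemma bridge_expectation_tendsto_at_top:
  fixes v :: "'a::euclidean_space \<Rightarrow> real" and \<phi> :: "real \<Rightarrow> real"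
  assumes d: "3 \<le> DIM('a)"
    and v [measurable]: "v \<in> borel_measurable borel" and K: "\<And>u. \<bar>v u\<bar> \<le> K" and R: "\<And>u. v u \<noteq> 0 \<Longrightarrow> norm u \<le> R"
    and x: "(x \<longlongrightarrow> x\<^sub>0) at_top" and y: "filterlim (\<lambda>t. norm (y t)) at_top at_top"
    and y_t: "\<forall>\<^sub>F t in at_top. (norm (y t))\<^sup>2 / t \<le> C\<^sub>y"
    and BB: "\<And>t. 0 < t \<Longrightarrow> brownian_bridge (Q t) t (x t) (y t) (X t)"
    and BM: "\<And>z. brownian_motion (P z) z (W z)"
    and b: "0 \<le> b" "b < \<beta>"
    and fin: "\<And>z. nn_exp_moment (P z) \<beta> (\<lambda>u. \<bar>v u\<bar>) (W z) < \<infinity>"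
    and \<phi>: "continuous_on UNIV \<phi>" and growth: "\<And>z. \<bar>\<phi> z\<bar> \<le> C * exp (b * \<bar>z\<bar>)"
  shows "integrable (P x\<^sub>0) (\<lambda>\<omega>. \<phi> (path_integral v {0..} (W x\<^sub>0) \<omega>)) \<and>
    ((\<lambda>t. \<integral>\<omega>. \<phi> (path_integral v {0..t} (X t) \<omega>) \<partial>Q t) \<longlongrightarrow> (\<integral>\<omega>. \<phi> (path_integral v {0..} (W x\<^sub>0) \<omega>) \<partial>P x\<^sub>0)) at_top"
proof -
  have fin': "(\<Sum>k. ennreal (\<beta> ^ k) * pot_iter (\<lambda>u. ennreal \<bar>v u\<bar>) k z) < \<infinity>" for z
    using fin[of z] nn_exp_moment_eq(1)[OF BM _ le_less_trans[OF b], of "\<lambda>u. \<bar>v u\<bar>" z] by simp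
  obtain t\<^sub>0 where t\<^sub>0: "\<And>t. t\<^sub>0 \<le> t \<Longrightarrow> (norm (y t))\<^sup>2 / t \<le> C\<^sub>y"
    using y_t by (auto simp: eventually_at_top_linorder)
  have key: "integrable (P x\<^sub>0) (\<lambda>\<omega>. \<phi> (path_integral v {0..} (W x\<^sub>0) \<omega>))"
    "(\<lambda>n. \<integral>\<omega>. \<phi> (path_integral v {0..t n} (X (t n)) \<omega>) \<partial>Q (t n)) \<longlonglongrightarrow> (\<integral>\<omega>. \<phi> (path_integral v {0..} (W x\<^sub>0) \<omega>) \<partial>P x\<^sub>0)"
    if t: "filterlim t at_top sequentially" "\<And>n. 1 \<le> t n" "\<And>n. t\<^sub>0 \<le> t n" for t :: "nat \<Rightarrow> real"
  proof -
    have esc: "escaping_endpoints t (\<lambda>n. x (t n)) (\<lambda>n. y (t n)) x\<^sub>0 C\<^sub>y"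
      by unfold_locales (use t t\<^sub>0 filterlim_compose[OF x t(1)] filterlim_compose[OF y t(1)] in auto)
    have BB': "brownian_bridge (Q (t n)) (t n) (x (t n)) (y (t n)) (X (t n))" for n
      using t(2)[of n] by (intro BB) simp
    show "integrable (P x\<^sub>0) (\<lambda>\<omega>. \<phi> (path_integral v {0..} (W x\<^sub>0) \<omega>))"
      by (rule bridge_expectation_tendsto(1)[OF d v K R esc BB' BM b fin' \<phi> growth])
    show "(\<lambda>n. \<integral>\<omega>. \<phi> (path_integral v {0..t n} (X (t n)) \<omega>) \<partial>Q (t n)) \<longlonglongrightarrow> (\<integral>\<omega>. \<phi> (path_integral v {0..} (W x\<^sub>0) \<omega>) \<partial>P x\<^sub>0)"
      by (rule bridge_expectation_tendsto(2)[OF d v K R esc BB' BM b fin' \<phi> growth])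
  qed
  have "integrable (P x\<^sub>0) (\<lambda>\<omega>. \<phi> (path_integral v {0..} (W x\<^sub>0) \<omega>))"
  \<comment> \<open>Integrability under Brownian motion does not mention t; one admissible sequence
    is exhibited to obtain it.\<close>
  proof (rule key(1))
    show "filterlim (\<lambda>n. max 1 t\<^sub>0 + real n) at_top sequentially"
      by (intro filterlim_tendsto_add_at_top[OF tendsto_const] filterlim_real_sequentially)
  qed auto
  moreover have "((\<lambda>t. \<integral>\<omega>. \<phi> (path_integral v {0..t} (X t) \<omega>) \<partial>Q t) \<longlongrightarrow> (\<integral>\<omega>. \<phi> (path_integral v {0..} (W x\<^sub>0) \<omega>) \<partial>P x\<^sub>0)) at_top"
  proof (rule tendsto_at_topI_sequentially)
    fix t :: "nat \<Rightarrow> real" assume t: "filterlim t at_top sequentially"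
    then obtain N where N: "\<And>n. N \<le> n \<Longrightarrow> max 1 t\<^sub>0 \<le> t n"
      unfolding filterlim_at_top eventually_sequentially by blast
    have "filterlim (\<lambda>n. t (n + N)) at_top sequentially"
      by (rule filterlim_compose[OF t filterlim_add_const_nat_at_top])
    moreover have "1 \<le> t (n + N)" "t\<^sub>0 \<le> t (n + N)" for n using N[of "n + N"] by auto
    ultimately have "(\<lambda>n. \<integral>\<omega>. \<phi> (path_integral v {0..t (n + N)} (X (t (n + N))) \<omega>) \<partial>Q (t (n + N)))
        \<longlonglongrightarrow> (\<integral>\<omega>. \<phi> (path_integral v {0..} (W x\<^sub>0) \<omega>) \<partial>P x\<^sub>0)"
      by (rule key(2))
    then show "(\<lambda>n. \<integral>\<omega>. \<phi> (path_integral v {0..t n} (X (t n)) \<omega>) \<partial>Q (t n))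
        \<longlonglongrightarrow> (\<integral>\<omega>. \<phi> (path_integral v {0..} (W x\<^sub>0) \<omega>) \<partial>P x\<^sub>0)"
      by (rule LIMSEQ_offset)
  qed
  ultimately show ?thesis ..
qed

theorem theorem2:
  fixes v :: "real ^ 'n \<Rightarrow> real"
    and x y :: "real \<Rightarrow> real ^ 'n"
    and x\<^sub>0 :: "real ^ 'n"
    and Q :: "real \<Rightarrow> 'b measure"
    and X :: "real \<Rightarrow> real \<Rightarrow> 'b \<Rightarrow> real ^ 'n"
    and P :: "real ^ 'n \<Rightarrow> 'a measure"
    and W :: "real ^ 'n \<Rightarrow> real \<Rightarrow> 'a \<Rightarrow> real ^ 'n"
    and \<alpha>\<^sub>0 :: real
    and Z :: "real \<Rightarrow> 'b \<Rightarrow> real"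
    and Y :: "real ^ 'n \<Rightarrow> 'a \<Rightarrow> real"
  assumes "CARD('n) \<ge> 3"
    and "v \<in> borel_measurable borel"
    and "bounded (range v)"
    and "bounded {u. v u \<noteq> 0}"
    and "(x \<longlongrightarrow> x\<^sub>0) at_top"
    and "filterlim (\<lambda>t. norm (y t)) at_top at_top"
    and "\<exists>C. \<forall>\<^sub>F t in at_top. (norm (y t))\<^sup>2 / t \<le> C"
    and "\<And>t. t > 0 \<Longrightarrow> brownian_bridge (Q t) t (x t) (y t) (X t)"
    and "\<And>z. brownian_motion (P z) z (W z)"
    and "\<And>t \<omega>. Z t \<omega> = path_integral v {0..t} (X t) \<omega>"
    and "\<And>z \<omega>. Y z \<omega> = path_integral v {0..} (W z) \<omega>"
    and "\<alpha>\<^sub>0 > 0"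
    and "\<And>\<alpha> z. \<bar>\<alpha>\<bar> < \<alpha>\<^sub>0 \<Longrightarrow> nn_exp_moment (P z) \<alpha> (\<lambda>u. \<bar>v u\<bar>) (W z) < \<infinity>"
  shows "(\<forall>k::nat. k \<ge> 1 \<longrightarrow>
            integrable (P x\<^sub>0) (\<lambda>\<omega>. Y x\<^sub>0 \<omega> ^ k) \<and>
            ((\<lambda>t. \<integral>\<omega>. Z t \<omega> ^ k \<partial>Q t) \<longlongrightarrow> (\<integral>\<omega>. Y x\<^sub>0 \<omega> ^ k \<partial>P x\<^sub>0)) at_top)
       \<and> (\<forall>\<alpha>. - \<alpha>\<^sub>0 < \<alpha> \<and> \<alpha> < \<alpha>\<^sub>0 \<longrightarrow>
            integrable (P x\<^sub>0) (\<lambda>\<omega>. exp (\<alpha> * Y x\<^sub>0 \<omega>)) \<and>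
            ((\<lambda>t. \<integral>\<omega>. exp (\<alpha> * Z t \<omega>) \<partial>Q t) \<longlongrightarrow> (\<integral>\<omega>. exp (\<alpha> * Y x\<^sub>0 \<omega>) \<partial>P x\<^sub>0)) at_top)
       \<and> ((\<forall>u. 0 \<le> v u) \<and> \<not> (AE u in lborel. v u = 0) \<longrightarrow>
            (\<forall>\<alpha>\<^sub>1>0.
               (\<forall>\<alpha><\<alpha>\<^sub>1. \<forall>z. nn_exp_moment (P z) \<alpha> v (W z) < \<infinity>) \<and>
               (\<forall>\<alpha>>\<alpha>\<^sub>1. \<forall>z. nn_exp_moment (P z) \<alpha> v (W z) = \<infinity>) \<longrightarrow>
               (\<forall>\<alpha><\<alpha>\<^sub>1.
                  integrable (P x\<^sub>0) (\<lambda>\<omega>. exp (\<alpha> * Y x\<^sub>0 \<omega>)) \<and>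
                  ((\<lambda>t. \<integral>\<omega>. exp (\<alpha> * Z t \<omega>) \<partial>Q t) \<longlongrightarrow> (\<integral>\<omega>. exp (\<alpha> * Y x\<^sub>0 \<omega>) \<partial>P x\<^sub>0)) at_top)))"
proof -
  obtain K where K: "\<And>u. \<bar>v u\<bar> \<le> K"
    using assms(3) by (auto simp: bounded_iff)
  obtain R where R: "\<And>u. v u \<noteq> 0 \<Longrightarrow> norm u \<le> R"
    using assms(4) by (auto simp: bounded_iff)
  obtain C where C: "\<forall>\<^sub>F t in at_top. (norm (y t))\<^sup>2 / t \<le> C"
    using assms(7) by blast
  have d: "3 \<le> DIM(real ^ 'n)" using assms(1) by simp
  note Z = assms(10) and Y = assms(11)
  have lim: "integrable (P x\<^sub>0) (\<lambda>\<omega>. \<phi> (Y x\<^sub>0 \<omega>)) \<and>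
      ((\<lambda>t. \<integral>\<omega>. \<phi> (Z t \<omega>) \<partial>Q t) \<longlongrightarrow> (\<integral>\<omega>. \<phi> (Y x\<^sub>0 \<omega>) \<partial>P x\<^sub>0)) at_top"
    if "0 \<le> b" "b < \<beta>" "\<And>z. nn_exp_moment (P z) \<beta> (\<lambda>u. \<bar>v u\<bar>) (W z) < \<infinity>"
      "continuous_on UNIV \<phi>" "\<And>z. \<bar>\<phi> z\<bar> \<le> D * exp (b * \<bar>z\<bar>)" for b \<beta> D :: real and \<phi>
    unfolding Z Y
    by (rule bridge_expectation_tendsto_at_top[OF d assms(2) K R assms(5,6) C assms(8,9) that])
  have exp_lim: "integrable (P x\<^sub>0) (\<lambda>\<omega>. exp (\<alpha> * Y x\<^sub>0 \<omega>)) \<and>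
      ((\<lambda>t. \<integral>\<omega>. exp (\<alpha> * Z t \<omega>) \<partial>Q t) \<longlongrightarrow> (\<integral>\<omega>. exp (\<alpha> * Y x\<^sub>0 \<omega>) \<partial>P x\<^sub>0)) at_top"
    if "\<bar>\<alpha>\<bar> < a" and "\<And>\<beta> z. \<bar>\<beta>\<bar> < a \<Longrightarrow> nn_exp_moment (P z) \<beta> (\<lambda>u. \<bar>v u\<bar>) (W z) < \<infinity>" for \<alpha> a
  \<comment> \<open>The midpoint of |\<alpha>| and a is a rate above the growth of exp(\<alpha> z)
    at which the exponential moment is still finite.\<close>
  proof (rule lim[where b = "\<bar>\<alpha>\<bar>" and \<beta> = "(\<bar>\<alpha>\<bar> + a) / 2" and D = 1])
    show "nn_exp_moment (P z) ((\<bar>\<alpha>\<bar> + a) / 2) (\<lambda>u. \<bar>v u\<bar>) (W z) < \<infinity>" for z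
      using that(1) by (intro that(2)) auto
    show "\<bar>exp (\<alpha> * z)\<bar> \<le> 1 * exp (\<bar>\<alpha>\<bar> * \<bar>z\<bar>)" for z
      using abs_ge_self[of "\<alpha> * z"] by (simp add: abs_mult)
  qed (use that(1) in \<open>auto intro!: continuous_intros\<close>)
  have moments: "integrable (P x\<^sub>0) (\<lambda>\<omega>. Y x\<^sub>0 \<omega> ^ k) \<and>
      ((\<lambda>t. \<integral>\<omega>. Z t \<omega> ^ k \<partial>Q t) \<longlongrightarrow> (\<integral>\<omega>. Y x\<^sub>0 \<omega> ^ k \<partial>P x\<^sub>0)) at_top" for k
  \<comment> \<open>Powers grow more slowly than any exponential; the two rates are any choice with
    0 < b < \<beta> < \<open>\<alpha>\<^sub>0\<close>.\<close>
  proof (rule lim[where b = "\<alpha>\<^sub>0 / 4" and \<beta> = "\<alpha>\<^sub>0 / 2" and D = "fact k / (\<alpha>\<^sub>0 / 4) ^ k"])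
    show "nn_exp_moment (P z) (\<alpha>\<^sub>0 / 2) (\<lambda>u. \<bar>v u\<bar>) (W z) < \<infinity>" for z
      using assms(12) by (intro assms(13)) auto
    show "\<bar>z ^ k\<bar> \<le> fact k / (\<alpha>\<^sub>0 / 4) ^ k * exp (\<alpha>\<^sub>0 / 4 * \<bar>z\<bar>)" for z
      using assms(12) by (intro power_le_exp) simp
  qed (use assms(12) in \<open>auto intro!: continuous_intros\<close>)
  have nonneg_lim: "integrable (P x\<^sub>0) (\<lambda>\<omega>. exp (\<alpha> * Y x\<^sub>0 \<omega>)) \<and>
      ((\<lambda>t. \<integral>\<omega>. exp (\<alpha> * Z t \<omega>) \<partial>Q t) \<longlongrightarrow> (\<integral>\<omega>. exp (\<alpha> * Y x\<^sub>0 \<omega>) \<partial>P x\<^sub>0)) at_top"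
    if v0: "\<And>u. 0 \<le> v u" and "0 < \<alpha>\<^sub>1" and fin: "\<And>\<beta> z. \<beta> < \<alpha>\<^sub>1 \<Longrightarrow> nn_exp_moment (P z) \<beta> v (W z) < \<infinity>" and "\<alpha> < \<alpha>\<^sub>1" for \<alpha> \<alpha>\<^sub>1
  proof -
    have abs_v: "(\<lambda>u. \<bar>v u\<bar>) = v" using v0 by auto
    show ?thesis
    proof (cases "0 \<le> \<alpha>")
      case True
      then show ?thesis using that by (intro exp_lim[of \<alpha> \<alpha>\<^sub>1]) (auto simp: abs_v)
    next
      case False
      have nonneg: "0 \<le> path_integral v A X \<omega>" for A X \<omega>
        unfolding path_integral_def set_lebesgue_integral_def
        using v0 by (intro Bochner_Integration.integral_nonneg) auto
      \<comment> \<open>Since the path integrals are nonnegative, the unbounded function exp (\<alpha> z) may be cut off at 1.\<close>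
      have cut: "min 1 (exp (\<alpha> * w)) = exp (\<alpha> * w)" if "0 \<le> w" for w
        using False that mult_nonpos_nonneg[of \<alpha> w] by (intro min_absorb2) simp
      have Z_cut: "min 1 (exp (\<alpha> * Z t \<omega>)) = exp (\<alpha> * Z t \<omega>)" for t \<omega>
        unfolding Z by (rule cut[OF nonneg])
      have Y_cut: "min 1 (exp (\<alpha> * Y z \<omega>)) = exp (\<alpha> * Y z \<omega>)" for z \<omega>
        unfolding Y by (rule cut[OF nonneg])
      have "integrable (P x\<^sub>0) (\<lambda>\<omega>. min 1 (exp (\<alpha> * Y x\<^sub>0 \<omega>))) \<and>
          ((\<lambda>t. \<integral>\<omega>. min 1 (exp (\<alpha> * Z t \<omega>)) \<partial>Q t) \<longlongrightarrow> (\<integral>\<omega>. min 1 (exp (\<alpha> * Y x\<^sub>0 \<omega>)) \<partial>P x\<^sub>0)) at_top"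
      \<comment> \<open>The cut-off function is bounded by 1, so growth rate 0 suffices and a finite
        moment at some positive rate below \<open>\<alpha>\<^sub>1\<close> is enough, however
        negative \<alpha> is.\<close>
      proof (rule lim[where b = 0 and \<beta> = "\<alpha>\<^sub>1 / 2" and D = 1])
        show "nn_exp_moment (P z) (\<alpha>\<^sub>1 / 2) (\<lambda>u. \<bar>v u\<bar>) (W z) < \<infinity>" for z
          unfolding abs_v using \<open>0 < \<alpha>\<^sub>1\<close> by (intro fin) simp
        show "continuous_on UNIV (\<lambda>z. min 1 (exp (\<alpha> * z)))"
          by (intro continuous_intros)
      qed (use \<open>0 < \<alpha>\<^sub>1\<close> in auto)
      then show ?thesis unfolding Z_cut Y_cut .
    qed
  qed
  show ?thesis
  proof (rule conjI[OF _ conjI]; intro allI impI)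
    fix \<alpha> assume "- \<alpha>\<^sub>0 < \<alpha> \<and> \<alpha> < \<alpha>\<^sub>0"
    then have "\<bar>\<alpha>\<bar> < \<alpha>\<^sub>0" by auto
    then show "integrable (P x\<^sub>0) (\<lambda>\<omega>. exp (\<alpha> * Y x\<^sub>0 \<omega>)) \<and>
      ((\<lambda>t. \<integral>\<omega>. exp (\<alpha> * Z t \<omega>) \<partial>Q t) \<longlongrightarrow> (\<integral>\<omega>. exp (\<alpha> * Y x\<^sub>0 \<omega>) \<partial>P x\<^sub>0)) at_top"
      by (rule exp_lim[OF _ assms(13)])
  qed (use moments nonneg_lim in blast)+
qed

end
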